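(* For every $k>0$, every mesh $\mathcal{T}_h$ (with $h_e>0$), and all penalty parameters with $\gamma_{0,e}>0$, $\gamma_{1,e}\ge0$ and $\beta_{1,e}\ge0$, and for every $f\in L^2(\Omega)$, $g\in L^2(\Gamma_R)$, the (symmetric, i.e. $\sigma=1$) IPDG method: find $u_h\in V^h$ such that $$a_h(u_h,v_h)-k^2(u_h,v_h)+\mathbf{i}k\langle u_h,v_h\rangle_{\Gamma_R}=(f,v_h)+\langle g,v_h\rangle_{\Gamma_R}\qquad\forall v_h\in V^h,$$ has a unique solution.
   Context: Domain. $d\in\{2,3\}$; $\Omega_1\subset\mathbf{R}^d$ is a bounded polygonal/polyhedral domain, $D\subset\Omega_1$ is the scatterer (polygonal/polyhedral so that $\Omega$ can be triangulated; $D=\emptyset$ is allowed, then $\Gamma_D=\emptyset$), $\Omega:=\Omega_1\setminus D$, $\Gamma_R:=\partial\Omega_1$, $\Gamma_D:=\partial D$, so $\partial\Omega=\Gamma_R\cup\Gamma_D$. Standing assumption: there are a point $x_{\Omega_1}$ and constants $c_{\Omega_1}>0$, $c_D\ge0$ with $(x-x_{\Omega_1})\cdot n_\Omega\ge c_{\Omega_1}$ on $\Gamma_R$ and $(x-x_{\Omega_1})\cdot n_D\ge c_D$ on $\Gamma_D$, where $n_\Omega,n_D$ are the unit outward normals to $\Omega$ and $D$. Mesh. $\mathcal{T}_h$ is a triangulation of $\Omega$ into triangles/tetrahedra (satisfying the minimal angle condition); $h_e=\mathrm{diam}(e)$ for an edge/face $e$. $\mathcal{E}_h^I$, $\mathcal{E}_h^D$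 are the sets of interior edges/faces and those on $\Gamma_D$; $\mathcal{E}_h^{ID}=\mathcal{E}_h^I\cup\mathcal{E}_h^D$. For $e=\partial K\cap\partial K'\in\mathcal{E}_h^I$ with $K$ having the bigger global label: $[v]=v|_K-v|_{K'}$, $\{v\}=\frac12(v|_K+v|_{K'})$, $n_e$ = unit outward normal of $K$ on $e$. For $e\in\mathcal{E}_h^D$: $[v]=\{v\}=v$, $n_e=n_\Omega$. $\{\tau_e^j\}_{j=1}^{d-1}$ is an orthonormal frame tangent to $e$, $\partial v/\partial\tau_e^j=\nabla v\cdot\tau_e^j$. Forms (all functions complex-valued; $L^2$ inner products $(\cdot,\cdot)$ on $\Omega$ and $\langle\cdot,\cdot\rangle_\Sigma$ on $\Sigma$ are conjugate-linear in the second argument). $V^h=\prod_{K\in\mathcal{T}_h}P_1(K)$ with $P_1(K)$ the (complex) polynomials of degree $\le1$. The form with $\sigma=1$ is $$a_h(u,v)=\sum_K(\nabla u,\nabla v)_K-\sum_{e\in\mathcal{E}_h^{ID}}\Big(\langle\{\tfrac{\partial u}{\partial n_e}\},[v]\rangle_e+\sigma\langle[u],\{\tfrac{\partial v}{\partial n_e}\}\rangle_e\Big)+\mathbf{i}\big(J_0(u,v)+J_1(u,v)+L_1(u,v)\big),$$ $$J_0(u,v)=\sum_{e\in\mathcal{E}_h^{ID}}\frac{\gamma_{0,e}}{h_e}\langle[u],[v]\rangle_e,\quad J_1(u,v)=\sum_{e\in\mathcal{E}_h^I}\gamma_{1,e}h_e\langle[\tfrac{\partial u}{\partial n_e}],[\tfrac{\partial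 v}{\partial n_e}]\rangle_e,\quad L_1(u,v)=\sum_{e\in\mathcal{E}_h^{ID}}\sum_{j=1}^{d-1}\frac{\beta_{1,e}}{h_e}\langle[\tfrac{\partial u}{\partial\tau_e^j}],[\tfrac{\partial v}{\partial\tau_e^j}]\rangle_e.$$ *)

theory Defs
  imports "HOL-Analysis.Analysis"
begin

section \<open>Polyhedral geometry\<close>

text \<open>
  The closure is a finite union of polytopes. The two inclusions exclude slits and lower-dimensional
  pieces, where no outward normal exists. They hold for open as well as for closed polyhedral
  bodies, and for the empty set.
\<close>

definition polyhedral_region :: "'a::euclidean_space set \<Rightarrow> bool" where
  "polyhedral_region S \<longleftrightarrow>
     (\<exists>P. finite P \<and> (\<forall>p\<in>P. polytope p) \<and> closure S = \<Union>P) \<and>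
     interior (closure S) \<subseteq> S \<and> S \<subseteq> closure (interior S)"

text \<open>
  \<open>n\<close> is the unit outward normal to \<open>S\<close> at the point \<open>x\<close>. For a polyhedral \<open>S\<close> the normal exists
  exactly at the flat boundary points, near which \<open>S\<close> is a half-space (up to boundary points);
  at edges and vertices there is no such \<open>n\<close>.
\<close>

definition outward_normal :: "'a::euclidean_space set \<Rightarrow> 'a \<Rightarrow> 'a \<Rightarrow> bool" where
  "outward_normal S x n \<longleftrightarrow> norm n = 1 \<and>
     (\<exists>r>0. \<forall>y\<in>ball x r. ((y - x) \<bullet> n < 0 \<longrightarrow> y \<in> S) \<and> ((y - x) \<bullet> n > 0 \<longrightarrow> y \<notin> S))"

definition unit_normal :: "'a::euclidean_space set \<Rightarrow> 'a set \<Rightarrow> 'a" where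
  "unit_normal S e = (THE n. \<forall>x\<in>rel_interior e. outward_normal S x n)"

definition tangent_space :: "'a::euclidean_space set \<Rightarrow> 'a set" where
  "tangent_space e = span {x - y |x y. x \<in> e \<and> y \<in> e}"

definition tangent_basis :: "'a::euclidean_space set \<Rightarrow> 'a set" where
  "tangent_basis e = (SOME B. pairwise orthogonal B \<and> (\<forall>b\<in>B. norm b = 1) \<and>
                              span B = tangent_space e)"

text \<open>
  The surface measure on a flat face \<open>e\<close>: Lebesgue measure of dimension \<open>aff_dim e\<close>, transported to
  the affine hull of \<open>e\<close> by the isometry \<open>t \<mapsto> p + (\<Sum>b. t b *\<^sub>R b)\<close>, completed and restricted to \<open>e\<close>.
  It depends neither on the orthonormal basis nor on the base point \<open>p\<close>.
\<close>

definition face_measure :: "'a::euclidean_space set \<Rightarrow> 'a measure" where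
  "face_measure e =
     restrict_space
       (completion
         (distr (PiM (tangent_basis e) (\<lambda>_. lborel :: real measure)) borel
           (\<lambda>t. (SOME p. p \<in> e) + (\<Sum>b\<in>tangent_basis e. t b *\<^sub>R b))))
       e"

section \<open>The spaces \<open>L\<^sup>2\<close>\<close>

definition L2_fun :: "'a measure \<Rightarrow> ('a \<Rightarrow> complex) \<Rightarrow> bool" where
  "L2_fun M f \<longleftrightarrow> f \<in> borel_measurable M \<and> integrable M (\<lambda>x. (cmod (f x))\<^sup>2)"

definition L2_inner :: "'a measure \<Rightarrow> ('a \<Rightarrow> complex) \<Rightarrow> ('a \<Rightarrow> complex) \<Rightarrow> complex" where
  "L2_inner M f g = (LINT x|M. f x * cnj (g x))"

section \<open>Meshes and faces\<close>

text \<open>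
  The library notion \<^const>\<open>triangulation\<close> requires finitely many simplices, any two meeting in a
  common face.
\<close>

definition mesh_of :: "'a::euclidean_space set set \<Rightarrow> 'a set \<Rightarrow> bool" where
  "mesh_of \<T> \<Omega> \<longleftrightarrow> triangulation \<T> \<and> (\<forall>K\<in>\<T>. int DIM('a) simplex K) \<and> \<Union>\<T> = closure \<Omega>"

definition interior_faces :: "'a::euclidean_space set set \<Rightarrow> 'a set set" where
  "interior_faces \<T> = {e. \<exists>K\<in>\<T>. \<exists>K'\<in>\<T>. K \<noteq> K' \<and> e = K \<inter> K' \<and> e facet_of K \<and> e facet_of K'}"

definition faces_on :: "'a::euclidean_space set set \<Rightarrow> 'a set \<Rightarrow> 'a set set" where
  "faces_on \<T> \<Gamma> = {e. (\<exists>K\<in>\<T>. e facet_of K) \<and> e \<subseteq> \<Gamma>}"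

text \<open>
  The elements adjacent to \<open>e\<close> with the bigger and with the smaller global label \<open>lab\<close>. On a boundary
  face both are the only adjacent element.
\<close>

definition upper_elem :: "'a::euclidean_space set set \<Rightarrow> ('a set \<Rightarrow> nat) \<Rightarrow> 'a set \<Rightarrow> 'a set" where
  "upper_elem \<T> lab e =
     (THE K. K \<in> \<T> \<and> e facet_of K \<and> (\<forall>K'\<in>\<T>. e facet_of K' \<longrightarrow> lab K' \<le> lab K))"

definition lower_elem :: "'a::euclidean_space set set \<Rightarrow> ('a set \<Rightarrow> nat) \<Rightarrow> 'a set \<Rightarrow> 'a set" where
  "lower_elem \<T> lab e =
     (THE K. K \<in> \<T> \<and> e facet_of K \<and> (\<forall>K'\<in>\<T>. e facet_of K' \<longrightarrow> lab K \<le> lab K'))"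

definition face_normal ::
  "'a::euclidean_space set \<Rightarrow> 'a set set \<Rightarrow> ('a set \<Rightarrow> nat) \<Rightarrow> 'a set \<Rightarrow> 'a" where
  "face_normal \<Omega> \<T> lab e =
     (if e \<in> interior_faces \<T> then unit_normal (upper_elem \<T> lab e) e else unit_normal \<Omega> e)"

definition orthonormal_tangent_frame :: "'a::euclidean_space set \<Rightarrow> (nat \<Rightarrow> 'a) \<Rightarrow> bool" where
  "orthonormal_tangent_frame e t \<longleftrightarrow>
     (\<forall>j\<in>{1..DIM('a) - 1}. t j \<in> tangent_space e) \<and>
     (\<forall>i\<in>{1..DIM('a) - 1}. \<forall>j\<in>{1..DIM('a) - 1}. t i \<bullet> t j = (if i = j then 1 else 0))"

section \<open>Piecewise linear functions\<close>

text \<open>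
  A piecewise function \<open>v\<close> is a family: \<open>v K\<close> is its branch on the element \<open>K\<close>. Elements have
  nonempty interior, so a polynomial on \<open>K\<close> is identified with its unique extension to the whole
  space.
\<close>

type_synonym 'a pw = "'a set \<Rightarrow> 'a \<Rightarrow> complex"

definition P1 :: "('a::euclidean_space \<Rightarrow> complex) set" where
  "P1 = {p. \<exists>a b. p = (\<lambda>x. a + (\<Sum>i\<in>Basis. b i * of_real (x \<bullet> i)))}"

definition Vh :: "'a::euclidean_space set set \<Rightarrow> 'a pw set" where
  "Vh \<T> = (\<T> \<rightarrow>\<^sub>E P1)"

definition pw_deriv :: "'a::euclidean_space \<Rightarrow> 'a pw \<Rightarrow> 'a pw" where
  "pw_deriv \<nu> v = (\<lambda>K x. frechet_derivative (v K) (at x) \<nu>)"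

definition jump ::
  "'a::euclidean_space set set \<Rightarrow> ('a set \<Rightarrow> nat) \<Rightarrow> 'a set \<Rightarrow> 'a pw \<Rightarrow> 'a \<Rightarrow> complex" where
  "jump \<T> lab e v x =
     (if e \<in> interior_faces \<T>
      then v (upper_elem \<T> lab e) x - v (lower_elem \<T> lab e) x
      else v (upper_elem \<T> lab e) x)"

definition avg ::
  "'a::euclidean_space set set \<Rightarrow> ('a set \<Rightarrow> nat) \<Rightarrow> 'a set \<Rightarrow> 'a pw \<Rightarrow> 'a \<Rightarrow> complex" where
  "avg \<T> lab e v x =
     (if e \<in> interior_faces \<T>
      then (v (upper_elem \<T> lab e) x + v (lower_elem \<T> lab e) x) / 2
      else v (upper_elem \<T> lab e) x)"

text \<open>
  Inner products over \<open>\<Omega>\<close> and over the part \<open>\<Gamma>\<close> of its boundary; elements and faces overlap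
  in null sets only. An ordinary function \<open>f\<close> is passed as the family \<open>\<lambda>_. f\<close>.
\<close>

definition mesh_inner :: "'a::euclidean_space set set \<Rightarrow> 'a pw \<Rightarrow> 'a pw \<Rightarrow> complex" where
  "mesh_inner \<T> u v = (\<Sum>K\<in>\<T>. L2_inner (lebesgue_on K) (u K) (v K))"

definition boundary_inner ::
  "'a::euclidean_space set set \<Rightarrow> ('a set \<Rightarrow> nat) \<Rightarrow> 'a set \<Rightarrow> 'a pw \<Rightarrow> 'a pw \<Rightarrow> complex" where
  "boundary_inner \<T> lab \<Gamma> u v =
     (\<Sum>e\<in>faces_on \<T> \<Gamma>.
        L2_inner (face_measure e) (u (upper_elem \<T> lab e)) (v (upper_elem \<T> lab e)))"

section \<open>The interior penalty form\<close>

definition J0 ::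
  "'a::euclidean_space set \<Rightarrow> 'a set set \<Rightarrow> ('a set \<Rightarrow> nat) \<Rightarrow> ('a set \<Rightarrow> real) \<Rightarrow>
   'a pw \<Rightarrow> 'a pw \<Rightarrow> complex" where
  "J0 \<Gamma>D \<T> lab \<gamma>0 u v =
     (\<Sum>e\<in>interior_faces \<T> \<union> faces_on \<T> \<Gamma>D.
        of_real (\<gamma>0 e / diameter e) *
        L2_inner (face_measure e) (jump \<T> lab e u) (jump \<T> lab e v))"

definition J1 ::
  "'a::euclidean_space set \<Rightarrow> 'a set set \<Rightarrow> ('a set \<Rightarrow> nat) \<Rightarrow> ('a set \<Rightarrow> real) \<Rightarrow>
   'a pw \<Rightarrow> 'a pw \<Rightarrow> complex" where
  "J1 \<Omega> \<T> lab \<gamma>1 u v =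
     (\<Sum>e\<in>interior_faces \<T>.
        of_real (\<gamma>1 e * diameter e) *
        L2_inner (face_measure e)
          (jump \<T> lab e (pw_deriv (face_normal \<Omega> \<T> lab e) u))
          (jump \<T> lab e (pw_deriv (face_normal \<Omega> \<T> lab e) v)))"

definition L1 ::
  "'a::euclidean_space set \<Rightarrow> 'a set set \<Rightarrow> ('a set \<Rightarrow> nat) \<Rightarrow> ('a set \<Rightarrow> nat \<Rightarrow> 'a) \<Rightarrow>
   ('a set \<Rightarrow> real) \<Rightarrow> 'a pw \<Rightarrow> 'a pw \<Rightarrow> complex" where
  "L1 \<Gamma>D \<T> lab \<tau> \<beta>1 u v =
     (\<Sum>e\<in>interior_faces \<T> \<union> faces_on \<T> \<Gamma>D. \<Sum>j=1..DIM('a) - 1.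
        of_real (\<beta>1 e / diameter e) *
        L2_inner (face_measure e)
          (jump \<T> lab e (pw_deriv (\<tau> e j) u))
          (jump \<T> lab e (pw_deriv (\<tau> e j) v)))"

definition a_h ::
  "'a::euclidean_space set \<Rightarrow> 'a set \<Rightarrow> 'a set set \<Rightarrow> ('a set \<Rightarrow> nat) \<Rightarrow> ('a set \<Rightarrow> nat \<Rightarrow> 'a) \<Rightarrow>
   real \<Rightarrow> ('a set \<Rightarrow> real) \<Rightarrow> ('a set \<Rightarrow> real) \<Rightarrow> ('a set \<Rightarrow> real) \<Rightarrow>
   'a pw \<Rightarrow> 'a pw \<Rightarrow> complex" where
  "a_h \<Omega> \<Gamma>D \<T> lab \<tau> \<sigma> \<gamma>0 \<gamma>1 \<beta>1 u v =
     (\<Sum>i\<in>Basis. mesh_inner \<T> (pw_deriv i u) (pw_deriv i v))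
     - (\<Sum>e\<in>interior_faces \<T> \<union> faces_on \<T> \<Gamma>D.
          L2_inner (face_measure e)
            (avg \<T> lab e (pw_deriv (face_normal \<Omega> \<T> lab e) u)) (jump \<T> lab e v)
          + of_real \<sigma> * L2_inner (face_measure e)
            (jump \<T> lab e u) (avg \<T> lab e (pw_deriv (face_normal \<Omega> \<T> lab e) v)))
     + \<i> * (J0 \<Gamma>D \<T> lab \<gamma>0 u v + J1 \<Omega> \<T> lab \<gamma>1 u v + L1 \<Gamma>D \<T> lab \<tau> \<beta>1 u v)"

end

theory Submission
  imports Defs
begin

text \<open>
  The system is square, so it suffices that a solution \<open>u\<close> of the homogeneous problem vanishes.
  Testing with \<open>v = u\<close> and taking imaginary parts, every penalty term and the boundary term on
  \<open>\<Gamma>\<^sub>R\<close> is zero: \<open>u\<close> has no jumps and vanishes on \<open>\<partial>\<Omega>\<close>; the real part gives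
  \<open>\<parallel>\<nabla>u\<parallel>\<^sup>2 = k\<^sup>2 \<parallel>u\<parallel>\<^sup>2\<close>. Since \<open>\<nabla>u\<close> is piecewise constant, the Rellich multiplier
  \<open>v = (x - x\<^sub>0) \<bullet> \<nabla>u\<close> lies in \<open>V\<^sup>h\<close>, and testing with it yields
  \<open>\<parallel>\<nabla>u\<parallel>\<^sup>2\<close> plus boundary terms that are nonnegative by the star-shape condition, equal to 0.

  The integrations by parts only involve the field \<open>x - x\<^sub>0\<close> and the quadratic polynomial
  \<open>|u|\<^sup>2\<close> on a simplex. If \<open>x\<^sub>0\<close> is a vertex they reduce to the cone formula
  \<open>\<integral>\<^bsub>K\<^esub> q = h / (d + m) * \<integral>\<^bsub>e\<^esub> q\<close> for \<open>q\<close> homogeneous of degree \<open>m\<close> about that vertex, with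
  \<open>e\<close> the opposite facet and \<open>h\<close> its distance; a general \<open>x\<^sub>0\<close> is an affine combination of the
  vertices.
\<close>

section \<open>Lebesgue measure in orthonormal coordinates\<close>

text \<open>The parameters of \<open>J1\<close> and \<open>L1\<close> may vanish, so only the jump
  of \<open>u\<close> itself is known to be zero; the normal derivative of \<open>u\<close> may
  still jump across interior faces, and the consistency terms survive the second test. They cancel
  nevertheless: on an interior face the averaged normal derivative of \<open>u\<close> times the
  jump of the multiplier has as real part the mean of the two outward fluxes of |grad u|^2 (x - x0)
  from the adjacent elements, and elementwise integration of the divergence d |grad u|^2 of this
  field produces the same fluxes. The multiplier is admissible because functions in
  \<open>Vh\<close> need not match across faces. The mass term needs Re (u, v) = - (d/2) ||u||^2,
  which comes from the flux of |u|^2 (x - x0): it cancels on interior faces and vanishes on the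
  boundary. Since ||grad u||^2 = k^2 ||u||^2, the interior sums and the factor d then drop out,
  whatever the mesh and k. Volume and facet integrals are linked by Fubini alone:
  \<open>face_measure\<close> uses an orthonormal tangent basis, and the unit normal completes it to
  coordinates of the whole space.\<close>

lemma PiM_lborel_affine:
  fixes a :: "'i \<Rightarrow> real"
  assumes B: "finite B" and c: "c > 0"
  shows "PiM B (\<lambda>_. lborel) =
    density (distr (PiM B (\<lambda>_. lborel)) (PiM B (\<lambda>_. lborel)) (\<lambda>t. \<lambda>b\<in>B. a b + c * t b))
      (\<lambda>_. ennreal (c ^ card B))"
    (is "?P = density (distr ?P ?P ?f) _")
proof -
  interpret product_sigma_finite "\<lambda>_. lborel :: real measure" ..
  have f [measurable]: "?f \<in> ?P \<rightarrow>\<^sub>M ?P"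
    by measurable
  \<comment> \<open>Product measures are determined by their values on boxes. The preimage of a box
    is a box, and each coordinate contributes one factor \<open>c\<close>.\<close>
  have "density (distr ?P ?P ?f) (\<lambda>_. ennreal (c ^ card B)) = ?P"
  proof (rule PiM_eqI[OF B])
    fix A :: "'i \<Rightarrow> real set" assume A: "\<And>i. i \<in> B \<Longrightarrow> A i \<in> sets lborel"
    have SA: "Pi\<^sub>E B A \<in> sets ?P"
      using A B by (intro sets_PiM_I_finite) auto
    have pre: "?f -` Pi\<^sub>E B A \<inter> space ?P = Pi\<^sub>E B (\<lambda>b. (\<lambda>x. a b + c * x) -` A b)"
      by (auto simp: space_PiM PiE_iff)
    have m: "(\<lambda>x. a b + c * x) -` A b \<in> sets lborel" if "b \<in> B" for b
      using measurable_sets[of "\<lambda>x. a b + c * x" borel borel "A b"] A[OF that] by simp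
    have one: "ennreal c * emeasure lborel ((\<lambda>x. a b + c * x) -` A b) = emeasure lborel (A b)"
      if "b \<in> B" for b
    proof -
      have "emeasure lborel (A b)
          = emeasure (density (distr lborel borel (\<lambda>x. a b + c * x)) (\<lambda>_. ennreal \<bar>c\<bar>)) (A b)"
        using lborel_real_affine[of c "a b"] c by simp
      then show ?thesis
        using A[OF that] c by (simp add: emeasure_density_const emeasure_distr)
    qed
    have "emeasure (density (distr ?P ?P ?f) (\<lambda>_. ennreal (c ^ card B))) (Pi\<^sub>E B A)
        = ennreal (c ^ card B) * emeasure ?P (Pi\<^sub>E B (\<lambda>b. (\<lambda>x. a b + c * x) -` A b))"
      using SA by (simp add: emeasure_density_const emeasure_distr pre)
    also have "\<dots> = (\<Prod>b\<in>B. ennreal c) * (\<Prod>b\<in>B. emeasure lborel ((\<lambda>x. a b + c * x) -` A b))"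
      using c m B by (subst emeasure_PiM) (auto simp: ennreal_power)
    also have "\<dots> = (\<Prod>b\<in>B. emeasure lborel (A b))"
      by (simp only: prod.distrib[symmetric]) (rule prod.cong[OF refl one])
    finally show "emeasure (density (distr ?P ?P ?f) (\<lambda>_. ennreal (c ^ card B))) (Pi\<^sub>E B A)
        = (\<Prod>b\<in>B. emeasure lborel (A b))" .
  qed simp
  then show ?thesis
    by simp
qed

lemma integral_PiM_lborel_affine:
  fixes a :: "'i \<Rightarrow> real" and f :: "('i \<Rightarrow> real) \<Rightarrow> 'c::{banach, second_countable_topology}"
  assumes B: "finite B" and c: "c > 0" and f [measurable]: "f \<in> borel_measurable (PiM B (\<lambda>_. lborel))"
  shows "(LINT t|PiM B (\<lambda>_. lborel). f t)
    = c ^ card B *\<^sub>R (LINT t|PiM B (\<lambda>_. lborel). f (\<lambda>b\<in>B. a b + c * t b))"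
  using c by (subst PiM_lborel_affine[OF B c, of a]) (simp add: integral_density integral_distr)

lemma nn_integral_PiM_lborel_shift:
  fixes a :: "'i \<Rightarrow> real"
  assumes B: "finite B" and f [measurable]: "f \<in> borel_measurable (PiM B (\<lambda>_. lborel))"
  shows "(\<integral>\<^sup>+t. f t \<partial>PiM B (\<lambda>_. lborel))
    = (\<integral>\<^sup>+t. f (\<lambda>b\<in>B. a b + t b) \<partial>PiM B (\<lambda>_. lborel))"
  by (subst PiM_lborel_affine[OF B, of 1 a]) (simp_all add: nn_integral_density nn_integral_distr)

definition orthonormal_set :: "'a::euclidean_space set \<Rightarrow> bool" where
  "orthonormal_set B \<longleftrightarrow> pairwise orthogonal B \<and> (\<forall>b\<in>B. norm b = 1)"

abbreviation flat_sum :: "'a::euclidean_space set \<Rightarrow> ('a \<Rightarrow> real) \<Rightarrow> 'a" where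
  "flat_sum B t \<equiv> \<Sum>b\<in>B. t b *\<^sub>R b"

lemma orthonormal_set_finite: "orthonormal_set B \<Longrightarrow> finite B"
  unfolding orthonormal_set_def
  by (intro pairwise_orthogonal_imp_finite) auto

lemma orthonormal_set_independent: "orthonormal_set B \<Longrightarrow> independent B"
  unfolding orthonormal_set_def
  by (intro pairwise_orthogonal_independent) auto

lemma orthonormal_set_inner:
  "orthonormal_set B \<Longrightarrow> b \<in> B \<Longrightarrow> b' \<in> B \<Longrightarrow> b \<bullet> b' = (if b = b' then 1 else 0)"
  by (auto simp: orthonormal_set_def pairwise_def orthogonal_def norm_eq_1)

lemma flat_sum_inner:
  assumes "orthonormal_set B" "b \<in> B"
  shows "flat_sum B t \<bullet> b = t b"
proof -
  have "flat_sum B t \<bullet> b = (\<Sum>b'\<in>B. t b' * (b' \<bullet> b))"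
    by (simp add: inner_sum_left)
  also have "\<dots> = (\<Sum>b'\<in>B. if b' = b then t b' else 0)"
    using assms by (intro sum.cong) (auto simp: orthonormal_set_inner)
  finally show ?thesis
    using orthonormal_set_finite[OF assms(1)] assms(2) by simp
qed

lemma norm_flat_sum:
  assumes "orthonormal_set B"
  shows "norm (flat_sum B t) = sqrt (\<Sum>b\<in>B. (t b)\<^sup>2)"
proof -
  have "flat_sum B t \<bullet> flat_sum B t = (\<Sum>b\<in>B. t b * (flat_sum B t \<bullet> b))"
    by (simp add: inner_sum_right)
  also have "\<dots> = (\<Sum>b\<in>B. (t b)\<^sup>2)"
    by (intro sum.cong) (auto simp: flat_sum_inner[OF assms] power2_eq_square)
  finally show ?thesis
    by (simp add: norm_eq_sqrt_inner)
qed

lemma flat_sum_representation: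
  assumes "orthonormal_set B" "x \<in> span B"
  shows "flat_sum B (\<lambda>b. x \<bullet> b) = x"
proof -
  obtain t where "x = flat_sum B t"
    using assms span_finite[OF orthonormal_set_finite[OF assms(1)]] by auto
  then show ?thesis
    using flat_sum_inner[OF assms(1)] by (auto intro!: sum.cong)
qed

lemma flat_sum_measurable [measurable]:
  "flat_sum B \<in> PiM B (\<lambda>_. lborel) \<rightarrow>\<^sub>M borel"
  by (intro borel_measurable_sum borel_measurable_scaleR) auto

text \<open>
  Both sides are translation invariant, so Fubini applied to \<open>f (x + y) * g y\<close>, with \<open>g\<close> the
  indicator of the unit ball, shows them to be proportional; the constant is 1 because both agree
  on the unit ball.
\<close>

lemma lborel_eq_distr_orthonormal:
  fixes B :: "'a::euclidean_space set"
  assumes on: "orthonormal_set B" and span: "span B = UNIV"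
  shows "distr (PiM B (\<lambda>_. lborel)) borel (flat_sum B) = lborel"
    (is "?M = lborel")
proof (rule measure_eqI)
  fix A assume "A \<in> sets ?M"
  then have A [measurable]: "A \<in> sets borel" by simp
  interpret P: product_sigma_finite "\<lambda>_. lborel :: real measure" ..
  have fB: "finite B" using on by (rule orthonormal_set_finite)
  have cB: "card B = DIM('a)"
    using dim_eq_card_independent[OF orthonormal_set_independent[OF on]] dim_span[of B] span
    by simp
  interpret PB: finite_product_sigma_finite "\<lambda>_. lborel :: real measure" B
    by standard fact
  let ?D = "cball (0::'a) 1"
  \<comment> \<open>\<open>flat_sum B\<close> is isometric, so the preimage of the ball is the
    Euclidean ball in the coordinates, whose volume is known.\<close>
  have vol: "emeasure ?M ?D = ennreal (unit_ball_vol DIM('a))"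
  proof -
    have "emeasure ?M ?D = emeasure (PiM B (\<lambda>_. lborel))
        ({t. sqrt (\<Sum>b\<in>B. (t b)\<^sup>2) \<le> 1} \<inter> space (PiM B (\<lambda>_. lborel)))"
      by (subst emeasure_distr) (auto simp: norm_flat_sum[OF on] intro!: arg_cong2[where f=emeasure])
    also have "\<dots> = ennreal (unit_ball_vol DIM('a))"
      using emeasure_cball_aux[OF fB, of 1] cB by simp
    finally show ?thesis .
  qed
  have vol': "emeasure lborel ?D = ennreal (unit_ball_vol DIM('a))"
    using emeasure_cball[of 1 "0::'a"] by simp
  have shift: "(\<integral>\<^sup>+y. f (x + y) \<partial>?M) = (\<integral>\<^sup>+y. f y \<partial>?M)"
    if f [measurable]: "f \<in> borel_measurable borel" for f x
  proof -
    have "(\<integral>\<^sup>+y. f y \<partial>?M) = (\<integral>\<^sup>+t. f (flat_sum B t) \<partial>PiM B (\<lambda>_. lborel))"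
      by (subst nn_integral_distr) auto
    also have "\<dots> = (\<integral>\<^sup>+t. f (flat_sum B (\<lambda>b\<in>B. x \<bullet> b + t b)) \<partial>PiM B (\<lambda>_. lborel))"
      by (rule nn_integral_PiM_lborel_shift[OF fB]) auto
    also have "\<dots> = (\<integral>\<^sup>+t. f (x + flat_sum B t) \<partial>PiM B (\<lambda>_. lborel))"
      using flat_sum_representation[OF on, of x] span
      by (intro nn_integral_cong) (simp add: scaleR_add_left sum.distrib)
    also have "\<dots> = (\<integral>\<^sup>+y. f (x + y) \<partial>?M)"
      by (subst nn_integral_distr) auto
    finally show ?thesis by simp
  qed
  have shift': "(\<integral>\<^sup>+x. f (x + y) \<partial>lborel) = (\<integral>\<^sup>+x. f x \<partial>lborel)"
    if f [measurable]: "f \<in> borel_measurable borel" for f :: "'a \<Rightarrow> ennreal" and y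
  proof -
    have "(\<integral>\<^sup>+x. f x \<partial>lborel)
        = (\<integral>\<^sup>+x. f x \<partial>density (distr lborel borel (\<lambda>x. y + 1 *\<^sub>R x)) (\<lambda>_. 1))"
      using lborel_affine[of 1 y] by simp
    then show ?thesis
      by (simp add: nn_integral_density nn_integral_distr add.commute)
  qed
  have sf: "sigma_finite_measure ?M"
  proof
    show "\<exists>A. countable A \<and> A \<subseteq> sets ?M \<and> \<Union>A = space ?M \<and> (\<forall>a\<in>A. emeasure ?M a \<noteq> \<infinity>)"
    proof (intro exI conjI ballI)
      show "countable (range (\<lambda>x::nat. cball (0::'a) (real x)))" by auto
      show "\<Union>(range (\<lambda>x::nat. cball (0::'a) (real x))) = space ?M"
        by (auto simp: real_arch_simple)
      fix a assume "a \<in> range (\<lambda>x::nat. cball (0::'a) (real x))"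
      then obtain m :: nat where a: "a = cball 0 (real m)" by auto
      have "emeasure ?M (cball 0 (real m)) \<le> emeasure ?M (cball 0 (real (Suc m)))"
        by (intro emeasure_mono) auto
      also have "\<dots> = emeasure (PiM B (\<lambda>_. lborel))
        ({t. sqrt (\<Sum>b\<in>B. (t b)\<^sup>2) \<le> real (Suc m)} \<inter> space (PiM B (\<lambda>_. lborel)))"
        by (subst emeasure_distr) (auto simp: norm_flat_sum[OF on] intro!: arg_cong2[where f=emeasure])
      also have "\<dots> < \<infinity>"
        using emeasure_cball_aux[OF fB, of "real (Suc m)"] by (simp add: ennreal_mult_less_top)
      finally show "emeasure ?M a \<noteq> \<infinity>" using a by simp
    qed auto
  qed
  interpret pair_sigma_finite ?M "lborel :: 'a measure"
    using sf by (auto intro!: pair_sigma_finite.intro sigma_finite_lborel)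
  let ?f = "indicator A :: 'a \<Rightarrow> ennreal" and ?g = "indicator ?D :: 'a \<Rightarrow> ennreal"
  have gm [measurable]: "?g \<in> borel_measurable borel"
    by (intro borel_measurable_indicator) simp
  have "emeasure lborel A * emeasure ?M ?D = (\<integral>\<^sup>+y. ?g y * (\<integral>\<^sup>+x. ?f x \<partial>lborel) \<partial>?M)"
    by (subst nn_integral_multc) (auto simp: mult.commute)
  also have "\<dots> = (\<integral>\<^sup>+y. ?g y * (\<integral>\<^sup>+x. ?f (x + y) \<partial>lborel) \<partial>?M)"
    by (simp only: shift'[of ?f] borel_measurable_indicator A)
  also have "\<dots> = (\<integral>\<^sup>+y. (\<integral>\<^sup>+x. ?g y * ?f (x + y) \<partial>lborel) \<partial>?M)"
    by (intro nn_integral_cong nn_integral_cmult[symmetric]) measurable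
  also have "\<dots> = (\<integral>\<^sup>+x. (\<integral>\<^sup>+y. ?g y * ?f (x + y) \<partial>?M) \<partial>lborel)"
    by (rule Fubini'[symmetric]) measurable
  also have "\<dots> = (\<integral>\<^sup>+x. (\<integral>\<^sup>+y. ?g (y - x) * ?f y \<partial>?M) \<partial>lborel)"
  proof (rule nn_integral_cong)
    fix x :: 'a
    have "(\<lambda>y. ?g (y - x) * ?f y) \<in> borel_measurable borel" by measurable
    from shift[OF this, of x]
    show "(\<integral>\<^sup>+y. ?g y * ?f (x + y) \<partial>?M) = (\<integral>\<^sup>+y. ?g (y - x) * ?f y \<partial>?M)" by simp
  qed
  also have "\<dots> = (\<integral>\<^sup>+y. (\<integral>\<^sup>+x. ?g (y - x) * ?f y \<partial>lborel) \<partial>?M)"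
    by (rule Fubini') measurable
  \<comment> \<open>The ball is symmetric about the origin, so y - x may be replaced by x - y; the
    inner integral is then a translate in x.\<close>
  also have "\<dots> = (\<integral>\<^sup>+y. (\<integral>\<^sup>+x. ?g (x + - y) * ?f y \<partial>lborel) \<partial>?M)"
    by (intro nn_integral_cong arg_cong2[where f="(*)"])
      (auto simp: indicator_def norm_minus_commute)
  also have "\<dots> = (\<integral>\<^sup>+y. (\<integral>\<^sup>+x. ?g (x + - y) \<partial>lborel) * ?f y \<partial>?M)"
    by (intro nn_integral_cong nn_integral_multc) measurable
  also have "\<dots> = (\<integral>\<^sup>+y. (\<integral>\<^sup>+x. ?g x \<partial>lborel) * ?f y \<partial>?M)"
    by (simp only: shift'[of ?g] gm)
  also have "\<dots> = emeasure lborel ?D * emeasure ?M A"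
    by (subst nn_integral_cmult) auto
  finally have "ennreal (unit_ball_vol DIM('a)) * emeasure ?M A
      = ennreal (unit_ball_vol DIM('a)) * emeasure lborel A"
    by (simp add: vol vol' mult.commute)
  then show "emeasure ?M A = emeasure lborel A"
    unfolding ennreal_mult_cancel_left using unit_ball_vol_pos[of "DIM('a)"] by (auto simp: less_le)
qed simp

text \<open>Fubini in orthonormal coordinates, with the coordinate along \<open>n\<close> split off.
  For a facet normal \<open>n\<close> and the tangent basis \<open>B\<close> the inner integral runs
  over a hyperplane parallel to the facet, in the very coordinates of
  \<open>face_measure\<close>.\<close>

lemma integral_lborel_slices:
  fixes f :: "'a::euclidean_space \<Rightarrow> 'c::{banach, second_countable_topology}"
  assumes on: "orthonormal_set (insert n B)" and n: "n \<notin> B" and span: "span (insert n B) = UNIV"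
    and f: "integrable lborel f"
  shows "(LINT x|lborel. f x)
    = (LINT s|lborel. LINT t|PiM B (\<lambda>_. lborel). f (s *\<^sub>R n + flat_sum B t))"
proof -
  interpret P: product_sigma_finite "\<lambda>_. lborel :: real measure" ..
  have fB: "finite B" using orthonormal_set_finite[OF on] by simp
  interpret PB: finite_product_sigma_finite "\<lambda>_. lborel :: real measure" B
    by standard fact
  have f' [measurable]: "f \<in> borel_measurable borel"
    using borel_measurable_integrable[OF f] by simp
  let ?B = "{n} \<union> B"
  have on': "orthonormal_set ?B" and span': "span ?B = UNIV"
    using on span by simp_all
  have int: "integrable (PiM ?B (\<lambda>_. lborel)) (\<lambda>t. f (flat_sum ?B t))"
    using f lborel_eq_distr_orthonormal[OF on' span']
    by (subst integrable_distr_eq[symmetric, where N=borel and g="flat_sum ?B"]) auto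
  have meas [measurable]: "(\<lambda>s. LINT t|PiM B (\<lambda>_. lborel). f (s *\<^sub>R n + flat_sum B t))
      \<in> borel_measurable lborel"
    by (intro PB.borel_measurable_lebesgue_integral) measurable
  have "(LINT x|lborel. f x) = (LINT t|PiM ?B (\<lambda>_. lborel). f (flat_sum ?B t))"
    by (subst lborel_eq_distr_orthonormal[OF on' span', symmetric]) (rule integral_distr; measurable)
  also have "\<dots> = (LINT x|PiM {n} (\<lambda>_. lborel). LINT y|PiM B (\<lambda>_. lborel).
      f (flat_sum ?B (merge {n} B (x, y))))"
    using n fB int by (intro P.product_integral_fold) auto
  also have "\<dots> = (LINT x|PiM {n} (\<lambda>_. lborel). LINT y|PiM B (\<lambda>_. lborel).
      f (x n *\<^sub>R n + flat_sum B y))"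
  proof (intro Bochner_Integration.integral_cong refl arg_cong[where f=f])
    fix x y
    have "flat_sum B (merge {n} B (x, y)) = flat_sum B y"
      using n by (intro sum.cong) (auto simp: merge_def)
    then show "flat_sum ?B (merge {n} B (x, y)) = x n *\<^sub>R n + flat_sum B y"
      using n fB by (simp add: merge_def)
  qed
  also have "\<dots> = (LINT s|lborel. LINT t|PiM B (\<lambda>_. lborel). f (s *\<^sub>R n + flat_sum B t))"
    by (rule P.product_integral_singleton) measurable
  finally show ?thesis .
qed

text \<open>The slice of the cone at height s is the base scaled by s/h, so by homogeneity its
  integral is (s/h)^(card B + m) times that of the base. Integrating this power over [0, h] gives
  the factor h / (1 + card B + m).\<close>

lemma integral_cone:
  fixes q :: "'a::euclidean_space \<Rightarrow> real"
  assumes on: "orthonormal_set (insert n B)" and n: "n \<notin> B" and span: "span (insert n B) = UNIV"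
    and h: "h > 0" and E: "\<And>y. y \<in> E \<Longrightarrow> y \<bullet> n = h"
    and K: "K = {r *\<^sub>R y |r y. 0 \<le> r \<and> r \<le> 1 \<and> y \<in> E}"
    and hom: "\<And>r y. r > 0 \<Longrightarrow> q (r *\<^sub>R y) = r ^ m * q y"
    and int: "integrable lborel (\<lambda>x. indicator K x * q x)"
  shows "(LINT x|lborel. indicator K x * q x) = h / (1 + card B + m) *
    (LINT t|PiM B (\<lambda>_. lborel). indicator E (h *\<^sub>R n + flat_sum B t) * q (h *\<^sub>R n + flat_sum B t))"
proof -
  have fB: "finite B" using orthonormal_set_finite[OF on] by simp
  define N where "N = card B + m"
  define I where "I = (LINT t|PiM B (\<lambda>_. lborel).
    indicator E (h *\<^sub>R n + flat_sum B t) * q (h *\<^sub>R n + flat_sum B t))"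
  define G where "G s = (LINT t|PiM B (\<lambda>_. lborel).
    indicator K (s *\<^sub>R n + flat_sum B t) * q (s *\<^sub>R n + flat_sum B t))" for s
  interpret PB: finite_product_sigma_finite "\<lambda>_. lborel :: real measure" B
    by standard fact
  have Km [measurable]: "(\<lambda>x. indicator K x * q x) \<in> borel_measurable borel"
    using borel_measurable_integrable[OF int] by simp
  have nB: "b \<bullet> n = 0" if "b \<in> B" for b
    using orthonormal_set_inner[OF on, of b n] that n by auto
  have n1: "n \<bullet> n = 1"
    using orthonormal_set_inner[OF on, of n n] by auto
  have lev: "(s *\<^sub>R n + flat_sum B t) \<bullet> n = s" for s t
    by (simp add: inner_add_left inner_sum_left nB n1)
  have Kn: "x \<bullet> n \<in> {0..h}" if "x \<in> K" for x
    using that E h unfolding K by (auto simp: mult_left_le_one_le)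
  \<comment> \<open>Every point of the base has height h, so the height of a point of the cone
    determines its scaling parameter.\<close>
  have KE: "(s / h) *\<^sub>R y \<in> K \<longleftrightarrow> y \<in> E" if s: "0 < s" "s \<le> h" and y: "y \<bullet> n = h" for s y
  proof
    assume "(s / h) *\<^sub>R y \<in> K"
    then obtain r z where rz: "(s / h) *\<^sub>R y = r *\<^sub>R z" "z \<in> E" unfolding K by auto
    have "(s / h) *\<^sub>R y \<bullet> n = r *\<^sub>R z \<bullet> n" using rz by simp
    then have "s / h = r" using y E[OF rz(2)] h by (simp add: field_simps)
    with rz s h show "y \<in> E" by auto
  next
    assume "y \<in> E" with s h show "(s / h) *\<^sub>R y \<in> K" unfolding K
      by (auto intro!: exI[of _ "s / h"] exI[of _ y])
  qed
  have G1: "G s = (s / h) ^ N * I" if s: "0 < s" "s \<le> h" for s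
  proof -
    have c: "s / h > 0" using s h by simp
    have shift: "s *\<^sub>R n + flat_sum B (\<lambda>b\<in>B. 0 + (s / h) * t b)
        = (s / h) *\<^sub>R (h *\<^sub>R n + flat_sum B t)" for t
      using h by (simp add: scaleR_add_right scaleR_sum_right)
    have "G s = (s / h) ^ card B *\<^sub>R (LINT t|PiM B (\<lambda>_. lborel).
        indicator K ((s / h) *\<^sub>R (h *\<^sub>R n + flat_sum B t)) * q ((s / h) *\<^sub>R (h *\<^sub>R n + flat_sum B t)))"
    proof -
      have "(\<lambda>t. indicator K (s *\<^sub>R n + flat_sum B t) * q (s *\<^sub>R n + flat_sum B t))
          \<in> borel_measurable (PiM B (\<lambda>_. lborel))"
        by measurable
      from integral_PiM_lborel_affine[OF fB c this, of "\<lambda>_. 0"] show ?thesis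
        unfolding G_def shift .
    qed
    also have "\<dots> = (s / h) ^ card B *\<^sub>R (LINT t|PiM B (\<lambda>_. lborel).
        (s / h) ^ m * (indicator E (h *\<^sub>R n + flat_sum B t) * q (h *\<^sub>R n + flat_sum B t)))"
      using KE[OF s lev] hom[OF c]
      by (intro arg_cong[where f="scaleR _"] Bochner_Integration.integral_cong refl)
        (simp add: indicator_def)
    also have "\<dots> = (s / h) ^ N * I"
      unfolding I_def N_def by (simp add: power_add)
    finally show ?thesis .
  qed
  have G0: "G s = 0" if "s < 0 \<or> s > h" for s
  proof -
    have "s *\<^sub>R n + flat_sum B t \<notin> K" for t
      using Kn[of "s *\<^sub>R n + flat_sum B t"] lev[of s t] that by auto
    then show ?thesis unfolding G_def by simp
  qed
  have Gm [measurable]: "G \<in> borel_measurable borel"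
    unfolding G_def[abs_def] by (intro PB.borel_measurable_lebesgue_integral) measurable
  have "(LINT x|lborel. indicator K x * q x) = (LINT s|lborel. G s)"
    unfolding G_def by (rule integral_lborel_slices[OF on n span int])
  also have "\<dots> = (LINT s|lborel. (I / h ^ N) * (s ^ N * indicator {0..h} s))"
  proof (rule integral_cong_AE)
    \<comment> \<open>The scaling law for \<open>G\<close> holds for positive heights only; the apex
      level s = 0 is a null set.\<close>
    show "AE s in lborel. G s = (I / h ^ N) * (s ^ N * indicator {0..h} s)"
      using AE_lborel_singleton[of "0::real"]
    proof eventually_elim
      case (elim s)
      then show ?case
        using G0[of s] G1[of s] by (cases "0 < s \<and> s \<le> h") (auto simp: indicator_def power_divide)
    qed
  qed measurable
  also have "\<dots> = (I / h ^ N) * (h ^ Suc N / Suc N)"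
    using integral_power[of 0 h N] h by simp
  also have "\<dots> = h / (1 + card B + m) * I"
    using h by (simp add: N_def field_simps)
  finally show ?thesis unfolding I_def .
qed

section \<open>Integration against the surface measure of a face\<close>

lemma tangent_basis_orthonormal: "orthonormal_set (tangent_basis e)"
  and span_tangent_basis: "span (tangent_basis e) = tangent_space e"
proof -
  have "subspace (tangent_space e)"
    by (simp add: tangent_space_def)
  then obtain B where "pairwise orthogonal B" "\<And>x. x \<in> B \<Longrightarrow> norm x = 1" "span B = tangent_space e"
    by (rule orthonormal_basis_subspace) blast
  then have "\<exists>B. pairwise orthogonal B \<and> (\<forall>b\<in>B. norm b = 1) \<and> span B = tangent_space e"
    by blast
  from someI_ex[OF this] show "orthonormal_set (tangent_basis e)"
    and "span (tangent_basis e) = tangent_space e"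
    unfolding tangent_basis_def orthonormal_set_def by blast+
qed

lemma space_face_measure [simp]: "space (face_measure e) = e"
  by (simp add: face_measure_def space_restrict_space)

lemma borel_measurable_face_measure:
  assumes "f \<in> borel_measurable borel"
  shows "f \<in> borel_measurable (face_measure e)"
  unfolding face_measure_def
  by (intro measurable_restrict_space1 measurable_completion) (use assms in simp)

text \<open>The base point chosen in \<open>face_measure\<close> may be replaced by any
  \<open>p\<close> of the affine hull of \<open>e\<close>, since this is a translation in the
  coordinates. Freedom in \<open>p\<close> is essential: for a cone it is the foot of the
  perpendicular from the apex, which may lie outside \<open>e\<close>.\<close>

lemma integral_face_measure:
  fixes f :: "'a::euclidean_space \<Rightarrow> 'c::{banach, second_countable_topology}"
  assumes e: "e \<in> sets borel" "x \<in> e" and p: "p - x \<in> tangent_space e"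
    and f [measurable]: "f \<in> borel_measurable borel"
  shows "(LINT x|face_measure e. f x) = (LINT t|PiM (tangent_basis e) (\<lambda>_. lborel).
    indicator e (p + flat_sum (tangent_basis e) t) *\<^sub>R f (p + flat_sum (tangent_basis e) t))"
proof -
  let ?B = "tangent_basis e" and ?p = "SOME p. p \<in> e"
  let ?T = "\<lambda>t. ?p + flat_sum ?B t" and ?F = "\<lambda>x. indicator e x *\<^sub>R f x"
  have on: "orthonormal_set ?B" by (rule tangent_basis_orthonormal)
  have fB: "finite ?B" using on by (rule orthonormal_set_finite)
  note [measurable] = e(1)
  have "?p \<in> e" using e(2) by (rule someI)
  then have "x - ?p \<in> tangent_space e"
    unfolding tangent_space_def using e(2) by (auto intro!: span_base)
  then have "(p - x) + (x - ?p) \<in> tangent_space e"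
    using p unfolding tangent_space_def by (intro span_add)
  \<comment> \<open>The difference of the two base points is tangential, hence recovered from its
    coordinates; the shift by these coordinates moves one base point to the other.\<close>
  then have d: "flat_sum ?B (\<lambda>b. (p - ?p) \<bullet> b) = p - ?p"
    by (intro flat_sum_representation on) (simp add: span_tangent_basis)
  have "(LINT x|face_measure e. f x)
      = (LINT x|completion (distr (PiM ?B (\<lambda>_. lborel)) borel ?T). ?F x)"
    unfolding face_measure_def using e by (intro integral_restrict_space) simp
  also have "\<dots> = (LINT x|distr (PiM ?B (\<lambda>_. lborel)) borel ?T. ?F x)"
    by (rule integral_completion) measurable
  also have "\<dots> = (LINT t|PiM ?B (\<lambda>_. lborel). ?F (?T t))"
    by (rule integral_distr) measurable
  also have "\<dots> = (LINT t|PiM ?B (\<lambda>_. lborel). ?F (?T (\<lambda>b\<in>?B. (p - ?p) \<bullet> b + 1 * t b)))"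
  proof -
    have "(\<lambda>t. ?F (?T t)) \<in> borel_measurable (PiM ?B (\<lambda>_. lborel))"
      by measurable
    from integral_PiM_lborel_affine[OF fB zero_less_one this, of "\<lambda>b. (p - ?p) \<bullet> b"] show ?thesis
      by simp
  qed
  also have "\<dots> = (LINT t|PiM ?B (\<lambda>_. lborel). ?F (p + flat_sum ?B t))"
    using d by (intro Bochner_Integration.integral_cong refl arg_cong[where f="?F"])
      (simp add: scaleR_add_left sum.distrib)
  finally show ?thesis .
qed

text \<open>The coordinates are isometric, so a bounded face pulls back into a Euclidean ball, which
  has finite volume.\<close>

lemma finite_measure_face_measure:
  assumes "compact e"
  shows "finite_measure (face_measure e)"
proof
  let ?B = "tangent_basis e" and ?p = "SOME p. p \<in> e"
  let ?T = "\<lambda>t. ?p + flat_sum ?B t"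
  have on: "orthonormal_set ?B" by (rule tangent_basis_orthonormal)
  have e [measurable]: "e \<in> sets borel" using assms by (simp add: borel_closed compact_imp_closed)
  obtain r where r: "r > 0" "\<And>x. x \<in> e \<Longrightarrow> norm (x - ?p) \<le> r"
  proof -
    have "bounded ((\<lambda>x. x - ?p) ` e)"
      using compact_imp_bounded[OF assms] by (simp add: bounded_translation_minus)
    then show ?thesis using that unfolding bounded_pos by auto
  qed
  have "emeasure (face_measure e) (space (face_measure e))
      = emeasure (distr (PiM ?B (\<lambda>_. lborel)) borel ?T) e"
    unfolding space_face_measure unfolding face_measure_def
    by (subst emeasure_restrict_space) auto
  also have "\<dots> = emeasure (PiM ?B (\<lambda>_. lborel)) (?T -` e \<inter> space (PiM ?B (\<lambda>_. lborel)))"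
    by (rule emeasure_distr) measurable
  also have "\<dots> \<le> emeasure (PiM ?B (\<lambda>_. lborel))
      ({t. sqrt (\<Sum>b\<in>?B. (t b)\<^sup>2) \<le> r} \<inter> space (PiM ?B (\<lambda>_. lborel)))"
  proof (rule emeasure_mono)
    show "?T -` e \<inter> space (PiM ?B (\<lambda>_. lborel)) \<subseteq>
        {t. sqrt (\<Sum>b\<in>?B. (t b)\<^sup>2) \<le> r} \<inter> space (PiM ?B (\<lambda>_. lborel))"
      using r(2) by (auto simp flip: norm_flat_sum[OF on] dest!: r(2))
  qed measurable
  also have "\<dots> < \<infinity>"
    using emeasure_cball_aux[OF orthonormal_set_finite[OF on] r(1)] by (simp add: ennreal_mult_less_top)
  finally show "emeasure (face_measure e) (space (face_measure e)) \<noteq> \<infinity>" by simp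
qed

section \<open>Affine functions and facets\<close>

text \<open>Basis-free form of \<open>P1\<close>, with real linearity: v \<mapsto> p v - p 0 is the
  derivative of p in direction v, and its values on \<open>Basis\<close> are the coefficients.
  Gradients appear in this form throughout.\<close>

lemma P1_iff_linear: "p \<in> P1 \<longleftrightarrow> linear (\<lambda>v. p v - p 0)"
proof
  assume "p \<in> P1"
  then obtain a b where p: "p = (\<lambda>x. a + (\<Sum>i\<in>Basis. b i * of_real (x \<bullet> i)))"
    unfolding P1_def by auto
  show "linear (\<lambda>v. p v - p 0)"
    by (rule linearI)
      (simp_all add: p inner_add_left sum.distrib ring_distribs scaleR_sum_right scaleR_conv_of_real mult.left_commute sum_distrib_left)
next
  assume lin: "linear (\<lambda>v. p v - p 0)"
  have "p x = p 0 + (\<Sum>i\<in>Basis. (p i - p 0) * of_real (x \<bullet> i))" for x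
  proof -
    have "p x - p 0 = (\<lambda>v. p v - p 0) (\<Sum>i\<in>Basis. (x \<bullet> i) *\<^sub>R i)"
      by (simp add: euclidean_representation)
    also have "\<dots> = (\<Sum>i\<in>Basis. (x \<bullet> i) *\<^sub>R (p i - p 0))"
      using linear_sum[OF lin, of "\<lambda>i. (x \<bullet> i) *\<^sub>R i" Basis] linear_scale[OF lin] by simp
    finally show ?thesis
      by (simp add: scaleR_conv_of_real mult.commute algebra_simps)
  qed
  then have "p = (\<lambda>x. p 0 + (\<Sum>i\<in>Basis. (p i - p 0) * of_real (x \<bullet> i)))"
    by (rule ext)
  then show "p \<in> P1"
    unfolding P1_def mem_Collect_eq by (intro exI)
qed

lemma P1_add_arg:
  assumes "p \<in> P1"
  shows "p (x + v) = p x + (p v - p 0)"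
  using linear_add[OF assms[unfolded P1_iff_linear], of x v] by (simp add: algebra_simps)

lemma P1_has_derivative:
  assumes "p \<in> P1"
  shows "(p has_derivative (\<lambda>v. p v - p 0)) (at x)"
proof -
  have "((\<lambda>x. p 0 + (p x - p 0)) has_derivative (\<lambda>v. 0 + (p v - p 0))) (at x)"
    using assms by (intro derivative_intros linear_imp_has_derivative) (simp add: P1_iff_linear)
  then show ?thesis by simp
qed

lemma P1_frechet_derivative: "p \<in> P1 \<Longrightarrow> frechet_derivative p (at x) = (\<lambda>v. p v - p 0)"
  by (rule frechet_derivative_at[symmetric, OF P1_has_derivative])

lemma P1_continuous_on: "p \<in> P1 \<Longrightarrow> continuous_on S p"
  by (rule has_derivative_continuous_on) (rule has_derivative_at_withinI[OF P1_has_derivative])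

lemma P1_const [simp]: "(\<lambda>x. c) \<in> P1"
  by (simp add: P1_iff_linear linear_zero)

lemma P1_add: "p \<in> P1 \<Longrightarrow> q \<in> P1 \<Longrightarrow> (\<lambda>x. p x + q x) \<in> P1"
  unfolding P1_iff_linear by (drule (1) linear_compose_add) (simp add: algebra_simps)

lemma P1_cmult:
  assumes "p \<in> P1"
  shows "(\<lambda>x. c * p x) \<in> P1"
proof -
  have "linear (\<lambda>v. c * (p v - p 0))"
    by (rule linear_compose[OF assms[unfolded P1_iff_linear], of "(*) c", unfolded o_def])
      (rule bounded_linear.linear[OF bounded_linear_mult_right])
  then show ?thesis
    by (simp add: P1_iff_linear right_diff_distrib)
qed

lemma P1_diff: "p \<in> P1 \<Longrightarrow> q \<in> P1 \<Longrightarrow> (\<lambda>x. p x - q x) \<in> P1"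
  using P1_add[OF _ P1_cmult[of q "-1"]] by simp

text \<open>For affine \<open>p\<close> this function is the gradient of \<open>p\<close> applied to
  x - a: the Rellich multiplier centred at \<open>a\<close>, which thus stays affine.\<close>

lemma P1_translate_linear: "p \<in> P1 \<Longrightarrow> (\<lambda>x. p (x - a) - p 0) \<in> P1"
proof -
  assume p: "p \<in> P1"
  have "(\<lambda>x. p (x - a) - p 0) = (\<lambda>x. p x + (p (- a) - 2 * p 0))"
    using P1_add_arg[OF p, where v="- a"] by (simp add: fun_eq_iff)
  then show ?thesis
    using P1_add[OF p P1_const] by simp
qed

lemma P1_eq_zero:
  assumes p: "p \<in> P1" and S: "open S" "S \<noteq> {}" and z: "\<And>x. x \<in> S \<Longrightarrow> p x = 0"
  shows "p = (\<lambda>x. 0)"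
proof
  fix y
  obtain x where xS: "x \<in> S" using S(2) by auto
  obtain e where "e > 0" "ball x e \<subseteq> S" using openE[OF S(1) xS] .
  note x = xS this
  have L: "p v - p 0 = 0" for v
  proof -
    \<comment> \<open>Scales \<open>v\<close> into the ball around \<open>x\<close>; the summand 1
      covers \<open>v = 0\<close> and makes the estimate strict.\<close>
    define r where "r = e / (norm v + 1)"
    have nv: "0 < norm v + 1" by (simp add: add_nonneg_pos)
    have r: "r > 0" using x(2) nv by (simp add: r_def)
    have "r * norm v < r * (norm v + 1)" using r by simp
    also have "\<dots> = e" using nv by (simp add: r_def)
    finally have "x + r *\<^sub>R v \<in> S"
      using r by (intro subsetD[OF x(3)]) (simp add: dist_norm)
    then have "p (r *\<^sub>R v) - p 0 = 0"
      using z x(1) P1_add_arg[OF p, of x "r *\<^sub>R v"] by simp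
    then have "r *\<^sub>R (p v - p 0) = 0"
      using linear_scale[OF p[unfolded P1_iff_linear], of r v] by simp
    then show ?thesis using r by simp
  qed
  show "p y = 0"
    using P1_add_arg[OF p, of x "y - x"] z[OF x(1)] L[of "y - x"] by simp
qed

text \<open>Outwardness is expressed globally, by a supporting half-space of the convex body, which
  gives inequalities at once for all its points; \<open>outward_normal_nrm\<close> connects it with
  the local notion \<open>outward_normal\<close>.\<close>

definition facet_normal :: "'a::euclidean_space set \<Rightarrow> 'a set \<Rightarrow> 'a \<Rightarrow> bool" where
  "facet_normal K e n \<longleftrightarrow>
     norm n = 1 \<and> (\<exists>b. (\<forall>x\<in>K. x \<bullet> n \<le> b) \<and> e = {x \<in> K. x \<bullet> n = b})"

lemma facet_normal_exists:
  assumes "polyhedron K" "e facet_of K"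
  shows "\<exists>n. facet_normal K e n"
proof -
  obtain a b where ab: "a \<noteq> 0" "K \<subseteq> {x. a \<bullet> x \<le> b}" "e = K \<inter> {x. a \<bullet> x = b}"
    using facet_of_polyhedron[OF assms] .
  have "facet_normal K e (a /\<^sub>R norm a)"
    unfolding facet_normal_def using ab
    by (intro conjI exI[of _ "b / norm a"])
      (auto simp: field_simps inner_commute)
  then show ?thesis ..
qed

lemma facet_normal_inner_eq:
  "facet_normal K e n \<Longrightarrow> x \<in> e \<Longrightarrow> y \<in> e \<Longrightarrow> x \<bullet> n = y \<bullet> n"
  unfolding facet_normal_def by auto

lemma facet_normal_inner_le:
  "facet_normal K e n \<Longrightarrow> x \<in> K \<Longrightarrow> y \<in> e \<Longrightarrow> x \<bullet> n \<le> y \<bullet> n"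
  unfolding facet_normal_def by auto

lemma facet_normal_memI:
  "facet_normal K e n \<Longrightarrow> x \<in> K \<Longrightarrow> y \<in> e \<Longrightarrow> x \<bullet> n = y \<bullet> n \<Longrightarrow> x \<in> e"
  unfolding facet_normal_def by auto

text \<open>One inclusion is clear, and both subspaces have dimension d - 1.\<close>

lemma tangent_space_facet:
  fixes e :: "'a::euclidean_space set"
  assumes e: "e \<noteq> {}" "aff_dim e = int DIM('a) - 1"
    and n: "norm n = 1" "\<And>x y. x \<in> e \<Longrightarrow> y \<in> e \<Longrightarrow> x \<bullet> n = y \<bullet> n"
  shows "tangent_space e = {v. v \<bullet> n = 0}"
proof -
  obtain a where a: "a \<in> e" using e by auto
  have n0: "n \<noteq> 0" using n by auto
  have sub: "subspace {v. v \<bullet> n = 0}"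
    using subspace_hyperplane[of n] by (simp add: inner_commute)
  have le: "tangent_space e \<subseteq> {v. v \<bullet> n = 0}"
    unfolding tangent_space_def
  proof (rule span_minimal[OF _ sub], safe)
    fix x y assume "x \<in> e" "y \<in> e"
    from n(2)[OF this] show "(x - y) \<bullet> n = 0" by (simp add: inner_diff_left)
  qed
  have "int (dim {v. v \<bullet> n = 0}) = int DIM('a) - 1"
    using dim_hyperplane[OF n0] DIM_positive[where 'a='a] by (simp add: inner_commute)
  also have "\<dots> = int (dim ((\<lambda>x. x - a) ` e))"
    using aff_dim_eq_dim_subtract[of a e] a e(2) by (simp add: hull_inc)
  also have "\<dots> \<le> int (dim (tangent_space e))"
    unfolding of_nat_le_iff tangent_space_def
    by (rule dim_subset) (use a in \<open>auto intro!: span_base\<close>)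
  finally have "dim {v. v \<bullet> n = 0} \<le> dim (tangent_space e)" by simp
  then show ?thesis
    using subspace_dim_equal[OF _ sub le] by (simp add: tangent_space_def)
qed

lemma facet_aff_dim:
  assumes "int DIM('a) simplex K" "e facet_of K"
  shows "aff_dim (e::'a::euclidean_space set) = int DIM('a) - 1" "e \<noteq> {}"
  using assms aff_dim_simplex[OF assms(1)] by (auto simp: facet_of_def)

text \<open>Supplies the hypotheses of \<open>integral_cone\<close> for the particular tangent basis
  on which \<open>face_measure\<close> is built.\<close>

lemma tangent_basis_facet:
  fixes e :: "'a::euclidean_space set"
  assumes e: "e \<noteq> {}" "aff_dim e = int DIM('a) - 1"
    and n: "norm n = 1" "\<And>x y. x \<in> e \<Longrightarrow> y \<in> e \<Longrightarrow> x \<bullet> n = y \<bullet> n"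
  shows "orthonormal_set (insert n (tangent_basis e))" "n \<notin> tangent_basis e"
    "span (insert n (tangent_basis e)) = UNIV" "1 + card (tangent_basis e) = DIM('a)"
proof -
  let ?B = "tangent_basis e"
  have sp: "span ?B = {v. v \<bullet> n = 0}"
    using span_tangent_basis[of e] tangent_space_facet[OF assms] by (rule trans)
  have Bn: "b \<bullet> n = 0" if "b \<in> ?B" for b
    using span_base[OF that] sp by auto
  have n1: "n \<bullet> n = 1" using n(1) by (simp add: norm_eq_1)
  show nB: "n \<notin> ?B" using Bn n1 by force
  show on: "orthonormal_set (insert n ?B)"
    using tangent_basis_orthonormal[of e] Bn n(1)
    by (auto simp: orthonormal_set_def pairwise_insert orthogonal_def inner_commute)
  show span: "span (insert n ?B) = UNIV"
  proof (rule equalityI[OF subset_UNIV subsetI])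
    fix x
    have "x - (x \<bullet> n) *\<^sub>R n \<in> span ?B"
      by (simp add: sp inner_diff_left n1)
    then show "x \<in> span (insert n ?B)"
      by (auto simp: span_insert)
  qed
  have "card (insert n ?B) = DIM('a)"
    using dim_eq_card_independent[OF orthonormal_set_independent[OF on]] dim_span[of "insert n ?B"] span
    by simp
  then show "1 + card ?B = DIM('a)"
    using nB orthonormal_set_finite[OF tangent_basis_orthonormal[of e]] by simp
qed

section \<open>Integrals over compact elements and faces\<close>

lemma integrable_continuous_compact:
  fixes f :: "'a::topological_space \<Rightarrow> 'b::{banach, second_countable_topology}"
  assumes M: "finite_measure M" "compact (space M)"
    and f: "continuous_on UNIV f" "f \<in> borel_measurable M"
  shows "integrable M f"
proof -
  interpret finite_measure M by fact
  have "bounded (f ` space M)"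
    using compact_continuous_image[OF continuous_on_subset[OF f(1) subset_UNIV] M(2)]
    by (rule compact_imp_bounded)
  then obtain C where "\<And>x. x \<in> space M \<Longrightarrow> norm (f x) \<le> C"
    unfolding bounded_iff by auto
  then show ?thesis
    using f(2) by (intro integrable_const_bound[of _ C]) auto
qed

lemma finite_measure_lebesgue_on_compact:
  assumes "compact (K::'a::euclidean_space set)"
  shows "finite_measure (lebesgue_on K)"
proof (rule finite_measureI)
  have K: "K \<in> sets lebesgue" "emeasure lebesgue K < \<infinity>"
    using lmeasurable_compact[OF assms] by (auto simp: fmeasurable_def)
  have "emeasure (lebesgue_on K) (space (lebesgue_on K)) = emeasure lebesgue K"
    using K(1) emeasure_restrict_space[of K lebesgue K] by (simp only: space_lebesgue_on) simp
  then show "emeasure (lebesgue_on K) (space (lebesgue_on K)) \<noteq> \<infinity>"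
    using K(2) by (simp only: less_top[symmetric])
qed

lemma integrable_lebesgue_on_compact:
  fixes f :: "'a::euclidean_space \<Rightarrow> 'b::{banach, second_countable_topology}"
  assumes "compact K" "continuous_on UNIV f"
  shows "integrable (lebesgue_on K) f"
  using assms
  by (intro integrable_continuous_compact finite_measure_lebesgue_on_compact
      measurable_restrict_space1 measurable_completion)
    (auto intro: borel_measurable_continuous_onI)

lemma integrable_face_measure:
  fixes f :: "'a::euclidean_space \<Rightarrow> 'b::{banach, second_countable_topology}"
  assumes "compact e" "continuous_on UNIV f"
  shows "integrable (face_measure e) f"
  using assms
  by (intro integrable_continuous_compact finite_measure_face_measure borel_measurable_face_measure)
    (auto intro: borel_measurable_continuous_onI)

lemma integral_lebesgue_on_borel:
  fixes f :: "'a::euclidean_space \<Rightarrow> 'b::{banach, second_countable_topology}"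
  assumes K: "K \<in> sets borel" and f [measurable]: "f \<in> borel_measurable borel"
  shows "(LINT x|lebesgue_on K. f x) = (LINT x|lborel. indicator K x *\<^sub>R f x)"
proof -
  note [measurable] = K
  have "(LINT x|lebesgue_on K. f x) = (LINT x|lebesgue. indicator K x *\<^sub>R f x)"
    using K by (intro integral_restrict_space) simp
  also have "\<dots> = (LINT x|lborel. indicator K x *\<^sub>R f x)"
    by (rule integral_completion) measurable
  finally show ?thesis .
qed

lemma integral_lborel_shift:
  fixes f :: "'a::euclidean_space \<Rightarrow> 'b::{banach, second_countable_topology}"
  assumes [measurable]: "f \<in> borel_measurable borel"
  shows "(LINT x|lborel. f (x + u)) = (LINT x|lborel. f x)"
proof -
  have "(LINT x|lborel. f x) = (LINT x|distr lborel borel ((+) u). f x)"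
    by (simp add: lborel_distr_plus)
  then show ?thesis
    by (simp add: integral_distr add.commute)
qed

text \<open>Translating the apex \<open>u\<close> to the origin reduces this to
  \<open>integral_cone\<close>; the facet integral is parametrised from the foot of the
  perpendicular from \<open>u\<close>. Only measurability and integrability of \<open>q\<close> are
  asked, because \<open>q\<close> will also be a function extended radially from the facet, which
  may be discontinuous at the apex.\<close>

lemma integral_simplex_cone:
  fixes q :: "'a::euclidean_space \<Rightarrow> real" and u :: 'a
  assumes C: "finite C" "u \<notin> C" and e: "e = convex hull C" "e \<noteq> {}" "aff_dim e = int DIM('a) - 1"
    and K: "K = convex hull (insert u C)"
    and n: "norm n = 1" and lev: "\<And>y. y \<in> e \<Longrightarrow> (y - u) \<bullet> n = h" and h: "h > 0"
    and hom: "\<And>r y. r > 0 \<Longrightarrow> q (r *\<^sub>R y) = r ^ m * q y"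
    and q [measurable]: "q \<in> borel_measurable borel"
    and int: "integrable (lebesgue_on K) (\<lambda>x. q (x - u))"
  shows "(LINT x|lebesgue_on K. q (x - u)) = h / (DIM('a) + m) * (LINT x|face_measure e. q (x - u))"
proof -
  let ?B = "tangent_basis e"
  have lev': "x \<bullet> n = y \<bullet> n" if "x \<in> e" "y \<in> e" for x y
    using lev[OF that(1)] lev[OF that(2)] by (simp add: inner_diff_left)
  note B = tangent_basis_facet[OF e(2,3) n lev']
  define E where "E = (\<lambda>z. z - u) ` e"
  define K0 where "K0 = (\<lambda>z. z - u) ` K"
  have n1: "n \<bullet> n = 1" using n by (simp add: norm_eq_1)
  have Cne: "C \<noteq> {}" using e by auto
  have cK: "compact K" using K C by (auto intro: finite_imp_compact_convex_hull)
  have ce: "compact e" using e C by (auto intro: finite_imp_compact_convex_hull)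
  have [measurable]: "K \<in> sets borel" "e \<in> sets borel"
    using cK ce by (auto intro: borel_closed compact_imp_closed)
  have K0: "K0 = {r *\<^sub>R y |r y. 0 \<le> r \<and> r \<le> 1 \<and> y \<in> E}"
  proof -
    have KK: "K = {x. \<exists>a\<ge>0. \<exists>v\<ge>0. \<exists>b. a + v = 1 \<and> b \<in> e \<and> x = a *\<^sub>R u + v *\<^sub>R b}"
      unfolding K e(1) by (rule convex_hull_insert[OF Cne])
    have id: "a *\<^sub>R u + v *\<^sub>R b - u = v *\<^sub>R (b - u)" if "a + v = 1" for a v :: real and b
    proof -
      have a: "a = 1 - v" using that by simp
      show ?thesis unfolding a by (simp add: algebra_simps)
    qed
    have "K0 = {v *\<^sub>R (b - u) |v b. 0 \<le> v \<and> v \<le> 1 \<and> b \<in> e}"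
    proof (intro equalityI subsetI)
      fix z assume "z \<in> K0"
      then obtain a v b where *: "a \<ge> 0" "v \<ge> 0" "a + v = 1" "b \<in> e" "z = a *\<^sub>R u + v *\<^sub>R b - u"
        unfolding K0_def KK by blast
      then have "z = v *\<^sub>R (b - u)" "v \<le> 1" using id by simp_all
      then show "z \<in> {v *\<^sub>R (b - u) |v b. 0 \<le> v \<and> v \<le> 1 \<and> b \<in> e}" using * by blast
    next
      fix z assume "z \<in> {v *\<^sub>R (b - u) |v b. 0 \<le> v \<and> v \<le> 1 \<and> b \<in> e}"
      then obtain v b where *: "z = v *\<^sub>R (b - u)" "0 \<le> v" "v \<le> 1" "b \<in> e" by blast
      have "(1 - v) *\<^sub>R u + v *\<^sub>R b \<in> K"
        unfolding KK mem_Collect_eq using *(2-4) by (intro exI[of _ "1 - v"] exI[of _ v] exI[of _ b] conjI) auto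
      moreover have "z = ((1 - v) *\<^sub>R u + v *\<^sub>R b) - u"
        using *(1) id[of "1 - v" v b] by simp
      ultimately show "z \<in> K0" unfolding K0_def by blast
    qed
    then show ?thesis
      unfolding E_def by auto
  qed
  have K0K: "indicator K0 (x - u) = (indicator K x :: real)" for x
    unfolding K0_def by (auto simp: indicator_def)
  have EE: "indicator E (x - u) = (indicator e x :: real)" for x
    unfolding E_def by (auto simp: indicator_def)
  have K0m [measurable]: "K0 \<in> sets borel"
    unfolding K0_def using cK by (intro borel_closed compact_imp_closed) (simp add: compact_translation_subtract)
  have sh: "(LINT x|lebesgue_on K. q (x - u)) = (LINT x|lborel. indicator K0 x * q x)"
    using integral_lborel_shift[of "\<lambda>x. indicator K0 x * q x" "- u"]
    by (subst integral_lebesgue_on_borel) (auto simp: K0K)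
  have int': "integrable lborel (\<lambda>x. indicator K0 x * q x)"
  proof -
    have "integrable lebesgue (\<lambda>x. indicator K x *\<^sub>R q (x - u))"
      using int by (subst (asm) integrable_restrict_space) auto
    then have "integrable lborel (\<lambda>x. indicator K x *\<^sub>R q (x - u))"
      by (subst (asm) integrable_completion) measurable
    then have "integrable lborel (\<lambda>x. indicator K0 (x - u) * q (x - u))"
      by (simp add: K0K)
    then have "integrable (distr lborel borel ((+) u)) (\<lambda>x. indicator K0 (x - u) * q (x - u))"
      by (simp add: lborel_distr_plus)
    then show ?thesis
      by (subst (asm) integrable_distr_eq) auto
  qed
  have levE: "y \<bullet> n = h" if "y \<in> E" for y
    using that lev unfolding E_def by auto
  have face: "(LINT x|face_measure e. q (x - u)) = (LINT t|PiM ?B (\<lambda>_. lborel).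
      indicator E (h *\<^sub>R n + flat_sum ?B t) * q (h *\<^sub>R n + flat_sum ?B t))"
  proof -
    obtain x where x: "x \<in> e" using e(2) by blast
    have "(u + h *\<^sub>R n - x) \<bullet> n = 0"
      using lev[OF x] n1 by (simp add: inner_diff_left inner_add_left)
    then have "u + h *\<^sub>R n - x \<in> tangent_space e"
      using tangent_space_facet[OF e(2,3) n lev'] by blast
    from integral_face_measure[OF _ x this, of "\<lambda>x. q (x - u)"]
    have "(LINT x|face_measure e. q (x - u)) = (LINT t|PiM ?B (\<lambda>_. lborel).
        indicator e (u + h *\<^sub>R n + flat_sum ?B t) * q (u + h *\<^sub>R n + flat_sum ?B t - u))"
      by simp
    also have "\<dots> = (LINT t|PiM ?B (\<lambda>_. lborel).
        indicator E (h *\<^sub>R n + flat_sum ?B t) * q (h *\<^sub>R n + flat_sum ?B t))"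
    proof (rule Bochner_Integration.integral_cong[OF refl])
      fix t
      show "indicator e (u + h *\<^sub>R n + flat_sum ?B t) * q (u + h *\<^sub>R n + flat_sum ?B t - u)
          = indicator E (h *\<^sub>R n + flat_sum ?B t) * q (h *\<^sub>R n + flat_sum ?B t)"
        using EE[of "u + (h *\<^sub>R n + flat_sum ?B t)"] by (simp add: add.assoc)
    qed
    finally show ?thesis .
  qed
  show ?thesis
    unfolding sh face
    using integral_cone[OF B(1,2,3) h levE K0 hom int'] B(4) by simp
qed

section \<open>Integration by parts on a simplex\<close>

text \<open>Facets are indexed by their opposite vertices. The normals are a parameter, so that
  those chosen for a mesh can be inserted.\<close>

locale full_simplex =
  fixes K C :: "'a::euclidean_space set" and N :: "'a \<Rightarrow> 'a"
  assumes C: "\<not> affine_dependent C" "card C = Suc DIM('a)" and K: "K = convex hull C"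
    and N: "\<And>u. u \<in> C \<Longrightarrow> facet_normal K (convex hull (C - {u})) (N u)"
begin

abbreviation opp :: "'a \<Rightarrow> 'a set" where "opp u \<equiv> convex hull (C - {u})"

lemma finite_C: "finite C"
  using C(1) by (rule aff_independent_finite)

lemma compact_K: "compact K"
  unfolding K using finite_C by (rule finite_imp_compact_convex_hull)

lemma compact_opp: "compact (opp u)"
  using finite_C by (intro finite_imp_compact_convex_hull) simp

lemma opp_ne: "u \<in> C \<Longrightarrow> opp u \<noteq> {}"
  using C(2) finite_C DIM_positive[where 'a='a] by (auto simp: card_1_singleton_iff dest!: card_mono[of "{u}" C, rotated])

lemma facet_iff: "e facet_of K \<longleftrightarrow> (\<exists>u\<in>C. e = opp u)"
  unfolding K facet_of_convex_hull_affine_independent[OF C(1)] using opp_ne by auto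

lemma simplex_K: "int DIM('a) simplex K"
  unfolding simplex_def K using C by auto

lemma opp_dim: "u \<in> C \<Longrightarrow> aff_dim (opp u) = int DIM('a) - 1"
  using facet_aff_dim[OF simplex_K] facet_iff by blast

lemma affine_hull_C: "affine hull C = UNIV"
  using affine_independent_span_eq[OF C(1)] C(2) by simp

lemma interior_K: "interior K \<noteq> {}"
  unfolding K using C interior_convex_hull_eq_empty[of C] by auto

lemma facets_K: "{e. e facet_of K} = opp ` C"
  using facet_iff by auto

lemma opp_notin: "u \<in> C \<Longrightarrow> u \<notin> opp u"
proof
  assume u: "u \<in> C" "u \<in> opp u"
  then have "u \<in> affine hull (C - {u})" using convex_hull_subset_affine_hull by blast
  then show False using C(1) u(1) unfolding affine_dependent_def by blast
qed

lemma inj_opp: "inj_on opp C"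
proof (rule inj_onI)
  fix u v assume "u \<in> C" "v \<in> C" "opp u = opp v"
  then show "u = v"
    using opp_notin[of v] hull_inc[of v "C - {u}" convex] by auto
qed

lemma height_pos: "u \<in> C \<Longrightarrow> y \<in> opp u \<Longrightarrow> (y - u) \<bullet> N u > 0"
proof -
  assume u: "u \<in> C" and y: "y \<in> opp u"
  have uK: "u \<in> K" unfolding K by (rule hull_inc[OF u])
  have "u \<bullet> N u \<le> y \<bullet> N u" by (rule facet_normal_inner_le[OF N[OF u] uK y])
  moreover have "u \<bullet> N u \<noteq> y \<bullet> N u"
    using facet_normal_memI[OF N[OF u] uK y] opp_notin[OF u] by auto
  ultimately show ?thesis by (simp add: inner_diff_left)
qed

lemma norm_N: "u \<in> C \<Longrightarrow> norm (N u) = 1"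
  using N unfolding facet_normal_def by blast

lemma integral_cone_opp:
  fixes q :: "'a \<Rightarrow> real"
  assumes u: "u \<in> C" and y: "y \<in> opp u"
    and hom: "\<And>r y. r > 0 \<Longrightarrow> q (r *\<^sub>R y) = r ^ m * q y"
    and q: "q \<in> borel_measurable borel"
    and int: "integrable (lebesgue_on K) (\<lambda>x. q (x - u))"
  shows "(LINT x|lebesgue_on K. q (x - u))
    = ((y - u) \<bullet> N u) / (DIM('a) + m) * (LINT x|face_measure (opp u). q (x - u))"
proof (rule integral_simplex_cone[OF _ _ refl opp_ne opp_dim _ norm_N _ height_pos hom q int])
  show "K = convex hull (insert u (C - {u}))"
    unfolding K using u by (simp add: insert_absorb)
  show "(z - u) \<bullet> N u = (y - u) \<bullet> N u" if "z \<in> opp u" for z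
    using facet_normal_inner_eq[OF N[OF u] that y] by (simp add: inner_diff_left)
qed (use finite_C u y in auto)

text \<open>
  Extending \<open>\<phi>\<close> from the face to the cone by degree-0 homogeneity reduces the claim to Lebesgue
  measure on the simplex.
\<close>

lemma integral_opp_eq_0_imp:
  fixes \<phi> :: "'a \<Rightarrow> real"
  assumes u: "u \<in> C" and \<phi>: "continuous_on UNIV \<phi>" "\<And>x. \<phi> x \<ge> 0"
    and zero: "(LINT x|face_measure (opp u). \<phi> x) = 0" and z: "z \<in> opp u"
  shows "\<phi> z = 0"
proof (rule ccontr)
  assume nz: "\<phi> z \<noteq> 0"
  define h where "h = (z - u) \<bullet> N u"
  have h: "h > 0" unfolding h_def by (rule height_pos[OF u z])
  \<comment> \<open>Radial projection from \<open>u\<close> to the plane of the facet, followed by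
    \<phi>. Where \<open>y \<bullet> N u = 0\<close> the quotient is 0 and the value is
    \<open>\<phi> u\<close>; hence the bound \<open>max c (\<phi> u)\<close> on the simplex.\<close>
  define q where "q y = \<phi> (u + (h / (y \<bullet> N u)) *\<^sub>R y)" for y
  have \<phi>m [measurable]: "\<phi> \<in> borel_measurable borel"
    using \<phi>(1) by (rule borel_measurable_continuous_onI)
  have q [measurable]: "q \<in> borel_measurable borel"
    unfolding q_def[abs_def] by measurable
  have hom: "q (r *\<^sub>R y) = r ^ 0 * q y" if "r > 0" for r y
    using that by (simp add: q_def)
  have lev: "(x - u) \<bullet> N u = h" if "x \<in> opp u" for x
    unfolding h_def using facet_normal_inner_eq[OF N[OF u] that z] by (simp add: inner_diff_left)
  have qface: "q (x - u) = \<phi> x" if "x \<in> opp u" for x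
    using lev[OF that] h by (simp add: q_def)
  obtain c where c: "\<And>x. x \<in> opp u \<Longrightarrow> \<phi> x \<le> c"
  proof -
    have "bounded (\<phi> ` opp u)"
      using compact_continuous_image[OF continuous_on_subset[OF \<phi>(1) subset_UNIV] compact_opp[of u]]
      by (rule compact_imp_bounded)
    then have "bdd_above (\<phi> ` opp u)" by (rule bounded_imp_bdd_above)
    then show ?thesis using that unfolding bdd_above_def by blast
  qed
  have KC: "K = {x. \<exists>a\<ge>0. \<exists>v\<ge>0. \<exists>b. a + v = 1 \<and> b \<in> opp u \<and> x = a *\<^sub>R u + v *\<^sub>R b}"
    using convex_hull_insert[of "C - {u}" u] opp_ne[OF u] u unfolding K by (simp add: insert_absorb)
  have qK: "\<bar>q (x - u)\<bar> \<le> max c (\<phi> u)" if xK: "x \<in> K" for x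
  proof -
    from xK[unfolded KC mem_Collect_eq] obtain a v b
      where x: "a \<ge> 0" "v \<ge> 0" "a + v = 1" "b \<in> opp u" "x = a *\<^sub>R u + v *\<^sub>R b"
      by blast
    have a: "a = 1 - v" using x(3) by simp
    have d: "x - u = v *\<^sub>R (b - u)" unfolding x(5) a by (simp add: algebra_simps)
    show ?thesis
    proof (cases "v = 0")
      case True
      then show ?thesis using d \<phi>(2) by (simp add: q_def)
    next
      case False
      then have "q (x - u) = \<phi> b"
        using hom[of v "b - u"] x(2) qface[OF x(4)] d by simp
      then show ?thesis using c[OF x(4)] \<phi>(2) by simp
    qed
  qed
  interpret finite_measure "lebesgue_on K"
    by (rule finite_measure_lebesgue_on_compact[OF compact_K])
  have int: "integrable (lebesgue_on K) (\<lambda>x. q (x - u))"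
    using qK
    by (intro integrable_const_bound[of _ "max c (\<phi> u)"] AE_I2 measurable_restrict_space1
        measurable_completion) (auto simp del: max_less_iff_conj)
  have "(LINT x|face_measure (opp u). q (x - u)) = (LINT x|face_measure (opp u). \<phi> x)"
    by (rule Bochner_Integration.integral_cong) (auto simp: qface)
  then have "(LINT x|lebesgue_on K. q (x - u)) = 0"
    using integral_cone_opp[OF u z hom q int] zero by simp
  then have "AE x in lebesgue_on K. q (x - u) = 0"
    using integral_nonneg_eq_0_iff_AE[OF int] \<phi>(2) by (simp add: q_def)
  then have ae: "AE x in lebesgue. x \<in> K \<longrightarrow> q (x - u) = 0"
    using lmeasurable_compact[OF compact_K]
    by (subst (asm) AE_restrict_space_iff) (auto simp: fmeasurable_def)
  \<comment> \<open>On this open half-space the denominator does not vanish and the extension is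
    continuous.\<close>
  define H where "H = {x. (x - u) \<bullet> N u > 0}"
  have oH: "open H"
    unfolding H_def by (intro open_Collect_less continuous_intros)
  have contH: "continuous_on H (\<lambda>x. q (x - u))"
    unfolding q_def by (intro continuous_on_compose2[OF \<phi>(1)] continuous_intros) (auto simp: H_def)
  define S where "S = interior K \<inter> ((\<lambda>x. q (x - u)) -` {0<..} \<inter> H)"
  have oS: "open S"
  proof -
    have "open ((\<lambda>x. q (x - u)) -` {0<..} \<inter> H)"
      using contH oH by (simp add: continuous_on_open_vimage)
    then show ?thesis unfolding S_def by (rule open_Int[OF open_interior])
  qed
  \<comment> \<open>The midpoint between apex and \<open>z\<close> projects to \<open>z\<close>, so
    the extension is positive there. It need not be interior to K, but K is the closure of its
    interior, so interior points of the same kind exist.\<close>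
  define x0 where "x0 = (1 / 2) *\<^sub>R u + (1 / 2) *\<^sub>R z"
  have d0: "x0 - u = (1 / 2) *\<^sub>R (z - u)" unfolding x0_def by (simp add: algebra_simps flip: scaleR_add_left)
  have "x0 \<in> K" unfolding KC x0_def mem_Collect_eq using z by (intro exI[of _ "1/2"] exI[of _ z] conjI) auto
  moreover have "x0 \<in> H" unfolding H_def using h d0 by (simp add: h_def)
  moreover have "q (x0 - u) > 0"
    using hom[of "1/2" "z - u"] qface[OF z] nz \<phi>(2)[of z] d0 by simp
  moreover have "K = closure (interior K)"
    using convex_closure_interior[of K] interior_K compact_K
    by (simp add: K convex_convex_hull compact_imp_closed closure_closed)
  moreover have "open ((\<lambda>x. q (x - u)) -` {0<..} \<inter> H)"
    using contH oH by (simp add: continuous_on_open_vimage)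
  ultimately have "S \<noteq> {}"
    unfolding S_def using open_Int_closure_eq_empty[of "(\<lambda>x. q (x - u)) -` {0<..} \<inter> H" "interior K"] by auto
  then obtain x where x: "x \<in> S" by auto
  have "AE x\<in>S in lebesgue. x \<in> {}"
    using ae by eventually_elim (auto simp: S_def dest: interior_subset[THEN subsetD])
  from mem_closed_if_AE_lebesgue_open[OF oS closed_empty this x] show False by simp
qed

text \<open>Divergence theorem for the field |w|^2 (x - u), which is tangential on all facets
  through \<open>u\<close>, so that only the opposite one contributes. Expanding |w|^2 about
  \<open>u\<close> into homogeneous parts of degree m = 0, 1, 2, the integrand becomes the sum of (d
  + m) times these parts by Euler's relation, and d + m is the denominator in the cone
  formula.\<close>

lemma vertex_identity:
  assumes w: "w \<in> P1" and u: "u \<in> C" and y: "y \<in> opp u"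
  shows "(LINT x|lebesgue_on K. DIM('a) * (cmod (w x))\<^sup>2 + 2 * Re (w x * cnj (w (x - u) - w 0)))
    = ((y - u) \<bullet> N u) * (LINT x|face_measure (opp u). (cmod (w x))\<^sup>2)"
proof -
  define L where "L v = w v - w 0" for v
  define a where "a = w u"
  have lin: "linear L" unfolding L_def[abs_def] using w by (simp add: P1_iff_linear)
  have L_scale: "L (r *\<^sub>R v) = of_real r * L v" for r v
    using linear_scale[OF lin] by (simp add: scaleR_conv_of_real)
  have w_eq: "w x = a + L (x - u)" for x
    using P1_add_arg[OF w, of u "x - u"] by (simp add: L_def a_def)
  have cw: "continuous_on UNIV w" using w by (rule P1_continuous_on)
  have cL: "continuous_on UNIV L" unfolding L_def[abs_def] by (intro continuous_intros cw)
  define q0 q1 q2 :: "'a \<Rightarrow> real"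
    where "q0 = (\<lambda>_. (cmod a)\<^sup>2)" and "q1 = (\<lambda>v. 2 * Re (a * cnj (L v)))" and "q2 = (\<lambda>v. (cmod (L v))\<^sup>2)"
  have cont: "continuous_on UNIV q0" "continuous_on UNIV q1" "continuous_on UNIV q2"
    unfolding q0_def q1_def q2_def by (intro continuous_intros cL)+
  have cont': "continuous_on UNIV (\<lambda>x. q (x - u))" if "continuous_on UNIV q" for q :: "'a \<Rightarrow> real"
    by (rule continuous_on_compose2[OF that]) (auto intro!: continuous_intros)
  have hom: "q0 (r *\<^sub>R v) = r ^ 0 * q0 v" "q1 (r *\<^sub>R v) = r ^ 1 * q1 v" "q2 (r *\<^sub>R v) = r ^ 2 * q2 v" for r v
    by (simp_all add: q0_def q1_def q2_def L_scale norm_mult power_mult_distrib algebra_simps)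
  have int: "integrable (lebesgue_on K) (\<lambda>x. q (x - u))" if "continuous_on UNIV q" for q :: "'a \<Rightarrow> real"
    by (rule integrable_lebesgue_on_compact[OF compact_K cont'[OF that]])
  have intf: "integrable (face_measure (opp u)) (\<lambda>x. q (x - u))" if "continuous_on UNIV q" for q :: "'a \<Rightarrow> real"
    by (rule integrable_face_measure[OF compact_opp cont'[OF that]])
  let ?h = "(y - u) \<bullet> N u"
  have cone: "(DIM('a) + m) * (LINT x|lebesgue_on K. q (x - u)) = ?h * (LINT x|face_measure (opp u). q (x - u))"
    if q: "continuous_on UNIV q" and h: "\<And>r v. q (r *\<^sub>R v) = r ^ m * q v" for q m
  proof -
    have "real (DIM('a) + m) \<noteq> 0"
      using DIM_positive[where 'a='a] by linarith
    then show ?thesis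
      using integral_cone_opp[OF u y h borel_measurable_continuous_onI[OF q] int[OF q]]
      by (simp del: of_nat_add)
  qed
  have sq: "(cmod (w x))\<^sup>2 = q0 (x - u) + q1 (x - u) + q2 (x - u)" for x
    unfolding w_eq q0_def q1_def q2_def cmod_power2 by (simp add: power2_eq_square algebra_simps)
  have dw: "2 * Re (w x * cnj (L (x - u))) = q1 (x - u) + 2 * q2 (x - u)" for x
    unfolding w_eq q1_def q2_def cmod_power2 by (simp add: power2_eq_square algebra_simps)
  have "(LINT x|lebesgue_on K. DIM('a) * (cmod (w x))\<^sup>2 + 2 * Re (w x * cnj (w (x - u) - w 0)))
      = (LINT x|lebesgue_on K. (DIM('a) + 0) * q0 (x - u) + (DIM('a) + 1) * q1 (x - u) + (DIM('a) + 2) * q2 (x - u))"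
    unfolding L_def[symmetric] dw sq by (simp add: algebra_simps)
  also have "\<dots> = (DIM('a) + 0) * (LINT x|lebesgue_on K. q0 (x - u))
      + (DIM('a) + 1) * (LINT x|lebesgue_on K. q1 (x - u)) + (DIM('a) + 2) * (LINT x|lebesgue_on K. q2 (x - u))"
    using int[OF cont(1)] int[OF cont(2)] int[OF cont(3)] by simp
  also have "\<dots> = ?h * (LINT x|face_measure (opp u). q0 (x - u))
      + ?h * (LINT x|face_measure (opp u). q1 (x - u)) + ?h * (LINT x|face_measure (opp u). q2 (x - u))"
    using cone[OF cont(1) hom(1)] cone[OF cont(2) hom(2)] cone[OF cont(3) hom(3)] by simp
  also have "\<dots> = ?h * (LINT x|face_measure (opp u). (cmod (w x))\<^sup>2)"
    unfolding sq using intf[OF cont(1)] intf[OF cont(2)] intf[OF cont(3)] by (simp add: algebra_simps)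
  finally show ?thesis .
qed

text \<open>
  Barycentric coordinates \<open>c u\<close> of \<open>x0\<close> combine the identities centred at the vertices: the
  distance of \<open>x0\<close> to the facet opposite to \<open>u\<close> is \<open>c u\<close> times the height of \<open>u\<close>.
\<close>

lemma integral_dilation_field:
  assumes w: "w \<in> P1"
  shows "(LINT x|lebesgue_on K. DIM('a) * (cmod (w x))\<^sup>2 + 2 * Re (w x * cnj (w (x - x0) - w 0)))
    = (\<Sum>u\<in>C. LINT x|face_measure (opp u). ((x - x0) \<bullet> N u) * (cmod (w x))\<^sup>2)"
proof -
  obtain c where c: "sum c C = 1" "(\<Sum>u\<in>C. c u *\<^sub>R u) = x0"
    using affine_hull_C affine_hull_finite[OF finite_C] by blast
  define L where "L v = w v - w 0" for v
  have lin: "linear L" unfolding L_def[abs_def] using w by (simp add: P1_iff_linear)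
  have cw: "continuous_on UNIV w" using w by (rule P1_continuous_on)
  have cL: "continuous_on UNIV (\<lambda>x. L (x - v))" for v
    unfolding L_def[abs_def]
    by (intro continuous_intros continuous_on_compose2[OF cw]) auto
  define F where "F v x = DIM('a) * (cmod (w x))\<^sup>2 + 2 * Re (w x * cnj (L (x - v)))" for v x
  \<comment> \<open>The centre enters only through the linear part of \<open>w\<close>, and the
    coefficients \<open>c\<close> sum to 1, which reproduces the term free of the centre.\<close>
  have F_sum: "F x0 x = (\<Sum>u\<in>C. c u * F u x)" for x
  proof -
    have "L (x - x0) = L (\<Sum>u\<in>C. c u *\<^sub>R (x - u))"
      using c by (simp add: scaleR_diff_right sum_subtractf flip: scaleR_left.sum)
    also have "\<dots> = (\<Sum>u\<in>C. of_real (c u) * L (x - u))"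
      by (simp add: linear_sum[OF lin] linear_scale[OF lin] scaleR_conv_of_real)
    finally have L: "L (x - x0) = (\<Sum>u\<in>C. of_real (c u) * L (x - u))" .
    have "(\<Sum>u\<in>C. c u * F u x) = (\<Sum>u\<in>C. c u) * (DIM('a) * (cmod (w x))\<^sup>2)
        + 2 * (\<Sum>u\<in>C. c u * Re (w x * cnj (L (x - u))))"
      by (simp add: F_def ring_distribs sum.distrib sum_distrib_right sum_distrib_left mult.left_commute)
    also have "(\<Sum>u\<in>C. c u * Re (w x * cnj (L (x - u)))) = Re (w x * cnj (L (x - x0)))"
      by (simp add: L sum_distrib_left algebra_simps sum.distrib sum_negf[symmetric] flip: sum_subtractf)
    finally show ?thesis using c by (simp add: F_def)
  qed
  have intF: "integrable (lebesgue_on K) (F v)" for v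
    unfolding F_def[abs_def]
    by (intro integrable_lebesgue_on_compact compact_K continuous_intros cw cL)
  have "(LINT x|lebesgue_on K. F x0 x) = (\<Sum>u\<in>C. c u * (LINT x|lebesgue_on K. F u x))"
    unfolding F_sum using intF by simp
  also have "\<dots> = (\<Sum>u\<in>C. LINT x|face_measure (opp u). ((x - x0) \<bullet> N u) * (cmod (w x))\<^sup>2)"
  proof (rule sum.cong[OF refl])
    fix u assume u: "u \<in> C"
    obtain y where y: "y \<in> opp u" using opp_ne[OF u] by blast
    have lev: "v \<bullet> N u = y \<bullet> N u" if "v \<in> C" "v \<noteq> u" for v
      using that by (intro facet_normal_inner_eq[OF N[OF u] _ y] hull_inc) simp
    have "x0 \<bullet> N u = (\<Sum>v\<in>C. c v * (v \<bullet> N u))"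
      by (simp add: c(2)[symmetric] inner_sum_left)
    also have "\<dots> = c u * (u \<bullet> N u) + (\<Sum>v\<in>C - {u}. c v * (v \<bullet> N u))"
      by (rule sum.remove[OF finite_C u])
    also have "(\<Sum>v\<in>C - {u}. c v * (v \<bullet> N u)) = (\<Sum>v\<in>C - {u}. c v * (y \<bullet> N u))"
      using lev by (intro sum.cong) auto
    also have "\<dots> = (1 - c u) * (y \<bullet> N u)"
      using sum.remove[OF finite_C u, of c] c(1) by (simp flip: sum_distrib_right)
    finally have lam: "(y - x0) \<bullet> N u = c u * ((y - u) \<bullet> N u)"
      by (simp add: inner_diff_left algebra_simps)
    have "(LINT x|face_measure (opp u). ((x - x0) \<bullet> N u) * (cmod (w x))\<^sup>2)
        = (LINT x|face_measure (opp u). ((y - x0) \<bullet> N u) * (cmod (w x))\<^sup>2)"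
      using facet_normal_inner_eq[OF N[OF u] _ y]
      by (intro Bochner_Integration.integral_cong refl) (simp add: inner_diff_left)
    also have "\<dots> = c u * (LINT x|lebesgue_on K. F u x)"
      unfolding F_def L_def vertex_identity[OF w u y] lam by simp
    finally show "c u * (LINT x|lebesgue_on K. F u x)
        = (LINT x|face_measure (opp u). ((x - x0) \<bullet> N u) * (cmod (w x))\<^sup>2)" by simp
  qed
  finally show ?thesis unfolding F_def L_def .
qed

end

section \<open>Facets of a triangulation\<close>

text \<open>A point slightly below the hyperplane lies on a segment from \<open>p\<close> to a point
  of the disc that the hyperplane has in \<open>K\<close>.\<close>

lemma convex_half_ball:
  fixes K :: "'a::euclidean_space set"
  assumes K: "convex K" and p: "p \<in> K" "(p - x) \<bullet> n < 0"
    and \<rho>: "\<rho> > 0" "\<And>z. (z - x) \<bullet> n = 0 \<Longrightarrow> dist z x < \<rho> \<Longrightarrow> z \<in> K" and n: "norm n = 1"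
  shows "\<exists>r>0. \<forall>y\<in>ball x r. (y - x) \<bullet> n \<le> 0 \<longrightarrow> y \<in> K"
proof -
  define c where "c = - ((p - x) \<bullet> n)"
  define M where "M = norm (p - x) / c + 1"
  have c: "c > 0" using p unfolding c_def by simp
  have M: "M \<ge> 1" using c unfolding M_def by simp
  \<comment> \<open>The first bound gives t \<le> 1/2 below; the second keeps the hyperplane point
    \<open>z\<close> within \<rho> of \<open>x\<close>, since norm (z - x) \<le> 2 M norm (y -
    x).\<close>
  define r where "r = min (c / 2) (\<rho> / (2 * M))"
  have r: "r > 0" using c \<rho> M unfolding r_def by simp
  have "y \<in> K" if y: "y \<in> ball x r" "(y - x) \<bullet> n \<le> 0" for y
  proof -
    \<comment> \<open>The depth of \<open>y\<close> relative to that of \<open>p\<close>: removing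
      the share \<open>t\<close> of \<open>p\<close> from \<open>y\<close> leaves a point of the
      hyperplane.\<close>
    define t where "t = - ((y - x) \<bullet> n) / c"
    have d: "norm (y - x) < r" using y(1) by (simp add: dist_norm norm_minus_commute)
    have "- ((y - x) \<bullet> n) \<le> norm (y - x)"
      using Cauchy_Schwarz_ineq2[of "y - x" n] n by simp
    then have tr: "t \<le> norm (y - x) / c" unfolding t_def using c by (intro divide_right_mono) auto
    have t0: "t \<ge> 0" unfolding t_def using c y(2) by (intro divide_nonneg_pos) auto
    have "norm (y - x) / c \<le> r / c" using d c by (intro divide_right_mono) auto
    also have "r / c \<le> 1 / 2" using c unfolding r_def by (simp add: field_simps min_def)
    finally have t1: "t \<le> 1 / 2" using tr by linarith
    define z where "z = x + (1 / (1 - t)) *\<^sub>R ((y - x) - t *\<^sub>R (p - x))"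
    have zn: "(z - x) \<bullet> n = 0"
    proof -
      have "t * ((p - x) \<bullet> n) = (y - x) \<bullet> n"
        using c unfolding t_def c_def by (simp del: inner_diff_left add: field_simps)
      then show ?thesis
        unfolding z_def by (simp only: add_diff_cancel_left' inner_scaleR_left
            inner_diff_left[of "y - x" "t *\<^sub>R (p - x)"]) simp
    qed
    have "norm ((y - x) - t *\<^sub>R (p - x)) \<le> norm (y - x) + t * norm (p - x)"
      using norm_triangle_ineq4[of "y - x" "t *\<^sub>R (p - x)"] t0 by simp
    also have "\<dots> \<le> norm (y - x) + norm (y - x) / c * norm (p - x)"
      using tr by (intro add_left_mono mult_right_mono) auto
    also have "\<dots> = M * norm (y - x)" unfolding M_def by (simp add: algebra_simps)
    finally have nb: "norm ((y - x) - t *\<^sub>R (p - x)) \<le> M * norm (y - x)" .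
    have "norm (z - x) = 1 / (1 - t) * norm ((y - x) - t *\<^sub>R (p - x))"
      using t1 unfolding z_def by simp
    also have "\<dots> \<le> 2 * (M * norm (y - x))"
      using nb t1 by (intro mult_mono) (auto simp: field_simps)
    also have "\<dots> < 2 * (M * r)" using d M by simp
    also have "\<dots> \<le> 2 * (M * (\<rho> / (2 * M)))"
      using M unfolding r_def by (intro mult_left_mono) auto
    also have "\<dots> = \<rho>" using M by simp
    finally have "z \<in> K" using \<rho>(2)[OF zn] by (simp add: dist_norm)
    moreover have "y = (1 - t) *\<^sub>R z + t *\<^sub>R p"
    proof -
      have "(1 - t) *\<^sub>R z = (1 - t) *\<^sub>R x + ((y - x) - t *\<^sub>R (p - x))"
        using t1 unfolding z_def scaleR_add_right by simp
      then show ?thesis by (simp add: algebra_simps)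
    qed
    ultimately show "y \<in> K" using convexD[OF K, of z p "1 - t" t] p(1) t0 t1 by simp
  qed
  with r show ?thesis by blast
qed

text \<open>If the normals differed, a small step along n' - n would go inwards with respect to
  \<open>n\<close> and outwards with respect to \<open>n'\<close>.\<close>

lemma outward_normal_unique:
  assumes "outward_normal S x n" "outward_normal S x n'"
  shows "n = n'"
proof (rule ccontr)
  assume ne: "n \<noteq> n'"
  obtain r where r: "r > 0" "\<And>y. y \<in> ball x r \<Longrightarrow> (y - x) \<bullet> n < 0 \<Longrightarrow> y \<in> S"
    and n: "norm n = 1" using assms(1) unfolding outward_normal_def by blast
  obtain r' where r': "r' > 0" "\<And>y. y \<in> ball x r' \<Longrightarrow> (y - x) \<bullet> n' > 0 \<Longrightarrow> y \<notin> S"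
    and n': "norm n' = 1" using assms(2) unfolding outward_normal_def by blast
  have "n \<bullet> n' < 1"
  proof -
    have "0 < (norm (n - n'))\<^sup>2" using ne by simp
    also have "\<dots> = 2 - 2 * (n \<bullet> n')"
      using n n' by (simp add: power2_norm_eq_inner inner_diff_left inner_diff_right norm_eq_1 inner_commute)
    finally show ?thesis by simp
  qed
  \<comment> \<open>Since norm (n' - n) \<le> 2, the step stays inside both balls.\<close>
  define s where "s = min r r' / 4"
  have s: "s > 0" using r(1) r'(1) unfolding s_def by simp
  define y where "y = x + s *\<^sub>R (n' - n)"
  have "norm (n' - n) \<le> 2" using norm_triangle_ineq4[of n' n] n n' by simp
  then have "s * norm (n' - n) \<le> s * 2" using s by (intro mult_left_mono) auto
  also have "\<dots> < min r r'" using r(1) r'(1) unfolding s_def by (simp add: min_def)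
  finally have "y \<in> ball x r" "y \<in> ball x r'"
    unfolding y_def using s by (auto simp: dist_norm)
  moreover have "(y - x) \<bullet> n < 0"
    using \<open>n \<bullet> n' < 1\<close> s n unfolding y_def
    by (simp add: inner_diff_left inner_diff_right norm_eq_1 inner_commute mult_less_0_iff)
  moreover have "(y - x) \<bullet> n' > 0"
    using \<open>n \<bullet> n' < 1\<close> s n' unfolding y_def
    by (simp add: inner_diff_left inner_diff_right norm_eq_1 inner_commute)
  ultimately show False using r(2) r'(2) by blast
qed

lemma unit_normal_eq:
  assumes "rel_interior e \<noteq> {}" "\<And>x. x \<in> rel_interior e \<Longrightarrow> outward_normal S x n"
  shows "unit_normal S e = n"
  unfolding unit_normal_def using assms outward_normal_unique by (intro the_equality) blast+

locale simplicial_mesh =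
  fixes \<T> :: "'a::euclidean_space set set" and lab :: "'a set \<Rightarrow> nat"
  assumes tri: "triangulation \<T>" and full: "\<And>K. K \<in> \<T> \<Longrightarrow> int DIM('a) simplex K"
    and labels: "inj_on lab \<T>" and dim: "DIM('a) \<ge> 2"
begin

definition nrm :: "'a set \<Rightarrow> 'a set \<Rightarrow> 'a" where
  "nrm K e = (SOME n. facet_normal K e n)"

lemma finite_T: "finite \<T>"
  using tri unfolding triangulation_def by blast

lemma face_Int: "K \<in> \<T> \<Longrightarrow> K' \<in> \<T> \<Longrightarrow> (K \<inter> K') face_of K"
  using tri unfolding triangulation_def by blast

lemma compact_elem: "K \<in> \<T> \<Longrightarrow> compact K"
  using full compact_simplex by blast

lemma convex_elem: "K \<in> \<T> \<Longrightarrow> convex K"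
  using full convex_simplex by blast

lemma aff_dim_elem: "K \<in> \<T> \<Longrightarrow> aff_dim K = int DIM('a)"
  using full aff_dim_simplex by blast

lemma facet_normal_nrm:
  assumes "K \<in> \<T>" "e facet_of K"
  shows "facet_normal K e (nrm K e)"
  unfolding nrm_def
  by (rule someI_ex, rule facet_normal_exists[OF simplex_imp_polyhedron[OF full[OF assms(1)]] assms(2)])

lemma norm_nrm: "K \<in> \<T> \<Longrightarrow> e facet_of K \<Longrightarrow> norm (nrm K e) = 1"
  using facet_normal_nrm unfolding facet_normal_def by blast

lemma full_simplexE:
  assumes "K \<in> \<T>"
  obtains C N where "full_simplex K C N" "\<And>u. u \<in> C \<Longrightarrow> N u = nrm K (convex hull (C - {u}))"
proof -
  obtain C where C: "\<not> affine_dependent C" "int (card C) = int DIM('a) + 1" "K = convex hull C"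
    using full[OF assms] unfolding simplex_def by blast
  define N where "N u = nrm K (convex hull (C - {u}))" for u
  have "card C = Suc DIM('a)" using C(2) by simp
  moreover have "facet_normal K (convex hull (C - {u})) (N u)" if u: "u \<in> C" for u
  proof -
    have "C - {u} \<noteq> {}"
    proof -
      have "card (C - {u}) = DIM('a)" using C(2) card_Diff_singleton[OF u] by simp
      then show ?thesis using DIM_positive[where 'a='a] by force
    qed
    then have "convex hull (C - {u}) facet_of K"
      unfolding C(3) facet_of_convex_hull_affine_independent[OF C(1)] using u by auto
    then show ?thesis unfolding N_def by (rule facet_normal_nrm[OF assms])
  qed
  ultimately have "full_simplex K C N" using C by unfold_locales auto
  then show ?thesis using that N_def by blast
qed

lemma interior_elem: "K \<in> \<T> \<Longrightarrow> interior K \<noteq> {}"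
  using full_simplexE full_simplex.interior_K by metis

lemma
  assumes "K \<in> \<T>" "e facet_of K"
  shows convex_facet: "convex e" and compact_facet: "compact e" and facet_ne: "e \<noteq> {}"
    and aff_dim_facet: "aff_dim e = int DIM('a) - 1" and rel_interior_facet: "rel_interior e \<noteq> {}"
    and facet_subset: "e \<subseteq> K"
proof -
  have f: "e face_of K" using assms(2) by (rule facet_of_imp_face_of)
  show c: "convex e" using f by (rule face_of_imp_convex)
  show "compact e"
    by (rule face_of_imp_compact[OF convex_elem[OF assms(1)] compact_elem[OF assms(1)] f])
  show ne: "e \<noteq> {}" and "aff_dim e = int DIM('a) - 1"
    using facet_aff_dim[OF full[OF assms(1)] assms(2)] by auto
  show "rel_interior e \<noteq> {}" using ne c by (simp add: rel_interior_eq_empty)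
  show "e \<subseteq> K" using f by (rule face_of_imp_subset)
qed

text \<open>In dimension at least 2 a facet is more than a point. This gives the penalty weights,
  which multiply or divide by the diameter, the sign of their parameters.\<close>

lemma diameter_facet_pos:
  assumes "K \<in> \<T>" "e facet_of K"
  shows "diameter e > 0"
proof -
  obtain x where x: "x \<in> e" using facet_ne[OF assms] by auto
  have "e \<noteq> {x}" using aff_dim_facet[OF assms] dim by auto
  then obtain y where y: "y \<in> e" "y \<noteq> x" using x by auto
  have "dist x y \<le> diameter e"
    using compact_imp_bounded[OF compact_facet[OF assms]] x y(1) by (rule diameter_bounded_bound)
  moreover have "0 < dist x y" using y(2) by simp
  ultimately show ?thesis by linarith
qed

lemma tangent_space_nrm:
  assumes "K \<in> \<T>" "e facet_of K"
  shows "tangent_space e = {v. v \<bullet> nrm K e = 0}"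
  using facet_ne[OF assms] aff_dim_facet[OF assms] norm_nrm[OF assms]
    facet_normal_inner_eq[OF facet_normal_nrm[OF assms]]
  by (intro tangent_space_facet)

text \<open>Around a relative interior point the facet contains a disc of its hyperplane, and the
  element has a point strictly below it, so \<open>convex_half_ball\<close> yields one inclusion;
  the supporting half-space yields the other.\<close>

lemma facet_half_ball:
  assumes K: "K \<in> \<T>" and e: "e facet_of K" and x: "x \<in> rel_interior e"
  shows "\<exists>r>0. \<forall>y\<in>ball x r. y \<in> K \<longleftrightarrow> (y - x) \<bullet> nrm K e \<le> 0"
proof -
  let ?n = "nrm K e"
  have fn: "facet_normal K e ?n" by (rule facet_normal_nrm[OF K e])
  have xe: "x \<in> e" using x rel_interior_subset by blast
  have le: "(y - x) \<bullet> ?n \<le> 0" if "y \<in> K" for y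
    using facet_normal_inner_le[OF fn that xe] by (simp add: inner_diff_left)
  have "aff_dim e \<noteq> aff_dim K" using e by (simp add: facet_of_def)
  then obtain p where p: "p \<in> K" "p \<notin> e"
    using facet_subset[OF K e] by (metis subsetI subset_antisym)
  have "(p - x) \<bullet> ?n \<noteq> 0"
    using facet_normal_memI[OF fn p(1) xe] p(2) by (auto simp: inner_diff_left)
  with le[OF p(1)] have pn: "(p - x) \<bullet> ?n < 0" by simp
  obtain \<rho> where \<rho>: "\<rho> > 0" "ball x \<rho> \<inter> affine hull e \<subseteq> e"
    using x unfolding mem_rel_interior_ball by blast
  \<comment> \<open>The relative interior speaks of the affine hull, the normal of a hyperplane;
    both agree because the tangent space is the full orthogonal complement of the normal.\<close>
  have aff: "z \<in> affine hull e" if z: "(z - x) \<bullet> ?n = 0" for z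
  proof -
    have "z - x \<in> span {x - y |x y. x \<in> e \<and> y \<in> e}"
      using tangent_space_nrm[OF K e] z unfolding tangent_space_def by blast
    also have "span {x - y |x y. x \<in> e \<and> y \<in> e} \<subseteq> (\<lambda>z. z - x) ` (affine hull e)"
    proof (rule span_minimal)
      show "subspace ((\<lambda>z. z - x) ` (affine hull e))"
        using affine_diffs_subspace_subtract[OF affine_affine_hull hull_inc[OF xe]] .
      have "a - b + x \<in> affine hull e" if "a \<in> e" "b \<in> e" for a b
        using mem_affine_3[OF affine_affine_hull[of e] hull_inc[OF that(1)] hull_inc[OF that(2)] hull_inc[OF xe], of 1 "-1" 1]
        by simp
      then show "{x - y |x y. x \<in> e \<and> y \<in> e} \<subseteq> (\<lambda>z. z - x) ` (affine hull e)"
        by (auto simp: image_iff intro!: bexI[of _ "a - b + x" for a b])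
    qed
    finally show ?thesis by auto
  qed
  have "\<exists>r>0. \<forall>y\<in>ball x r. (y - x) \<bullet> ?n \<le> 0 \<longrightarrow> y \<in> K"
  proof (rule convex_half_ball[OF convex_elem[OF K] p(1) pn \<rho>(1) _ norm_nrm[OF K e]])
    fix z assume "(z - x) \<bullet> ?n = 0" "dist z x < \<rho>"
    then have "z \<in> e" using \<rho>(2) aff by (auto simp: dist_commute)
    then show "z \<in> K" using facet_subset[OF K e] by blast
  qed
  then show ?thesis using le by blast
qed

lemma outward_normal_nrm:
  assumes K: "K \<in> \<T>" and e: "e facet_of K" and x: "x \<in> rel_interior e"
  shows "outward_normal K x (nrm K e)"
proof -
  obtain r where r: "r > 0" "\<And>y. y \<in> ball x r \<Longrightarrow> y \<in> K \<longleftrightarrow> (y - x) \<bullet> nrm K e \<le> 0"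
    using facet_half_ball[OF assms] by blast
  show ?thesis
    unfolding outward_normal_def using norm_nrm[OF K e] r(1) by (auto simp: r(2) intro!: exI[of _ r])
qed

lemma unit_normal_nrm:
  assumes K: "K \<in> \<T>" and e: "e facet_of K"
  shows "unit_normal K e = nrm K e"
  using rel_interior_facet[OF assms] outward_normal_nrm[OF assms] by (rule unit_normal_eq)

lemma Int_proper:
  assumes K: "K \<in> \<T>" "K' \<in> \<T>" "K \<noteq> K'"
  shows "K \<inter> K' \<noteq> K"
proof
  assume KK: "K \<inter> K' = K"
  then have "K face_of K'" using face_Int[OF K(2,1)] by (simp add: Int_commute)
  from face_of_aff_dim_lt[OF convex_elem[OF K(2)] this K(3)] show False
    using aff_dim_elem K by simp
qed

lemma interior_elem_disjoint:
  assumes K: "K \<in> \<T>" "K' \<in> \<T>" "K \<noteq> K'"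
  shows "interior K \<inter> K' = {}"
  using face_of_disjoint_interior[OF face_Int[OF K(1,2)] Int_proper[OF K]] interior_subset[of K] by blast

text \<open>Dimension leaves no room: between the facet, of dimension d - 1, and \<open>K\<close>,
  of dimension d, there is no further proper face.\<close>

lemma Int_eq_facet:
  assumes K: "K \<in> \<T>" "K' \<in> \<T>" "K \<noteq> K'" and e: "e facet_of K" and sub: "e \<subseteq> K'"
  shows "e = K \<inter> K'" "e facet_of K'"
proof -
  have F: "(K \<inter> K') face_of K" by (rule face_Int[OF K(1,2)])
  have eF: "e face_of (K \<inter> K')"
    using face_of_subset[OF facet_of_imp_face_of[OF e]] facet_subset[OF K(1) e] sub by blast
  show eq: "e = K \<inter> K'"
  proof (rule ccontr)
    assume "e \<noteq> K \<inter> K'"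
    then have "aff_dim e < aff_dim (K \<inter> K')"
      by (rule face_of_aff_dim_lt[OF convex_Int[OF convex_elem[OF K(1)] convex_elem[OF K(2)]] eF])
    moreover have "aff_dim (K \<inter> K') < aff_dim K"
      by (rule face_of_aff_dim_lt[OF convex_elem[OF K(1)] F Int_proper[OF K]])
    ultimately show False using aff_dim_facet[OF K(1) e] aff_dim_elem[OF K(1)] by simp
  qed
  have "(K' \<inter> K) face_of K'" by (rule face_Int[OF K(2,1)])
  then show "e facet_of K'"
    using eq aff_dim_facet[OF K(1) e] aff_dim_elem[OF K(2)] facet_ne[OF K(1) e]
    by (simp add: facet_of_def Int_commute)
qed

lemma interior_faces_iff:
  "e \<in> interior_faces \<T> \<longleftrightarrow> (\<exists>K\<in>\<T>. \<exists>K'\<in>\<T>. K \<noteq> K' \<and> e facet_of K \<and> e facet_of K')"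
proof
  assume "\<exists>K\<in>\<T>. \<exists>K'\<in>\<T>. K \<noteq> K' \<and> e facet_of K \<and> e facet_of K'"
  then obtain K K' where K: "K \<in> \<T>" "K' \<in> \<T>" "K \<noteq> K'" and e: "e facet_of K" "e facet_of K'"
    by blast
  have "e = K \<inter> K'" by (rule Int_eq_facet(1)[OF K e(1) facet_subset[OF K(2) e(2)]])
  then show "e \<in> interior_faces \<T>" unfolding interior_faces_def using K e by blast
qed (unfold interior_faces_def, blast)

text \<open>Both normals are orthogonal to the same tangent space, hence equal up to sign. Equal
  normals would put one half-ball into both elements, whose interiors are disjoint.\<close>

lemma nrm_opposite:
  assumes K: "K \<in> \<T>" "K' \<in> \<T>" "K \<noteq> K'" and e: "e facet_of K" "e facet_of K'"
  shows "nrm K' e = - nrm K e"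
proof (rule ccontr)
  assume ne: "nrm K' e \<noteq> - nrm K e"
  let ?n = "nrm K e" and ?n' = "nrm K' e"
  have n: "?n \<bullet> ?n = 1" "?n' \<bullet> ?n' = 1"
    using norm_nrm[OF K(1) e(1)] norm_nrm[OF K(2) e(2)] by (simp_all add: norm_eq_1)
  have tan: "v \<bullet> ?n = 0 \<longleftrightarrow> v \<bullet> ?n' = 0" for v
    using tangent_space_nrm[OF K(1) e(1)] tangent_space_nrm[OF K(2) e(2)] by blast
  define s where "s = ?n' \<bullet> ?n"
  have "(?n' - s *\<^sub>R ?n) \<bullet> ?n = 0" by (simp add: s_def inner_diff_left n)
  then have 1: "(?n' - s *\<^sub>R ?n) \<bullet> ?n' = 0" using tan by blast
  have "(norm (?n' - s *\<^sub>R ?n))\<^sup>2 = (?n' - s *\<^sub>R ?n) \<bullet> ?n' - s * ((?n' - s *\<^sub>R ?n) \<bullet> ?n)"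
    by (simp add: power2_norm_eq_inner inner_diff_right)
  also have "\<dots> = 0" using 1 by (simp add: s_def inner_diff_left n)
  finally have n': "?n' = s *\<^sub>R ?n" by simp
  have "1 = s * s" using n(2) unfolding n' by (simp add: n(1))
  then have "s = 1 \<or> s = -1" by (simp add: square_eq_1_iff)
  with n' ne have same: "?n' = ?n" by auto
  obtain x where x: "x \<in> rel_interior e" using rel_interior_facet[OF K(1) e(1)] by auto
  obtain r where r: "r > 0" "\<And>y. y \<in> ball x r \<Longrightarrow> y \<in> K \<longleftrightarrow> (y - x) \<bullet> ?n \<le> 0"
    using facet_half_ball[OF K(1) e(1) x] by blast
  obtain r' where r': "r' > 0" "\<And>y. y \<in> ball x r' \<Longrightarrow> y \<in> K' \<longleftrightarrow> (y - x) \<bullet> ?n \<le> 0"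
    using facet_half_ball[OF K(2) e(2) x] unfolding same by blast
  define S where "S = ball x r \<inter> ball x r' \<inter> {y. (y - x) \<bullet> ?n < 0}"
  have "open S" unfolding S_def by (intro open_Int open_ball open_Collect_less continuous_intros)
  moreover have "S \<subseteq> K" "S \<subseteq> K'" unfolding S_def using r(2) r'(2) by auto
  moreover have "x - (min r r' / 2) *\<^sub>R ?n \<in> S"
    using r(1) r'(1) norm_nrm[OF K(1) e(1)] n(1) unfolding S_def by (auto simp: dist_norm)
  ultimately have "interior K \<inter> K' \<noteq> {}" using interior_maximal by blast
  then show False using interior_elem_disjoint[OF K] by simp
qed

section \<open>Elements adjacent to a facet\<close>

definition adj :: "'a set \<Rightarrow> 'a set set" where
  "adj e = {K \<in> \<T>. e facet_of K}"

abbreviation "up \<equiv> upper_elem \<T> lab"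
abbreviation "lo \<equiv> lower_elem \<T> lab"

text \<open>Labels are injective and \<open>adj e\<close> is finite, so exactly one adjacent element
  carries the extreme label and the definite descriptions are well defined.\<close>

lemma
  assumes e: "adj e \<noteq> {}"
  shows up_adj: "up e \<in> adj e" and lo_adj: "lo e \<in> adj e"
    and up_max: "\<And>K. K \<in> adj e \<Longrightarrow> lab K \<le> lab (up e)"
    and lo_min: "\<And>K. K \<in> adj e \<Longrightarrow> lab (lo e) \<le> lab K"
proof -
  have fin: "finite (adj e)" unfolding adj_def using finite_T by simp
  have inj: "K = K'" if "K \<in> adj e" "K' \<in> adj e" "lab K = lab K'" for K K'
    using labels that unfolding adj_def inj_on_def by blast
  obtain K where K: "K \<in> adj e" "\<And>K'. K' \<in> adj e \<Longrightarrow> lab K' \<le> lab K"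
    using Max_in[of "lab ` adj e"] Max_ge[of "lab ` adj e"] fin e by fastforce
  have "up e = K"
    unfolding upper_elem_def
  proof (rule the_equality)
    fix K' assume "K' \<in> \<T> \<and> e facet_of K' \<and> (\<forall>K''\<in>\<T>. e facet_of K'' \<longrightarrow> lab K'' \<le> lab K')"
    then have "K' \<in> adj e" "lab K \<le> lab K'" using K(1) unfolding adj_def by auto
    then show "K' = K" using inj K by (meson le_antisym)
  qed (use K in \<open>auto simp: adj_def\<close>)
  then show "up e \<in> adj e" "\<And>K. K \<in> adj e \<Longrightarrow> lab K \<le> lab (up e)" using K by auto
  obtain L where L: "L \<in> adj e" "\<And>K'. K' \<in> adj e \<Longrightarrow> lab L \<le> lab K'"
    using Min_in[of "lab ` adj e"] Min_le[of "lab ` adj e"] fin e by fastforce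
  have "lo e = L"
    unfolding lower_elem_def
  proof (rule the_equality)
    fix K' assume "K' \<in> \<T> \<and> e facet_of K' \<and> (\<forall>K''\<in>\<T>. e facet_of K'' \<longrightarrow> lab K' \<le> lab K'')"
    then have "K' \<in> adj e" "lab K' \<le> lab L" using L(1) unfolding adj_def by auto
    then show "K' = L" using inj L by (meson le_antisym)
  qed (use L in \<open>auto simp: adj_def\<close>)
  then show "lo e \<in> adj e" "\<And>K. K \<in> adj e \<Longrightarrow> lab (lo e) \<le> lab K" using L by auto
qed

text \<open>Normals of distinct adjacent elements are opposite to each other; three such elements
  would force a unit vector to equal its own negative.\<close>

lemma adj_interior:
  assumes "e \<in> interior_faces \<T>"
  shows "adj e = {up e, lo e}" "up e \<noteq> lo e"
proof -
  obtain K K' where K: "K \<in> adj e" "K' \<in> adj e" "K \<noteq> K'"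
    using assms unfolding interior_faces_iff adj_def by blast
  then have ne: "adj e \<noteq> {}" by blast
  show neq: "up e \<noteq> lo e"
  proof
    assume eq: "up e = lo e"
    have "lab K = lab K'"
      using up_max[OF ne K(1)] up_max[OF ne K(2)] lo_min[OF ne K(1)] lo_min[OF ne K(2)] eq by simp
    then show False using labels K unfolding adj_def inj_on_def by blast
  qed
  show "adj e = {up e, lo e}"
  proof (rule ccontr)
    assume "adj e \<noteq> {up e, lo e}"
    then obtain L where L: "L \<in> adj e" "L \<noteq> up e" "L \<noteq> lo e"
      using up_adj[OF ne] lo_adj[OF ne] by blast
    have opp: "nrm B e = - nrm A e" if "A \<in> adj e" "B \<in> adj e" "A \<noteq> B" for A B
      using that unfolding adj_def by (intro nrm_opposite) auto
    have "nrm L e = nrm (lo e) e"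
      using opp[OF up_adj[OF ne] L(1)] opp[OF up_adj[OF ne] lo_adj[OF ne]] L neq by simp
    moreover have "nrm L e = - nrm (lo e) e"
      using opp[OF lo_adj[OF ne] L(1)] L by simp
    ultimately have "nrm (lo e) e = - nrm (lo e) e" by (rule trans[OF sym])
    then have "nrm (lo e) e + nrm (lo e) e = 0" by (simp only: eq_neg_iff_add_eq_0)
    then have "nrm (lo e) e = 0" by (simp flip: scaleR_2)
    then show False using lo_adj[OF ne] norm_nrm[of "lo e" e] unfolding adj_def by simp
  qed
qed

lemma adj_boundary:
  assumes "adj e \<noteq> {}" "e \<notin> interior_faces \<T>"
  shows "adj e = {up e}"
proof (rule ccontr)
  assume "adj e \<noteq> {up e}"
  then obtain L where "L \<in> adj e" "L \<noteq> up e" using up_adj[OF assms(1)] by blast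
  then have "e \<in> interior_faces \<T>"
    unfolding interior_faces_iff using up_adj[OF assms(1)] unfolding adj_def by blast
  with assms(2) show False by simp
qed

lemma nrm_lo: "e \<in> interior_faces \<T> \<Longrightarrow> nrm (lo e) e = - nrm (up e) e"
  using adj_interior[of e] unfolding adj_def by (intro nrm_opposite) auto

lemma finite_facets: "K \<in> \<T> \<Longrightarrow> finite {e. e facet_of K}"
  using finite_polytope_facets[OF simplex_imp_polytope[OF full]] .

text \<open>Another element containing \<open>x\<close> would contain all of \<open>e\<close>,
  because it meets \<open>K\<close> in a face, and \<open>e\<close> would be an interior face. The
  remaining elements form a closed set and so stay away from \<open>x\<close>.\<close>

lemma boundary_facet_half_ball:
  assumes K: "K \<in> \<T>" and e: "e facet_of K" and ni: "e \<notin> interior_faces \<T>" and x: "x \<in> rel_interior e"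
  shows "\<exists>r>0. \<forall>y\<in>ball x r. y \<in> \<Union>\<T> \<longleftrightarrow> (y - x) \<bullet> nrm K e \<le> 0"
proof -
  have notin: "x \<notin> K'" if K': "K' \<in> \<T>" "K' \<noteq> K" for K'
  proof
    assume "x \<in> K'"
    moreover have "x \<in> K" using x rel_interior_subset facet_subset[OF K e] by blast
    ultimately have "e \<subseteq> K \<inter> K'"
      using subset_of_face_of[OF face_Int[OF K K'(1)] facet_subset[OF K e]] x by blast
    then have "e facet_of K'"
      using Int_eq_facet(2)[OF K K'(1) _ e] K'(2) by blast
    then show False using ni K K' e unfolding interior_faces_iff by blast
  qed
  define A where "A = \<Union>(\<T> - {K})"
  have "closed A" unfolding A_def using finite_T compact_elem by (intro closed_Union) (auto simp: compact_imp_closed)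
  then have "open (- A)" by (simp add: open_Compl)
  moreover have "x \<in> - A" using notin unfolding A_def by blast
  ultimately obtain s where s: "s > 0" "ball x s \<subseteq> - A" using openE by blast
  obtain r where r: "r > 0" "\<And>y. y \<in> ball x r \<Longrightarrow> y \<in> K \<longleftrightarrow> (y - x) \<bullet> nrm K e \<le> 0"
    using facet_half_ball[OF K e x] by blast
  have U: "\<Union>\<T> = K \<union> A" unfolding A_def using K by blast
  have "\<forall>y\<in>ball x (min r s). y \<in> \<Union>\<T> \<longleftrightarrow> (y - x) \<bullet> nrm K e \<le> 0"
  proof
    fix y assume "y \<in> ball x (min r s)"
    then have "y \<in> ball x r" "y \<in> ball x s" by auto
    then show "y \<in> \<Union>\<T> \<longleftrightarrow> (y - x) \<bullet> nrm K e \<le> 0" unfolding U using r(2) s(2) by blast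
  qed
  then show ?thesis using r(1) s(1) by (intro exI[of _ "min r s"]) simp
qed

text \<open>The half-balls of the two elements have opposite normals and together cover a
  ball.\<close>

lemma interior_facet_rel_interior:
  assumes e: "e \<in> interior_faces \<T>" and x: "x \<in> rel_interior e"
  shows "x \<in> interior (\<Union>\<T>)"
proof -
  have ad: "up e \<in> \<T>" "e facet_of up e" "lo e \<in> \<T>" "e facet_of lo e"
    using adj_interior(1)[OF e] unfolding adj_def by blast+
  obtain r where r: "r > 0" "\<And>y. y \<in> ball x r \<Longrightarrow> y \<in> up e \<longleftrightarrow> (y - x) \<bullet> nrm (up e) e \<le> 0"
    using facet_half_ball[OF ad(1,2) x] by blast
  obtain s where s: "s > 0" "\<And>y. y \<in> ball x s \<Longrightarrow> y \<in> lo e \<longleftrightarrow> (y - x) \<bullet> nrm (lo e) e \<le> 0"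
    using facet_half_ball[OF ad(3,4) x] by blast
  have "ball x (min r s) \<subseteq> \<Union>\<T>"
  proof
    fix y assume "y \<in> ball x (min r s)"
    then have "y \<in> ball x r" "y \<in> ball x s" by auto
    then have "y \<in> up e \<or> y \<in> lo e"
      using r(2)[of y] s(2)[of y] by (auto simp: nrm_lo[OF e])
    then show "y \<in> \<Union>\<T>" using ad by blast
  qed
  then show ?thesis using r(1) s(1) by (intro interiorI[of "ball x (min r s)"]) auto
qed

text \<open>Counts incident pairs of element and facet by facets: two elements at an interior facet,
  one at a facet in \<open>B\<close>.\<close>

lemma sum_facets:
  fixes F :: "'a set \<Rightarrow> 'a set \<Rightarrow> real"
  assumes B: "finite B" "B \<inter> interior_faces \<T> = {}"
    and all: "\<And>e. e \<in> B \<union> interior_faces \<T> \<longleftrightarrow> adj e \<noteq> {}"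
  shows "(\<Sum>K\<in>\<T>. \<Sum>e | e facet_of K. F K e)
    = (\<Sum>e\<in>interior_faces \<T>. F (up e) e + F (lo e) e) + (\<Sum>e\<in>B. F (up e) e)"
proof -
  have E: "B \<union> interior_faces \<T> = (\<Union>K\<in>\<T>. {e. e facet_of K})"
    using all unfolding adj_def by blast
  have finE: "finite (B \<union> interior_faces \<T>)"
    unfolding E using finite_T finite_facets by simp
  have "(\<Sum>K\<in>\<T>. \<Sum>e | e facet_of K. F K e)
      = (\<Sum>K\<in>\<T>. \<Sum>e\<in>{e \<in> B \<union> interior_faces \<T>. e facet_of K}. F K e)"
    using E by (intro sum.cong) auto
  also have "\<dots> = (\<Sum>e\<in>B \<union> interior_faces \<T>. \<Sum>K\<in>adj e. F K e)"
    unfolding adj_def by (rule sum.swap_restrict[OF finite_T finE])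
  also have "\<dots> = (\<Sum>e\<in>B. \<Sum>K\<in>adj e. F K e) + (\<Sum>e\<in>interior_faces \<T>. \<Sum>K\<in>adj e. F K e)"
    using finE B(2) by (intro sum.union_disjoint) auto
  also have "(\<Sum>e\<in>B. \<Sum>K\<in>adj e. F K e) = (\<Sum>e\<in>B. F (up e) e)"
  proof (rule sum.cong[OF refl])
    fix e assume "e \<in> B"
    then have "adj e = {up e}" using all B(2) by (intro adj_boundary) auto
    then show "(\<Sum>K\<in>adj e. F K e) = F (up e) e" by simp
  qed
  also have "(\<Sum>e\<in>interior_faces \<T>. \<Sum>K\<in>adj e. F K e)
      = (\<Sum>e\<in>interior_faces \<T>. F (up e) e + F (lo e) e)"
    by (intro sum.cong refl) (simp add: adj_interior)
  finally show ?thesis by simp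
qed

end

section \<open>Boundary facets\<close>

locale domain_mesh = simplicial_mesh \<T> lab
  for \<T> :: "'a::euclidean_space set set" and lab +
  fixes \<Omega>\<^sub>1 D \<Omega> \<Gamma>\<^sub>R \<Gamma>\<^sub>D :: "'a set"
  assumes open_dom: "open \<Omega>\<^sub>1" and poly: "polyhedral_region \<Omega>\<^sub>1" "polyhedral_region D"
    and D_inside: "closure D \<subseteq> \<Omega>\<^sub>1" and \<Omega>: "\<Omega> = \<Omega>\<^sub>1 - D"
    and \<Gamma>\<^sub>R: "\<Gamma>\<^sub>R = frontier \<Omega>\<^sub>1" and \<Gamma>\<^sub>D: "\<Gamma>\<^sub>D = frontier D"
    and cover: "\<Union>\<T> = closure \<Omega>"
begin

lemma interior_closure_subset_dom: "interior (closure \<Omega>) \<subseteq> \<Omega>\<^sub>1"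
proof -
  have "interior (closure \<Omega>) \<subseteq> interior (closure \<Omega>\<^sub>1)"
    unfolding \<Omega> by (intro interior_mono closure_mono) blast
  then show ?thesis using poly(1) unfolding polyhedral_region_def by blast
qed

lemma closure_D_disjoint: "closure D \<inter> interior (closure \<Omega>) = {}"
proof -
  have "interior D \<inter> \<Omega> = {}" unfolding \<Omega> using interior_subset by blast
  then have "interior D \<inter> closure \<Omega> = {}" by (simp add: open_Int_closure_eq_empty)
  then have "interior (closure \<Omega>) \<inter> interior D = {}" using interior_subset by blast
  then have "interior (closure \<Omega>) \<inter> closure (interior D) = {}" by (simp add: open_Int_closure_eq_empty)
  moreover have "D \<subseteq> closure (interior D)" using poly(2) unfolding polyhedral_region_def by blast
  then have "closure D \<subseteq> closure (interior D)" by (simp add: closure_minimal)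
  ultimately show ?thesis by blast
qed

text \<open>This is where slits are excluded. It turns half-balls in the closed mesh region into
  half-balls in the domain itself.\<close>

lemma interior_closure_subset: "interior (closure \<Omega>) \<subseteq> \<Omega>"
  using interior_closure_subset_dom closure_D_disjoint closure_subset[of D] unfolding \<Omega> by blast

lemma boundaries_disjoint: "\<Gamma>\<^sub>R \<inter> \<Gamma>\<^sub>D = {}"
  using D_inside open_dom unfolding \<Gamma>\<^sub>R \<Gamma>\<^sub>D frontier_def by (auto simp: interior_open)

lemma boundary_outside: "\<Gamma>\<^sub>R \<inter> interior (closure \<Omega>) = {}" "\<Gamma>\<^sub>D \<inter> interior (closure \<Omega>) = {}"
  using interior_closure_subset_dom closure_D_disjoint open_dom
  unfolding \<Gamma>\<^sub>R \<Gamma>\<^sub>D frontier_def by (auto simp: interior_open)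

lemma closure_diff_interior:
  assumes x: "x \<in> closure \<Omega>" "x \<notin> interior (closure \<Omega>)"
  shows "x \<in> \<Gamma>\<^sub>R \<union> \<Gamma>\<^sub>D"
proof (cases "x \<in> \<Omega>\<^sub>1")
  case False
  moreover have "x \<in> closure \<Omega>\<^sub>1" using x(1) closure_mono[of \<Omega> \<Omega>\<^sub>1] unfolding \<Omega> by blast
  ultimately show ?thesis unfolding \<Gamma>\<^sub>R frontier_def using open_dom by (simp add: interior_open)
next
  case True
  have "x \<in> closure D"
  proof (rule ccontr)
    assume "x \<notin> closure D"
    then have "x \<in> \<Omega>\<^sub>1 - closure D" using True by blast
    moreover have "open (\<Omega>\<^sub>1 - closure D)" using open_dom by (simp add: open_Diff)
    moreover have "\<Omega>\<^sub>1 - closure D \<subseteq> closure \<Omega>"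
      using closure_subset[of \<Omega>] closure_subset[of D] unfolding \<Omega> by blast
    ultimately show False using x(2) interior_maximal[of "\<Omega>\<^sub>1 - closure D" "closure \<Omega>"] by blast
  qed
  moreover have "x \<notin> interior D"
  proof
    assume "x \<in> interior D"
    moreover have "interior D \<inter> \<Omega> = {}" unfolding \<Omega> using interior_subset by blast
    then have "interior D \<inter> closure \<Omega> = {}" by (simp add: open_Int_closure_eq_empty)
    ultimately show False using x(1) by blast
  qed
  ultimately show ?thesis unfolding \<Gamma>\<^sub>D frontier_def by blast
qed

lemma faces_on_adj: "e \<in> faces_on \<T> \<Gamma> \<Longrightarrow> adj e \<noteq> {}"
  unfolding faces_on_def adj_def by blast

lemma up_faces_on: "e \<in> faces_on \<T> \<Gamma> \<Longrightarrow> up e \<in> \<T> \<and> e facet_of up e"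
  using up_adj[OF faces_on_adj] unfolding adj_def by blast

lemma faces_on_not_interior:
  assumes "\<Gamma> = \<Gamma>\<^sub>R \<or> \<Gamma> = \<Gamma>\<^sub>D" "e \<in> faces_on \<T> \<Gamma>"
  shows "e \<notin> interior_faces \<T>"
proof
  assume i: "e \<in> interior_faces \<T>"
  obtain x where x: "x \<in> rel_interior e"
    using rel_interior_facet up_faces_on[OF assms(2)] by blast
  then have "x \<in> \<Gamma>" using assms(2) rel_interior_subset unfolding faces_on_def by blast
  moreover have "x \<in> interior (closure \<Omega>)" using interior_facet_rel_interior[OF i x] cover by simp
  ultimately show False using assms(1) boundary_outside by blast
qed

lemma faces_on_disjoint: "faces_on \<T> \<Gamma>\<^sub>R \<inter> faces_on \<T> \<Gamma>\<^sub>D = {}"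
proof -
  have False if "e \<in> faces_on \<T> \<Gamma>\<^sub>R" "e \<in> faces_on \<T> \<Gamma>\<^sub>D" for e
  proof -
    have "e \<noteq> {}" using facet_ne up_faces_on[OF that(1)] by blast
    then show False using that boundaries_disjoint unfolding faces_on_def by blast
  qed
  then show ?thesis by blast
qed

text \<open>The inner half-ball consists of interior points of the closure, hence of points of the
  domain. Near a point of \<open>\<Gamma>\<^sub>D\<close> everything lies in
  \<open>\<Omega>\<^sub>1\<close>, where \<open>D\<close> is the complement of
  \<open>\<Omega>\<close>, so the normal changes sign.\<close>

lemma boundary_facet_point:
  assumes K: "K \<in> \<T>" and e: "e facet_of K" and ni: "e \<notin> interior_faces \<T>" and x: "x \<in> rel_interior e"
  shows "outward_normal \<Omega> x (nrm K e)" "x \<in> \<Gamma>\<^sub>R \<union> \<Gamma>\<^sub>D"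
    "x \<in> \<Gamma>\<^sub>D \<Longrightarrow> outward_normal D x (- nrm K e)"
proof -
  let ?n = "nrm K e"
  have n: "norm ?n = 1" by (rule norm_nrm[OF K e])
  then have nn: "?n \<bullet> ?n = 1" by (simp add: norm_eq_1)
  obtain r where r: "r > 0" "\<And>y. y \<in> ball x r \<Longrightarrow> y \<in> closure \<Omega> \<longleftrightarrow> (y - x) \<bullet> ?n \<le> 0"
    using boundary_facet_half_ball[OF assms] unfolding cover by blast
  have neg: "y \<in> interior (closure \<Omega>)" if "y \<in> ball x r" "(y - x) \<bullet> ?n < 0" for y
  proof -
    have "open (ball x r \<inter> {y. (y - x) \<bullet> ?n < 0})"
      by (intro open_Int open_ball open_Collect_less continuous_intros)
    moreover have "ball x r \<inter> {y. (y - x) \<bullet> ?n < 0} \<subseteq> closure \<Omega>" using r(2) by auto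
    ultimately show ?thesis using that interior_maximal by blast
  qed
  have pos: "y \<notin> closure \<Omega>" if "y \<in> ball x r" "(y - x) \<bullet> ?n > 0" for y
    using r(2)[OF that(1)] that(2) by simp
  show "outward_normal \<Omega> x ?n"
    unfolding outward_normal_def
    using n r(1) neg pos interior_closure_subset closure_subset[of \<Omega>] by blast
  have xc: "x \<in> closure \<Omega>" using r by simp
  have xi: "x \<notin> interior (closure \<Omega>)"
  proof
    assume "x \<in> interior (closure \<Omega>)"
    then obtain s where s: "s > 0" "ball x s \<subseteq> closure \<Omega>"
      unfolding mem_interior by blast
    let ?y = "x + (min r s / 2) *\<^sub>R ?n"
    have "?y \<in> ball x r" "?y \<in> ball x s" using r(1) s(1) n by (auto simp: dist_norm)
    moreover have "(?y - x) \<bullet> ?n > 0" using r(1) s(1) nn by simp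
    ultimately show False using pos s(2) by blast
  qed
  show "x \<in> \<Gamma>\<^sub>R \<union> \<Gamma>\<^sub>D" by (rule closure_diff_interior[OF xc xi])
  assume xD: "x \<in> \<Gamma>\<^sub>D"
  then have "x \<in> \<Omega>\<^sub>1" using D_inside unfolding \<Gamma>\<^sub>D frontier_def by blast
  then obtain s where s: "s > 0" "ball x s \<subseteq> \<Omega>\<^sub>1" using open_dom openE by blast
  show "outward_normal D x (- ?n)"
    unfolding outward_normal_def
  proof (intro conjI exI[of _ "min r s"] ballI impI)
    fix y assume y: "y \<in> ball x (min r s)"
    then have y': "y \<in> ball x r" "y \<in> ball x s" by auto
    show "y \<in> D" if "(y - x) \<bullet> - ?n < 0"
    proof -
      have "y \<notin> closure \<Omega>" using pos[OF y'(1)] that by simp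
      then show ?thesis using y'(2) s(2) closure_subset[of \<Omega>] unfolding \<Omega> by blast
    qed
    show "y \<notin> D" if "(y - x) \<bullet> - ?n > 0"
      using neg[OF y'(1)] that interior_closure_subset unfolding \<Omega> by auto
  qed (use n r(1) s(1) in auto)
qed

text \<open>The relative interior of a facet is connected and \<open>\<Gamma>\<^sub>R\<close>,
  \<open>\<Gamma>\<^sub>D\<close> are disjoint closed sets, so no boundary facet is shared between
  them; taking closures captures the whole facet.\<close>

lemma adj_iff:
  "adj e \<noteq> {} \<longleftrightarrow> e \<in> interior_faces \<T> \<or> e \<in> faces_on \<T> \<Gamma>\<^sub>R \<or> e \<in> faces_on \<T> \<Gamma>\<^sub>D"
proof
  assume "adj e \<noteq> {}"
  then obtain K where K: "K \<in> \<T>" "e facet_of K" unfolding adj_def by blast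
  have "e \<in> faces_on \<T> \<Gamma>\<^sub>R \<or> e \<in> faces_on \<T> \<Gamma>\<^sub>D" if ni: "e \<notin> interior_faces \<T>"
  proof -
    have sub: "rel_interior e \<subseteq> \<Gamma>\<^sub>R \<union> \<Gamma>\<^sub>D" using boundary_facet_point(2)[OF K ni] by blast
    have cl: "closed \<Gamma>\<^sub>R" "closed \<Gamma>\<^sub>D" unfolding \<Gamma>\<^sub>R \<Gamma>\<^sub>D by simp_all
    have "connected (rel_interior e)"
      by (intro convex_connected convex_rel_interior convex_facet[OF K])
    then have "rel_interior e \<inter> \<Gamma>\<^sub>R = {} \<or> rel_interior e \<inter> \<Gamma>\<^sub>D = {}"
      using sub cl boundaries_disjoint unfolding connected_closed by blast
    then have "rel_interior e \<subseteq> \<Gamma>\<^sub>D \<or> rel_interior e \<subseteq> \<Gamma>\<^sub>R" using sub by blast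
    moreover have "closure (rel_interior e) = e"
      using convex_closure_rel_interior[OF convex_facet[OF K]] compact_facet[OF K]
      by (simp add: compact_imp_closed closure_closed)
    ultimately have "e \<subseteq> \<Gamma>\<^sub>D \<or> e \<subseteq> \<Gamma>\<^sub>R" using cl closure_minimal by metis
    then show ?thesis using K unfolding faces_on_def by blast
  qed
  then show "e \<in> interior_faces \<T> \<or> e \<in> faces_on \<T> \<Gamma>\<^sub>R \<or> e \<in> faces_on \<T> \<Gamma>\<^sub>D" by blast
next
  assume "e \<in> interior_faces \<T> \<or> e \<in> faces_on \<T> \<Gamma>\<^sub>R \<or> e \<in> faces_on \<T> \<Gamma>\<^sub>D"
  then show "adj e \<noteq> {}" using adj_interior(1) faces_on_adj by blast
qed

lemma face_normal_eq:
  assumes e: "e \<in> interior_faces \<T> \<union> faces_on \<T> \<Gamma>\<^sub>D"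
  shows "face_normal \<Omega> \<T> lab e = nrm (up e) e"
proof -
  have "adj e \<noteq> {}" using e adj_iff by blast
  then have u: "up e \<in> \<T>" "e facet_of up e" using up_adj unfolding adj_def by blast+
  show ?thesis
    unfolding face_normal_def
    using unit_normal_nrm[OF u] unit_normal_eq[OF rel_interior_facet[OF u] boundary_facet_point(1)[OF u]]
    by simp
qed

lemma finite_faces: "finite (interior_faces \<T>)" "finite (faces_on \<T> \<Gamma>)"
proof -
  have fin: "finite (\<Union>K\<in>\<T>. {e. e facet_of K})" using finite_T finite_facets by simp
  show "finite (interior_faces \<T>)"
    by (rule finite_subset[OF _ fin]) (auto simp: interior_faces_def)
  show "finite (faces_on \<T> \<Gamma>)"
    by (rule finite_subset[OF _ fin]) (auto simp: faces_on_def)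
qed

lemma sum_elem_facets:
  fixes F :: "'a set \<Rightarrow> 'a set \<Rightarrow> real"
  shows "(\<Sum>K\<in>\<T>. \<Sum>e | e facet_of K. F K e)
    = (\<Sum>e\<in>interior_faces \<T>. F (up e) e + F (lo e) e)
      + (\<Sum>e\<in>faces_on \<T> \<Gamma>\<^sub>D. F (up e) e) + (\<Sum>e\<in>faces_on \<T> \<Gamma>\<^sub>R. F (up e) e)"
proof -
  have "(\<Sum>K\<in>\<T>. \<Sum>e | e facet_of K. F K e)
      = (\<Sum>e\<in>interior_faces \<T>. F (up e) e + F (lo e) e)
        + (\<Sum>e\<in>faces_on \<T> \<Gamma>\<^sub>D \<union> faces_on \<T> \<Gamma>\<^sub>R. F (up e) e)"
    using finite_faces(2) faces_on_not_interior adj_iff by (intro sum_facets) blast+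
  also have "(\<Sum>e\<in>faces_on \<T> \<Gamma>\<^sub>D \<union> faces_on \<T> \<Gamma>\<^sub>R. F (up e) e)
      = (\<Sum>e\<in>faces_on \<T> \<Gamma>\<^sub>D. F (up e) e) + (\<Sum>e\<in>faces_on \<T> \<Gamma>\<^sub>R. F (up e) e)"
    using finite_faces(2) faces_on_disjoint by (intro sum.union_disjoint) auto
  finally show ?thesis by simp
qed

section \<open>Measurability of the domain\<close>

lemma negligible_frontier_polyhedral:
  assumes "polyhedral_region S"
  shows "negligible (closure S - interior (closure S))"
proof -
  obtain P where P: "finite P" "\<And>p. p \<in> P \<Longrightarrow> polytope p" "closure S = \<Union>P"
    using assms unfolding polyhedral_region_def by blast
  have "frontier (\<Union>P) \<subseteq> \<Union>(frontier ` P)" by (rule frontier_Union_subset[OF P(1)])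
  moreover have "negligible (\<Union>(frontier ` P))"
    using P(1) by (intro negligible_Union) (auto intro: negligible_convex_frontier[OF polytope_imp_convex[OF P(2)]])
  ultimately have "negligible (frontier (closure S))"
    unfolding P(3) by (rule negligible_subset[rotated])
  then show ?thesis by (simp add: frontier_def)
qed

text \<open>The source \<open>f\<close> is given on the domain, while the load term integrates over
  elements, which cover the closure; the two differ by a null set.\<close>

lemma negligible_closure_diff: "negligible (closure \<Omega> - \<Omega>)"
proof -
  have "closure \<Omega> - \<Omega> \<subseteq> (closure \<Omega>\<^sub>1 - interior (closure \<Omega>\<^sub>1)) \<union> (closure D - interior (closure D))"
  proof
    fix x assume x: "x \<in> closure \<Omega> - \<Omega>"
    have cl: "x \<in> closure \<Omega>\<^sub>1" using x closure_mono[of \<Omega> \<Omega>\<^sub>1] unfolding \<Omega> by blast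
    show "x \<in> (closure \<Omega>\<^sub>1 - interior (closure \<Omega>\<^sub>1)) \<union> (closure D - interior (closure D))"
    proof (cases "x \<in> \<Omega>\<^sub>1")
      case False
      then show ?thesis using cl poly(1) unfolding polyhedral_region_def by blast
    next
      case True
      then have "x \<in> D" using x unfolding \<Omega> by blast
      moreover have "x \<notin> interior (closure D)"
      proof
        assume xi: "x \<in> interior (closure D)"
        have "interior (closure D) \<subseteq> D" using poly(2) unfolding polyhedral_region_def by blast
        then have "interior (closure D) \<inter> \<Omega> = {}" unfolding \<Omega> by blast
        then have "interior (closure D) \<inter> closure \<Omega> = {}" by (simp add: open_Int_closure_eq_empty)
        then show False using xi x by blast
      qed
      ultimately show ?thesis using closure_subset[of D] by blast
    qed
  qed
  then show ?thesis
    by (rule negligible_subset[OF negligible_Un[OF negligible_frontier_polyhedral[OF poly(1)]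
          negligible_frontier_polyhedral[OF poly(2)]]])
qed

lemma sets_lebesgue_domain: "\<Omega> \<in> sets lebesgue"
proof -
  have "closure \<Omega> - \<Omega> \<in> sets lebesgue" using negligible_closure_diff negligible_imp_sets by blast
  moreover have "\<Omega> = closure \<Omega> - (closure \<Omega> - \<Omega>)" using closure_subset[of \<Omega>] by blast
  moreover have "closure \<Omega> \<in> sets lebesgue" by simp
  ultimately show ?thesis using sets.Diff[of "closure \<Omega>" lebesgue "closure \<Omega> - \<Omega>"] by simp
qed

end

section \<open>The kernel of the form\<close>

lemma L2_inner_self:
  "L2_inner M w w = of_real (LINT x|M. (cmod (w x))\<^sup>2)"
  unfolding L2_inner_def complex_norm_square[symmetric] by (rule integral_complex_of_real)

lemma L2_inner_commute: "L2_inner M w v = cnj (L2_inner M v w)"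
  using Bochner_Integration.integral_cnj[of M "\<lambda>x. v x * cnj (w x)"] unfolding L2_inner_def by (simp add: mult.commute)

lemma L2_inner_zero_left: "(\<And>x. x \<in> space M \<Longrightarrow> w x = 0) \<Longrightarrow> L2_inner M w v = 0"
  unfolding L2_inner_def by (rule integral_eq_zero_AE) (auto intro: AE_I2)

lemma L2_inner_zero_right: "(\<And>x. x \<in> space M \<Longrightarrow> v x = 0) \<Longrightarrow> L2_inner M w v = 0"
  unfolding L2_inner_def by (rule integral_eq_zero_AE) (auto intro: AE_I2)

lemma P1_zero_on_tangent:
  assumes w: "w \<in> P1" and z: "\<And>x. x \<in> e \<Longrightarrow> w x = 0" and \<nu>: "\<nu> \<in> tangent_space e"
  shows "w \<nu> - w 0 = 0"
proof -
  have lin: "linear (\<lambda>v. w v - w 0)" using w by (simp add: P1_iff_linear)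
  have "w v - w 0 = 0" if v: "v \<in> {x - y |x y. x \<in> e \<and> y \<in> e}" for v
  proof -
    obtain x y where xy: "v = x - y" "x \<in> e" "y \<in> e" using v by blast
    have "w (y + v) = w y + (w v - w 0)" by (rule P1_add_arg[OF w])
    then show ?thesis using xy z by simp
  qed
  then show ?thesis
    using linear_eq_0_on_span[OF lin _ \<nu>[unfolded tangent_space_def]] by blast
qed

text \<open>The squared norm of the gradient, since p i - p 0 is the i-th partial derivative of an
  affine \<open>p\<close>.\<close>

definition grad_sq :: "('a::euclidean_space \<Rightarrow> complex) \<Rightarrow> real" where
  "grad_sq p = (\<Sum>i\<in>Basis. (cmod (p i - p 0))\<^sup>2)"

lemma linear_normal:
  fixes L :: "'a::euclidean_space \<Rightarrow> complex"
  assumes L: "linear L" and z: "\<And>v. v \<bullet> n = 0 \<Longrightarrow> L v = 0" and n: "norm n = 1"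
  shows "L v = of_real (v \<bullet> n) * L n"
proof -
  have "(v - (v \<bullet> n) *\<^sub>R n) \<bullet> n = 0" using n by (simp add: inner_diff_left norm_eq_1)
  then have "L (v - (v \<bullet> n) *\<^sub>R n) = 0" by (rule z)
  then show ?thesis by (simp add: linear_diff[OF L] linear_scale[OF L] scaleR_conv_of_real)
qed

text \<open>
  If \<open>p\<close> and \<open>q\<close> agree on a face, their gradients differ by a multiple of the normal \<open>n\<close>, so the
  product of the averaged and the jumping normal derivative is a difference of squared gradients.
\<close>

lemma grad_sq_diff:
  assumes p: "p \<in> P1" and q: "q \<in> P1" and n: "norm n = 1"
    and tan: "\<And>v. v \<bullet> n = 0 \<Longrightarrow> p v - p 0 = q v - q 0"
  shows "Re (((p n - p 0) + (q n - q 0)) * cnj ((p v - p 0) - (q v - q 0)))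
    = (v \<bullet> n) * (grad_sq p - grad_sq q)"
proof -
  define L where "L v = (p v - p 0) - (q v - q 0)" for v
  define A where "A v = (p v - p 0) + (q v - q 0)" for v
  have lin: "linear L" unfolding L_def[abs_def]
    using linear_compose_sub p q unfolding P1_iff_linear by blast
  have linA: "linear A" unfolding A_def[abs_def]
    using linear_compose_add p q unfolding P1_iff_linear by blast
  have L: "L v = of_real (v \<bullet> n) * L n" for v
    by (rule linear_normal[OF lin _ n]) (simp add: L_def tan)
  have "grad_sq p - grad_sq q = (\<Sum>i\<in>Basis. Re (A i * cnj (L i)))"
    unfolding grad_sq_def A_def L_def sum_subtractf[symmetric]
    by (intro sum.cong refl) (simp only: cmod_power2, simp add: power2_eq_square algebra_simps)
  also have "\<dots> = (\<Sum>i\<in>Basis. Re (((n \<bullet> i) *\<^sub>R A i) * cnj (L n)))"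
    by (subst L) (simp add: scaleR_conv_of_real inner_commute algebra_simps)
  also have "\<dots> = Re ((\<Sum>i\<in>Basis. (n \<bullet> i) *\<^sub>R A i) * cnj (L n))"
    by (simp only: sum_distrib_right Re_sum)
  also have "(\<Sum>i\<in>Basis. (n \<bullet> i) *\<^sub>R A i) = A n"
    using linear_sum[OF linA, of "\<lambda>i. (n \<bullet> i) *\<^sub>R i" Basis]
    by (simp add: linear_scale[OF linA] euclidean_representation)
  finally have "grad_sq p - grad_sq q = Re (A n * cnj (L n))" .
  moreover have "Re (A n * cnj (L v)) = (v \<bullet> n) * Re (A n * cnj (L n))"
    by (subst L) (simp add: algebra_simps)
  ultimately show ?thesis unfolding A_def L_def by simp
qed

section \<open>Piecewise affine functions: facet identities, jumps and averages\<close>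

context simplicial_mesh
begin

lemma Vh_P1: "u \<in> Vh \<T> \<Longrightarrow> K \<in> \<T> \<Longrightarrow> u K \<in> P1"
  unfolding Vh_def by (rule PiE_mem)

lemma Vh_restrictI: "(\<And>K. K \<in> \<T> \<Longrightarrow> p K \<in> P1) \<Longrightarrow> (\<lambda>K\<in>\<T>. p K) \<in> Vh \<T>"
  unfolding Vh_def by simp

lemma facet_oppE:
  assumes "K \<in> \<T>" "e facet_of K"
  obtains C N u where "full_simplex K C N" "u \<in> C" "e = convex hull (C - {u})"
  using full_simplexE[OF assms(1)] full_simplex.facet_iff assms(2) by metis

lemma facet_integral_eq_0_imp:
  fixes \<phi> :: "'a \<Rightarrow> real"
  assumes K: "K \<in> \<T>" and e: "e facet_of K"
    and \<phi>: "continuous_on UNIV \<phi>" "\<And>x. \<phi> x \<ge> 0" "(LINT x|face_measure e. \<phi> x) = 0" and z: "z \<in> e"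
  shows "\<phi> z = 0"
proof -
  obtain C N u where C: "full_simplex K C N" "u \<in> C" "e = convex hull (C - {u})"
    by (rule facet_oppE[OF K e])
  show ?thesis
    by (rule full_simplex.integral_opp_eq_0_imp[OF C(1,2) \<phi>(1,2)]) (use \<phi>(3) z C(3) in auto)
qed

lemma element_identity:
  assumes K: "K \<in> \<T>" and w: "w \<in> P1"
  shows "(LINT x|lebesgue_on K. DIM('a) * (cmod (w x))\<^sup>2 + 2 * Re (w x * cnj (w (x - x0) - w 0)))
    = (\<Sum>e | e facet_of K. LINT x|face_measure e. ((x - x0) \<bullet> nrm K e) * (cmod (w x))\<^sup>2)"
proof -
  obtain C N where C: "full_simplex K C N" "\<And>u. u \<in> C \<Longrightarrow> N u = nrm K (convex hull (C - {u}))"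
    by (rule full_simplexE[OF K]) blast
  show ?thesis
    unfolding full_simplex.integral_dilation_field[OF C(1) w] full_simplex.facets_K[OF C(1)]
    using C(2) by (simp add: sum.reindex[OF full_simplex.inj_opp[OF C(1)]])
qed

lemma element_integral_eq_0_imp:
  assumes K: "K \<in> \<T>" and w: "w \<in> P1" and zero: "(LINT x|lebesgue_on K. (cmod (w x))\<^sup>2) = 0"
  shows "w = (\<lambda>x. 0)"
proof (rule P1_eq_zero[OF w open_interior interior_elem[OF K]])
  fix x assume x: "x \<in> interior K"
  have cw: "continuous_on UNIV w" using w by (rule P1_continuous_on)
  have "integrable (lebesgue_on K) (\<lambda>x. (cmod (w x))\<^sup>2)"
    by (intro integrable_lebesgue_on_compact compact_elem[OF K] continuous_intros cw)
  from integral_nonneg_eq_0_iff_AE[OF this] zero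
  have "AE x in lebesgue_on K. w x = 0" by simp
  then have "AE x in lebesgue. x \<in> K \<longrightarrow> w x = 0"
    using lmeasurable_compact[OF compact_elem[OF K]]
    by (subst (asm) AE_restrict_space_iff) (auto simp: fmeasurable_def)
  then have "AE x\<in>interior K in lebesgue. x \<in> {x. w x = 0}"
    by eventually_elim (auto dest: interior_subset[THEN subsetD])
  moreover have "closed {x. w x = 0}"
    using cw by (intro closed_Collect_eq) (auto intro: continuous_intros)
  ultimately show "w x = 0" using mem_closed_if_AE_lebesgue_open[OF open_interior _ _ x] by blast
qed

lemma up_elem: "adj e \<noteq> {} \<Longrightarrow> up e \<in> \<T>" "adj e \<noteq> {} \<Longrightarrow> e facet_of up e"
  and lo_elem: "adj e \<noteq> {} \<Longrightarrow> lo e \<in> \<T>" "adj e \<noteq> {} \<Longrightarrow> e facet_of lo e"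
  using up_adj lo_adj unfolding adj_def by blast+

lemma pw_deriv_Vh: "u \<in> Vh \<T> \<Longrightarrow> K \<in> \<T> \<Longrightarrow> pw_deriv \<nu> u K x = u K \<nu> - u K 0"
  unfolding pw_deriv_def by (simp add: P1_frechet_derivative Vh_P1)

lemma jump_P1:
  assumes u: "u \<in> Vh \<T>" and e: "adj e \<noteq> {}"
  shows "jump \<T> lab e u \<in> P1"
proof -
  have "jump \<T> lab e u = (if e \<in> interior_faces \<T> then \<lambda>x. u (up e) x - u (lo e) x else u (up e))"
    by (rule ext) (simp add: jump_def)
  then show ?thesis
    using Vh_P1[OF u up_elem(1)[OF e]] Vh_P1[OF u lo_elem(1)[OF e]] by (simp add: P1_diff)
qed

text \<open>The jump of a directional derivative is the directional derivative of the affine jump;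
  in particular it is constant.\<close>

lemma jump_pw_deriv:
  "u \<in> Vh \<T> \<Longrightarrow> adj e \<noteq> {} \<Longrightarrow>
    jump \<T> lab e (pw_deriv \<nu> u) x = jump \<T> lab e u \<nu> - jump \<T> lab e u 0"
  unfolding jump_def using up_elem lo_elem by (simp add: pw_deriv_Vh)

lemma avg_pw_deriv:
  "u \<in> Vh \<T> \<Longrightarrow> adj e \<noteq> {} \<Longrightarrow>
    avg \<T> lab e (pw_deriv \<nu> u) x = avg \<T> lab e u \<nu> - avg \<T> lab e u 0"
  unfolding avg_def using up_elem lo_elem by (simp add: pw_deriv_Vh diff_divide_distrib add_divide_distrib)

end

locale helmholtz = domain_mesh \<T> lab \<Omega>\<^sub>1 D \<Omega> \<Gamma>\<^sub>R \<Gamma>\<^sub>D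
  for \<T> :: "'a::euclidean_space set set" and lab \<Omega>\<^sub>1 D \<Omega> \<Gamma>\<^sub>R \<Gamma>\<^sub>D +
  fixes x\<^sub>0 :: 'a and \<tau> :: "'a set \<Rightarrow> nat \<Rightarrow> 'a" and \<gamma>0 \<gamma>1 \<beta>1 :: "'a set \<Rightarrow> real" and k :: real
  assumes star_R: "\<And>x n. x \<in> \<Gamma>\<^sub>R \<Longrightarrow> outward_normal \<Omega> x n \<Longrightarrow> (x - x\<^sub>0) \<bullet> n \<ge> 0"
    and star_D: "\<And>x n. x \<in> \<Gamma>\<^sub>D \<Longrightarrow> outward_normal D x n \<Longrightarrow> (x - x\<^sub>0) \<bullet> n \<ge> 0"
    and frames: "\<And>e. e \<in> interior_faces \<T> \<union> faces_on \<T> \<Gamma>\<^sub>D \<Longrightarrow> orthonormal_tangent_frame e (\<tau> e)"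
    and gamma0: "\<And>e. e \<in> interior_faces \<T> \<union> faces_on \<T> \<Gamma>\<^sub>D \<Longrightarrow> \<gamma>0 e > 0"
    and gamma1: "\<And>e. e \<in> interior_faces \<T> \<Longrightarrow> \<gamma>1 e \<ge> 0"
    and beta1: "\<And>e. e \<in> interior_faces \<T> \<union> faces_on \<T> \<Gamma>\<^sub>D \<Longrightarrow> \<beta>1 e \<ge> 0"
    and k: "k > 0"
begin

definition form :: "'a pw \<Rightarrow> 'a pw \<Rightarrow> complex" where
  "form u v = a_h \<Omega> \<Gamma>\<^sub>D \<T> lab \<tau> 1 \<gamma>0 \<gamma>1 \<beta>1 u v - of_real (k\<^sup>2) * mesh_inner \<T> u v
    + \<i> * of_real k * boundary_inner \<T> lab \<Gamma>\<^sub>R u v"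

abbreviation "faces_ID \<equiv> interior_faces \<T> \<union> faces_on \<T> \<Gamma>\<^sub>D"
abbreviation "dn u e \<equiv> pw_deriv (face_normal \<Omega> \<T> lab e) u"

lemma adj_ID: "e \<in> faces_ID \<Longrightarrow> adj e \<noteq> {}"
  using adj_iff by blast

lemma adj_R: "e \<in> faces_on \<T> \<Gamma>\<^sub>R \<Longrightarrow> adj e \<noteq> {}"
  using adj_iff by blast

lemma diameter_pos: "adj e \<noteq> {} \<Longrightarrow> diameter e > 0"
  using diameter_facet_pos up_elem by blast

lemma sqnorm_nonneg: "(LINT x|M. (cmod (w x))\<^sup>2) \<ge> 0"
  by (rule Bochner_Integration.integral_nonneg) simp

lemma facet_sqnorm_eq_0_imp:
  assumes "adj e \<noteq> {}" "continuous_on UNIV w" "(LINT x|face_measure e. (cmod (w x))\<^sup>2) = 0" "x \<in> e"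
  shows "w x = 0"
  using facet_integral_eq_0_imp[OF up_elem[OF assms(1)], of "\<lambda>x. (cmod (w x))\<^sup>2" x] assms
  by (simp add: continuous_intros)

text \<open>For \<sigma> = 1 and equal arguments the two consistency terms are complex conjugates,
  so their sum is real, as are the gradient and mass terms. The imaginary part is
  \<open>j0 + j1 + l1 + k * b\<close> with nonnegative summands, each of which must vanish;
  continuity then gives pointwise zeros on the faces.\<close>

lemma form_self_zero:
  assumes u: "u \<in> Vh \<T>" and z: "form u u = 0"
  shows "\<And>e x. e \<in> faces_ID \<Longrightarrow> x \<in> e \<Longrightarrow> jump \<T> lab e u x = 0"
    "\<And>e x. e \<in> interior_faces \<T> \<Longrightarrow> \<gamma>1 e \<noteq> 0 \<Longrightarrow> x \<in> e \<Longrightarrow> jump \<T> lab e (dn u e) x = 0"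
    "\<And>e x. e \<in> faces_on \<T> \<Gamma>\<^sub>R \<Longrightarrow> x \<in> e \<Longrightarrow> u (up e) x = 0"
proof -
  define N where "N e w = (LINT x|face_measure e. (cmod (w x))\<^sup>2)" for e and w :: "'a \<Rightarrow> complex"
  have N: "N e w \<ge> 0" for e w unfolding N_def by (rule sqnorm_nonneg)
  have self: "L2_inner (face_measure e) w w = of_real (N e w)" for e w
    unfolding N_def by (rule L2_inner_self)
  define j0 where "j0 = (\<Sum>e\<in>faces_ID. \<gamma>0 e / diameter e * N e (jump \<T> lab e u))"
  define j1 where "j1 = (\<Sum>e\<in>interior_faces \<T>. \<gamma>1 e * diameter e * N e (jump \<T> lab e (dn u e)))"
  define l1 where "l1 = (\<Sum>e\<in>faces_ID. \<Sum>j=1..DIM('a) - 1.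
    \<beta>1 e / diameter e * N e (jump \<T> lab e (pw_deriv (\<tau> e j) u)))"
  define b where "b = (\<Sum>e\<in>faces_on \<T> \<Gamma>\<^sub>R. N e (u (up e)))"
  have diam: "e \<in> faces_ID \<Longrightarrow> diameter e > 0" "e \<in> interior_faces \<T> \<Longrightarrow> diameter e > 0" for e
    using diameter_pos adj_ID by blast+
  have t0: "\<gamma>0 e / diameter e * N e (jump \<T> lab e u) \<ge> 0" if "e \<in> faces_ID" for e
    using that gamma0[of e] diam[of e] N by (intro mult_nonneg_nonneg divide_nonneg_nonneg) auto
  have t1: "\<gamma>1 e * diameter e * N e (jump \<T> lab e (dn u e)) \<ge> 0" if "e \<in> interior_faces \<T>" for e
    using that gamma1[of e] diam(2)[of e] N by (intro mult_nonneg_nonneg) auto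
  have "l1 \<ge> 0" unfolding l1_def
    using beta1 diam N by (intro sum_nonneg mult_nonneg_nonneg divide_nonneg_nonneg) (auto simp: less_imp_le)
  moreover have "j0 \<ge> 0" unfolding j0_def using t0 by (intro sum_nonneg)
  moreover have "j1 \<ge> 0" unfolding j1_def using t1 by (intro sum_nonneg)
  moreover have "b \<ge> 0" unfolding b_def using N by (intro sum_nonneg)
  moreover have "j0 + j1 + l1 + k * b = 0"
  proof -
    have J0: "J0 \<Gamma>\<^sub>D \<T> lab \<gamma>0 u u = of_real j0"
      unfolding J0_def self j0_def by simp
    have J1: "J1 \<Omega> \<T> lab \<gamma>1 u u = of_real j1"
      unfolding J1_def self j1_def by simp
    have L1: "L1 \<Gamma>\<^sub>D \<T> lab \<tau> \<beta>1 u u = of_real l1"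
      unfolding L1_def self l1_def by simp
    have bb: "boundary_inner \<T> lab \<Gamma>\<^sub>R u u = of_real b"
      unfolding boundary_inner_def self b_def by simp
    have mm: "Im (mesh_inner \<T> w w) = 0" for w
      unfolding mesh_inner_def L2_inner_self by simp
    have "Im (\<Sum>e\<in>faces_ID.
          L2_inner (face_measure e) (avg \<T> lab e (dn u e)) (jump \<T> lab e u)
          + of_real 1 * L2_inner (face_measure e) (jump \<T> lab e u) (avg \<T> lab e (dn u e))) = 0"
      unfolding Im_sum
      by (rule sum.neutral) (subst (2) L2_inner_commute, simp)
    then have "Im (form u u) = j0 + j1 + l1 + k * b"
      unfolding form_def a_h_def J0 J1 L1 bb using mm by (simp add: Im_sum)
    then show ?thesis using z by simp
  qed
  moreover have "k * b \<ge> 0" using k \<open>b \<ge> 0\<close> by simp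
  ultimately have zero: "j0 = 0" "j1 = 0" "k * b = 0" by linarith+
  have fin: "finite faces_ID" using finite_faces by simp
  show "jump \<T> lab e u x = 0" if e: "e \<in> faces_ID" "x \<in> e" for e x
  proof -
    have "\<gamma>0 e / diameter e * N e (jump \<T> lab e u) = 0"
      by (rule sum_nonneg_0[OF fin _ zero(1)[unfolded j0_def] e(1)]) (rule t0)
    then have "N e (jump \<T> lab e u) = 0" using gamma0[OF e(1)] diam(1)[OF e(1)] by simp
    then show ?thesis
      using facet_sqnorm_eq_0_imp[OF adj_ID[OF e(1)] P1_continuous_on[OF jump_P1[OF u adj_ID[OF e(1)]]] _ e(2)]
      unfolding N_def by blast
  qed
  show "jump \<T> lab e (dn u e) x = 0" if e: "e \<in> interior_faces \<T>" "\<gamma>1 e \<noteq> 0" "x \<in> e" for e x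
  proof -
    have ad: "adj e \<noteq> {}" using e(1) adj_iff by blast
    have "\<gamma>1 e * diameter e * N e (jump \<T> lab e (dn u e)) = 0"
      by (rule sum_nonneg_0[OF finite_faces(1) _ zero(2)[unfolded j1_def] e(1)]) (rule t1)
    then have "N e (jump \<T> lab e (dn u e)) = 0" using e(2) diam(2)[OF e(1)] by simp
    moreover have "continuous_on UNIV (jump \<T> lab e (dn u e))"
      by (subst jump_pw_deriv[OF u ad, abs_def]) (rule continuous_on_const)
    ultimately show ?thesis
      using facet_sqnorm_eq_0_imp[OF ad _ _ e(3)] unfolding N_def by blast
  qed
  show "u (up e) x = 0" if e: "e \<in> faces_on \<T> \<Gamma>\<^sub>R" "x \<in> e" for e x
  proof -
    have "b = 0" using zero(3) k by simp
    then have "N e (u (up e)) = 0"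
      unfolding b_def by (rule sum_nonneg_0[OF finite_faces(2) _ _ e(1), rotated]) (rule N)
    then show ?thesis
      using facet_sqnorm_eq_0_imp[OF adj_R[OF e(1)] P1_continuous_on[OF Vh_P1[OF u up_elem(1)[OF adj_R[OF e(1)]]]] _ e(2)]
      unfolding N_def by blast
  qed
qed

text \<open>Terms with the jump or the outer trace of \<open>u\<close> drop out. \<open>J1\<close>
  drops out facewise, by a zero parameter or a zero jump, and \<open>L1\<close> because an affine
  jump that vanishes on a face has no tangential derivative. Of the consistency terms the one with
  the jump of \<open>v\<close> remains.\<close>

lemma form_reduced:
  assumes u: "u \<in> Vh \<T>" and z: "form u u = 0" and v: "v \<in> Vh \<T>"
  shows "form u v = (\<Sum>i\<in>Basis. mesh_inner \<T> (pw_deriv i u) (pw_deriv i v))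
    - (\<Sum>e\<in>faces_ID. L2_inner (face_measure e) (avg \<T> lab e (dn u e)) (jump \<T> lab e v))
    - of_real (k\<^sup>2) * mesh_inner \<T> u v"
proof -
  note zero = form_self_zero[OF u z]
  have ju: "L2_inner (face_measure e) (jump \<T> lab e u) w = 0" if "e \<in> faces_ID" for e w
    using zero(1)[OF that] by (intro L2_inner_zero_left) simp
  have "J0 \<Gamma>\<^sub>D \<T> lab \<gamma>0 u v = 0"
    unfolding J0_def by (rule sum.neutral) (simp add: ju)
  moreover have "J1 \<Omega> \<T> lab \<gamma>1 u v = 0"
    unfolding J1_def
  proof (rule sum.neutral, rule ballI)
    fix e assume e: "e \<in> interior_faces \<T>"
    show "of_real (\<gamma>1 e * diameter e) *
        L2_inner (face_measure e) (jump \<T> lab e (dn u e)) (jump \<T> lab e (dn v e)) = 0"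
    proof (cases "\<gamma>1 e = 0")
      case False
      then have "L2_inner (face_measure e) (jump \<T> lab e (dn u e)) (jump \<T> lab e (dn v e)) = 0"
        using zero(2)[OF e] by (intro L2_inner_zero_left) simp
      then show ?thesis by simp
    qed simp
  qed
  moreover have "L1 \<Gamma>\<^sub>D \<T> lab \<tau> \<beta>1 u v = 0"
    unfolding L1_def
  proof (rule sum.neutral, rule ballI, rule sum.neutral, rule ballI)
    fix e j assume e: "e \<in> faces_ID" and j: "j \<in> {1..DIM('a) - 1}"
    have "\<tau> e j \<in> tangent_space e"
      using frames[OF e] j unfolding orthonormal_tangent_frame_def by blast
    then have "jump \<T> lab e u (\<tau> e j) - jump \<T> lab e u 0 = 0"
      using P1_zero_on_tangent[OF jump_P1[OF u adj_ID[OF e]]] zero(1)[OF e] by blast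
    then have "L2_inner (face_measure e) (jump \<T> lab e (pw_deriv (\<tau> e j) u))
        (jump \<T> lab e (pw_deriv (\<tau> e j) v)) = 0"
      by (intro L2_inner_zero_left) (simp add: jump_pw_deriv[OF u adj_ID[OF e]])
    then show "of_real (\<beta>1 e / diameter e) * L2_inner (face_measure e)
        (jump \<T> lab e (pw_deriv (\<tau> e j) u)) (jump \<T> lab e (pw_deriv (\<tau> e j) v)) = 0" by simp
  qed
  moreover have "boundary_inner \<T> lab \<Gamma>\<^sub>R u v = 0"
    unfolding boundary_inner_def
    using zero(3) by (intro sum.neutral ballI L2_inner_zero_left) simp
  ultimately show ?thesis
    unfolding form_def a_h_def by (simp add: ju)
qed

text \<open>The quantity is constant on a flat face, so a relative interior point suffices, where an
  outward normal exists. On \<open>\<Gamma>\<^sub>D\<close> the element normal points into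
  \<open>D\<close>, which reverses the sign of the star-shape condition.\<close>

lemma normal_distance_sign:
  assumes e: "adj e \<noteq> {}" and x: "x \<in> e"
  shows "e \<in> faces_on \<T> \<Gamma>\<^sub>R \<Longrightarrow> (x - x\<^sub>0) \<bullet> nrm (up e) e \<ge> 0"
    "e \<in> faces_on \<T> \<Gamma>\<^sub>D \<Longrightarrow> (x - x\<^sub>0) \<bullet> nrm (up e) e \<le> 0"
proof -
  note K = up_elem[OF e]
  obtain z where z: "z \<in> rel_interior e" using rel_interior_facet[OF K] by blast
  then have ze: "z \<in> e" using rel_interior_subset by blast
  have eq: "(x - x\<^sub>0) \<bullet> nrm (up e) e = (z - x\<^sub>0) \<bullet> nrm (up e) e"
    using facet_normal_inner_eq[OF facet_normal_nrm[OF K] x ze] by (simp add: inner_diff_left)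
  show "(x - x\<^sub>0) \<bullet> nrm (up e) e \<ge> 0" if "e \<in> faces_on \<T> \<Gamma>\<^sub>R"
  proof -
    have "e \<notin> interior_faces \<T>" "z \<in> \<Gamma>\<^sub>R" using that faces_on_not_interior ze unfolding faces_on_def by blast+
    then show ?thesis using star_R boundary_facet_point(1)[OF K _ z] eq by simp
  qed
  show "(x - x\<^sub>0) \<bullet> nrm (up e) e \<le> 0" if "e \<in> faces_on \<T> \<Gamma>\<^sub>D"
  proof -
    have "e \<notin> interior_faces \<T>" "z \<in> \<Gamma>\<^sub>D" using that faces_on_not_interior ze unfolding faces_on_def by blast+
    then have "(z - x\<^sub>0) \<bullet> (- nrm (up e) e) \<ge> 0"
      using star_D[OF _ boundary_facet_point(3)[OF K _ z]] by blast
    then show ?thesis using eq by simp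
  qed
qed

lemma mesh_inner_grad_self:
  assumes u: "u \<in> Vh \<T>"
  shows "(\<Sum>i\<in>Basis. mesh_inner \<T> (pw_deriv i u) (pw_deriv i u))
    = of_real (\<Sum>K\<in>\<T>. LINT x|lebesgue_on K. grad_sq (u K))"
proof -
  have "(\<Sum>i\<in>Basis. mesh_inner \<T> (pw_deriv i u) (pw_deriv i u))
      = (\<Sum>i\<in>Basis. of_real (\<Sum>K\<in>\<T>. LINT x|lebesgue_on K. (cmod (u K i - u K 0))\<^sup>2))"
    unfolding mesh_inner_def L2_inner_self of_real_sum using pw_deriv_Vh[OF u] by simp
  also have "\<dots> = of_real (\<Sum>K\<in>\<T>. \<Sum>i\<in>Basis. LINT x|lebesgue_on K. (cmod (u K i - u K 0))\<^sup>2)"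
    by (subst sum.swap) simp
  also have "(\<Sum>K\<in>\<T>. \<Sum>i\<in>Basis. LINT x|lebesgue_on K. (cmod (u K i - u K 0))\<^sup>2)
      = (\<Sum>K\<in>\<T>. LINT x|lebesgue_on K. grad_sq (u K))"
    unfolding grad_sq_def
    by (intro sum.cong refl Bochner_Integration.integral_sum[symmetric]
        integrable_lebesgue_on_compact compact_elem continuous_on_const)
  finally show ?thesis .
qed

lemma integrable_face_weight:
  assumes "adj e \<noteq> {}"
  shows "integrable (face_measure e) (\<lambda>x. ((x - x\<^sub>0) \<bullet> n) * c)"
  using compact_facet[OF up_elem[OF assms]]
  by (intro integrable_face_measure continuous_intros)

text \<open>\<open>M\<close> and \<open>S\<close> are the squared norms of \<open>u\<close> and its
  gradient; \<open>H\<close> and \<open>Q\<close> are the outward fluxes through a facet of (x - x0)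
  weighted by |grad u|^2 and by |u|^2.\<close>

lemma form_kernel:
  assumes u: "u \<in> Vh \<T>" and z: "\<And>v. v \<in> Vh \<T> \<Longrightarrow> form u v = 0" and K: "K \<in> \<T>"
  shows "u K = (\<lambda>x. 0)"
proof -
  note zero = form_self_zero[OF u z[OF u]]
  define G where "G K = grad_sq (u K)" for K
  define M where "M = (\<Sum>K\<in>\<T>. LINT x|lebesgue_on K. (cmod (u K x))\<^sup>2)"
  define S where "S = (\<Sum>K\<in>\<T>. LINT x|lebesgue_on K. G K)"
  define H where "H K e = (LINT x|face_measure e. ((x - x\<^sub>0) \<bullet> nrm K e) * G K)" for K e
  define Q where "Q K e = (LINT x|face_measure e. ((x - x\<^sub>0) \<bullet> nrm K e) * (cmod (u K x))\<^sup>2)" for K e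
  define v where "v = (\<lambda>K\<in>\<T>. \<lambda>x. u K (x - x\<^sub>0) - u K 0)"
  have G0: "G K \<ge> 0" for K unfolding G_def grad_sq_def by (intro sum_nonneg) simp
  have v: "v \<in> Vh \<T>"
    unfolding v_def by (intro Vh_restrictI P1_translate_linear Vh_P1[OF u])
  have vK: "v K x = u K (x - x\<^sub>0) - u K 0" if "K \<in> \<T>" for K x
    unfolding v_def using that by simp
  \<comment> \<open>The multiplier has the same linear part as \<open>u\<close>, so the gradient
    term tested with \<open>v\<close> is \<open>S\<close> again.\<close>
  have dv: "pw_deriv i v K x = pw_deriv i u K x" if "K \<in> \<T>" for i K x
    using P1_add_arg[OF Vh_P1[OF u that], of i "- x\<^sub>0"] P1_add_arg[OF Vh_P1[OF u that], of 0 "- x\<^sub>0"]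
    by (simp add: pw_deriv_Vh[OF u that] pw_deriv_Vh[OF v that] vK[OF that])
  have M_eq: "mesh_inner \<T> u u = of_real M"
    unfolding mesh_inner_def L2_inner_self M_def by simp
  have S_eq: "(\<Sum>i\<in>Basis. mesh_inner \<T> (pw_deriv i u) (pw_deriv i u)) = of_real S"
    unfolding S_def G_def by (rule mesh_inner_grad_self[OF u])
  have SM: "S = k\<^sup>2 * M"
  proof -
    have "(\<Sum>e\<in>faces_ID. L2_inner (face_measure e) (avg \<T> lab e (dn u e)) (jump \<T> lab e u)) = 0"
      using zero(1) by (intro sum.neutral ballI L2_inner_zero_right) simp
    then have "complex_of_real (S - k\<^sup>2 * M) = 0"
      using z[OF u] unfolding form_reduced[OF u z[OF u] u] S_eq M_eq by simp
    then show ?thesis unfolding of_real_eq_0_iff by simp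
  qed
  have grad_v: "(\<Sum>i\<in>Basis. mesh_inner \<T> (pw_deriv i u) (pw_deriv i v)) = of_real S"
    unfolding S_eq[symmetric] mesh_inner_def L2_inner_def using dv by simp
  \<comment> \<open>The jump of \<open>u\<close> vanishes on the face, so the gradients of the two
    branches agree tangentially and \<open>grad_sq_diff\<close> applies. The factor 1/2 is that of
    the average, and the opposite normal of the lower element turns the difference into a sum. On
    \<open>\<Gamma>\<^sub>D\<close> averages are one-sided and the factor is absent.\<close>
  have reF: "Re (L2_inner (face_measure e) (avg \<T> lab e (dn u e)) (jump \<T> lab e v))
      = (if e \<in> interior_faces \<T> then (H (up e) e + H (lo e) e) / 2 else H (up e) e)"
    if e: "e \<in> faces_ID" for e
  proof -
    note ad = adj_ID[OF e]
    note U = up_elem[OF ad] and L = lo_elem[OF ad]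
    let ?n = "nrm (up e) e"
    have n: "norm ?n = 1" by (rule norm_nrm[OF U])
    have tan: "jump \<T> lab e u w - jump \<T> lab e u 0 = 0" if "w \<bullet> ?n = 0" for w
      using P1_zero_on_tangent[OF jump_P1[OF u ad] zero(1)[OF e]] tangent_space_nrm[OF U] that by blast
    have ce: "compact e" by (rule compact_facet[OF U])
    have avg_eq: "avg \<T> lab e (dn u e) x = avg \<T> lab e u ?n - avg \<T> lab e u 0" for x
      unfolding avg_pw_deriv[OF u ad] face_normal_eq[OF e] ..
    have jv: "continuous_on UNIV (jump \<T> lab e v)"
      by (rule P1_continuous_on[OF jump_P1[OF v ad]])
    have "Re (L2_inner (face_measure e) (avg \<T> lab e (dn u e)) (jump \<T> lab e v))
        = (LINT x|face_measure e. Re ((avg \<T> lab e u ?n - avg \<T> lab e u 0) * cnj (jump \<T> lab e v x)))"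
      unfolding L2_inner_def avg_eq
      by (rule integral_Re[symmetric])
        (intro integrable_face_measure[OF ce] continuous_intros jv)
    also have "\<dots> = (if e \<in> interior_faces \<T> then (H (up e) e + H (lo e) e) / 2 else H (up e) e)"
    proof (cases "e \<in> interior_faces \<T>")
      case True
      have "Re ((avg \<T> lab e u ?n - avg \<T> lab e u 0) * cnj (jump \<T> lab e v x))
          = ((x - x\<^sub>0) \<bullet> ?n) * (G (up e) - G (lo e)) / 2" for x
      proof -
        have a: "avg \<T> lab e u ?n - avg \<T> lab e u 0
            = ((u (up e) ?n - u (up e) 0) + (u (lo e) ?n - u (lo e) 0)) / 2"
          using True by (simp add: avg_def field_simps)
        have j: "jump \<T> lab e v x
            = (u (up e) (x - x\<^sub>0) - u (up e) 0) - (u (lo e) (x - x\<^sub>0) - u (lo e) 0)"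
          using True by (simp add: jump_def vK[OF U(1)] vK[OF L(1)])
        have t: "u (up e) w - u (up e) 0 = u (lo e) w - u (lo e) 0" if "w \<bullet> ?n = 0" for w
          using tan[OF that] True by (simp add: jump_def algebra_simps)
        note g = grad_sq_diff[OF Vh_P1[OF u U(1)] Vh_P1[OF u L(1)] n t, of "x - x\<^sub>0"]
        show ?thesis
          unfolding a j G_def times_divide_eq_left Re_divide_numeral
          by (rule arg_cong[where f="\<lambda>t. t / 2"]) (rule g)
      qed
      then have "(LINT x|face_measure e. Re ((avg \<T> lab e u ?n - avg \<T> lab e u 0) * cnj (jump \<T> lab e v x)))
          = (LINT x|face_measure e. (((x - x\<^sub>0) \<bullet> ?n) * G (up e) - ((x - x\<^sub>0) \<bullet> ?n) * G (lo e)) / 2)"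
        by (simp only: right_diff_distrib)
      also have "\<dots> = (H (up e) e + H (lo e) e) / 2"
        unfolding H_def nrm_lo[OF True] using integrable_face_weight[OF ad] by simp
      finally show ?thesis using True by simp
    next
      case False
      have "Re ((avg \<T> lab e u ?n - avg \<T> lab e u 0) * cnj (jump \<T> lab e v x))
          = ((x - x\<^sub>0) \<bullet> ?n) * G (up e)" for x
      proof -
        have a: "avg \<T> lab e u ?n - avg \<T> lab e u 0 = u (up e) ?n - u (up e) 0"
          using False by (simp add: avg_def)
        have j: "jump \<T> lab e v x = u (up e) (x - x\<^sub>0) - u (up e) 0"
          using False by (simp add: jump_def vK[OF U(1)])
        \<comment> \<open>The zero function plays the second branch: it agrees with \<open>u\<close>
          on this face. The form \<open>0 - 0\<close> is the premise of \<open>grad_sq_diff\<close>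
          for it.\<close>
        have t: "u (up e) w - u (up e) 0 = 0 - 0" if "w \<bullet> ?n = 0" for w
          using tan[OF that] False by (simp add: jump_def)
        note g = grad_sq_diff[OF Vh_P1[OF u U(1)] P1_const[of 0] n t, of "x - x\<^sub>0"]
        have "grad_sq (\<lambda>_::'a. 0) = 0" by (simp add: grad_sq_def)
        with g show ?thesis
          unfolding a j G_def by (simp only: diff_zero add_0_right)
      qed
      then show ?thesis using False by (simp only: H_def if_False)
    qed
    finally show ?thesis .
  qed
  have H_sum: "DIM('a) * S = (\<Sum>e\<in>interior_faces \<T>. H (up e) e + H (lo e) e)
      + (\<Sum>e\<in>faces_on \<T> \<Gamma>\<^sub>D. H (up e) e) + (\<Sum>e\<in>faces_on \<T> \<Gamma>\<^sub>R. H (up e) e)"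
  proof -
    have "DIM('a) * (LINT x|lebesgue_on K. G K) = (\<Sum>e | e facet_of K. H K e)" if "K \<in> \<T>" for K
    proof -
      \<comment> \<open>\<open>element_identity\<close> is about squared moduli of affine functions;
        a constant of squared modulus \<open>G K\<close> has no linear part and leaves just the flux
        of the position field.\<close>
      have "(cmod (complex_of_real (sqrt (G K))))\<^sup>2 = G K" using G0 by simp
      with element_identity[OF that P1_const, of "of_real (sqrt (G K))" x\<^sub>0] show ?thesis
        unfolding H_def by (simp add: mult_ac)
    qed
    then show ?thesis
      unfolding S_def sum_distrib_left sum_elem_facets[symmetric] by (intro sum.cong) auto
  qed
  have Q_sum: "DIM('a) * M + 2 * Re (mesh_inner \<T> u v) = 0"
  proof -
    have "(\<Sum>K\<in>\<T>. DIM('a) * (LINT x|lebesgue_on K. (cmod (u K x))\<^sup>2)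
        + 2 * Re (L2_inner (lebesgue_on K) (u K) (v K))) = (\<Sum>K\<in>\<T>. \<Sum>e | e facet_of K. Q K e)"
    proof (rule sum.cong[OF refl])
      fix K assume K: "K \<in> \<T>"
      have cu: "continuous_on UNIV (u K)" by (rule P1_continuous_on[OF Vh_P1[OF u K]])
      have cv: "continuous_on UNIV (v K)" by (rule P1_continuous_on[OF Vh_P1[OF v K]])
      have lin: "(LINT x|N. a * p x + 2 * q x) = a * integral\<^sup>L N p + 2 * integral\<^sup>L N q"
        if "integrable N p" "integrable N q" for N :: "'a measure" and a :: real and p q
        using that by simp
      have i: "integrable (lebesgue_on K) (\<lambda>x. (cmod (u K x))\<^sup>2)"
        "integrable (lebesgue_on K) (\<lambda>x. u K x * cnj (v K x))"
        by (intro integrable_lebesgue_on_compact compact_elem[OF K] continuous_intros cu cv)+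
      have "(\<Sum>e | e facet_of K. Q K e)
          = (LINT x|lebesgue_on K. DIM('a) * (cmod (u K x))\<^sup>2 + 2 * Re (u K x * cnj (v K x)))"
        unfolding Q_def element_identity[OF K Vh_P1[OF u K], of x\<^sub>0, symmetric] vK[OF K] ..
      also have "\<dots> = DIM('a) * (LINT x|lebesgue_on K. (cmod (u K x))\<^sup>2)
          + 2 * (LINT x|lebesgue_on K. Re (u K x * cnj (v K x)))"
        by (rule lin[OF i(1) integrable_Re[OF i(2)]])
      also have "(LINT x|lebesgue_on K. Re (u K x * cnj (v K x))) = Re (L2_inner (lebesgue_on K) (u K) (v K))"
        unfolding L2_inner_def by (rule integral_Re[OF i(2)])
      finally show "DIM('a) * (LINT x|lebesgue_on K. (cmod (u K x))\<^sup>2)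
          + 2 * Re (L2_inner (lebesgue_on K) (u K) (v K)) = (\<Sum>e | e facet_of K. Q K e)" by simp
    qed
    also have "\<dots> = 0"
    proof -
      have zQ: "Q (up e) e = 0" if "adj e \<noteq> {}" "\<And>x. x \<in> e \<Longrightarrow> u (up e) x = 0" for e
      proof -
        have "Q (up e) e = (LINT x|face_measure e. 0)"
          unfolding Q_def using that(2) by (intro Bochner_Integration.integral_cong) auto
        then show ?thesis by simp
      qed
      have "Q (up e) e + Q (lo e) e = 0" if e: "e \<in> interior_faces \<T>" for e
      proof -
        have eq: "u (lo e) x = u (up e) x" if "x \<in> e" for x
          using zero(1)[of e x] e that by (simp add: jump_def)
        have "Q (lo e) e = (LINT x|face_measure e. - (((x - x\<^sub>0) \<bullet> nrm (up e) e) * (cmod (u (up e) x))\<^sup>2))"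
          unfolding Q_def nrm_lo[OF e] using eq by (intro Bochner_Integration.integral_cong) auto
        then show ?thesis unfolding Q_def by simp
      qed
      moreover have "Q (up e) e = 0" if e: "e \<in> faces_on \<T> \<Gamma>\<^sub>D" for e
        using zero(1)[of e] e faces_on_not_interior[OF _ e] by (intro zQ faces_on_adj[OF e]) (simp add: jump_def)
      moreover have "Q (up e) e = 0" if e: "e \<in> faces_on \<T> \<Gamma>\<^sub>R" for e
        using zero(3)[OF e] by (intro zQ faces_on_adj[OF e])
      ultimately show ?thesis unfolding sum_elem_facets by simp
    qed
    finally show ?thesis
      unfolding M_def mesh_inner_def by (simp add: sum.distrib sum_distrib_left)
  qed
  have "S - ((\<Sum>e\<in>interior_faces \<T>. H (up e) e + H (lo e) e) / 2 + (\<Sum>e\<in>faces_on \<T> \<Gamma>\<^sub>D. H (up e) e))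
      - k\<^sup>2 * Re (mesh_inner \<T> u v) = 0"
  proof -
    have ni: "e \<notin> interior_faces \<T>" if "e \<in> faces_on \<T> \<Gamma>\<^sub>D" for e
      using faces_on_not_interior[OF _ that] by blast
    have "(\<Sum>e\<in>faces_ID. Re (L2_inner (face_measure e) (avg \<T> lab e (dn u e)) (jump \<T> lab e v)))
        = (\<Sum>e\<in>faces_ID. if e \<in> interior_faces \<T> then (H (up e) e + H (lo e) e) / 2 else H (up e) e)"
      using reF by (intro sum.cong) auto
    also have "\<dots> = (\<Sum>e\<in>interior_faces \<T>. (H (up e) e + H (lo e) e) / 2) + (\<Sum>e\<in>faces_on \<T> \<Gamma>\<^sub>D. H (up e) e)"
      using finite_faces ni by (subst sum.union_disjoint) (auto intro!: arg_cong2[where f="(+)"] sum.cong)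
    finally show ?thesis
      using z[OF v] arg_cong[OF form_reduced[OF u z[OF u] v], of Re]
      unfolding grad_v by (simp add: Re_sum sum_divide_distrib)
  qed
  moreover have "(\<Sum>e\<in>faces_on \<T> \<Gamma>\<^sub>D. H (up e) e) \<le> 0"
  proof (rule sum_nonpos)
    fix e assume e: "e \<in> faces_on \<T> \<Gamma>\<^sub>D"
    have "0 \<le> (LINT x|face_measure e. - (((x - x\<^sub>0) \<bullet> nrm (up e) e) * G (up e)))"
      using normal_distance_sign(2)[OF faces_on_adj[OF e] _ e] G0
      by (intro integral_nonneg_AE AE_I2) (auto intro: mult_nonpos_nonneg)
    then show "H (up e) e \<le> 0" unfolding H_def by simp
  qed
  moreover have "(\<Sum>e\<in>faces_on \<T> \<Gamma>\<^sub>R. H (up e) e) \<ge> 0"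
  proof (rule sum_nonneg)
    fix e assume e: "e \<in> faces_on \<T> \<Gamma>\<^sub>R"
    show "H (up e) e \<ge> 0" unfolding H_def
      using normal_distance_sign(1)[OF faces_on_adj[OF e] _ e] G0
      by (intro integral_nonneg_AE AE_I2) auto
  qed
  moreover have "k\<^sup>2 * Re (mesh_inner \<T> u v) = - (DIM('a) * S) / 2"
  proof -
    have "Re (mesh_inner \<T> u v) = - (DIM('a) * M) / 2" using Q_sum by simp
    then show ?thesis by (simp add: SM)
  qed
  \<comment> \<open>Write I, D, R for the sums of \<open>H\<close> over interior faces and over
    those on \<open>\<Gamma>\<^sub>D\<close> and \<open>\<Gamma>\<^sub>R\<close>. From S - I/2 - D +
    d S/2 = 0 and d S = I + D + R follows 2 S = D - R, where D \<le> 0 \<le> R.\<close>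
  ultimately have "S \<le> 0" using H_sum by (simp add: field_simps)
  moreover have "M \<ge> 0" unfolding M_def by (intro sum_nonneg sqnorm_nonneg)
  ultimately have "M = 0" using k unfolding SM by (simp add: mult_le_0_iff)
  then have "(LINT x|lebesgue_on K. (cmod (u K x))\<^sup>2) = 0"
    unfolding M_def by (rule sum_nonneg_0[OF finite_T sqnorm_nonneg _ K])
  then show ?thesis by (rule element_integral_eq_0_imp[OF K Vh_P1[OF u K]])
qed

end

section \<open>Unique solvability\<close>

text \<open>Gaussian elimination by induction on the equations: a trivial equation is dropped, any
  other removes one unknown.\<close>

lemma underdetermined_system:
  fixes a :: "'i \<Rightarrow> 'j \<Rightarrow> 'f::field"
  assumes "finite I" "finite J" "card I < card J"
  shows "\<exists>x. (\<exists>j\<in>J. x j \<noteq> 0) \<and> (\<forall>i\<in>I. (\<Sum>j\<in>J. a i j * x j) = 0)"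
  using assms
proof (induction I arbitrary: J a rule: finite_induct)
  case empty
  then obtain j where "j \<in> J" by (metis card_gt_0_iff card.empty ex_in_conv)
  then show ?case by (intro exI[of _ "\<lambda>_. 1"]) auto
next
  case (insert i0 I)
  show ?case
  proof (cases "\<forall>j\<in>J. a i0 j = 0")
    case True
    have "card I < card J" using insert.prems insert.hyps by simp
    then obtain x where "\<exists>j\<in>J. x j \<noteq> 0" "\<forall>i\<in>I. (\<Sum>j\<in>J. a i j * x j) = 0"
      using insert.IH[OF insert.prems(1)] by blast
    then show ?thesis using True by (intro exI[of _ x]) auto
  next
    case False
    then obtain j0 where j0: "j0 \<in> J" "a i0 j0 \<noteq> 0" by blast
    define J' where "J' = J - {j0}"
    \<comment> \<open>Elimination of the unknown \<open>j0\<close> with pivot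
      \<open>a i0 j0\<close>; the value of \<open>y\<close> at \<open>j0\<close> below is the back
      substitution in equation \<open>i0\<close>.\<close>
    define a' where "a' i j = a i j - a i j0 * a i0 j / a i0 j0" for i j
    have fJ: "finite J'" "J = insert j0 J'" "j0 \<notin> J'" unfolding J'_def using j0 insert.prems by auto
    have "card I < card J'" using insert.prems insert.hyps fJ by simp
    then obtain x where x: "\<exists>j\<in>J'. x j \<noteq> 0" "\<forall>i\<in>I. (\<Sum>j\<in>J'. a' i j * x j) = 0"
      using insert.IH[OF fJ(1), of a'] by blast
    define y where "y = x(j0 := - (\<Sum>j\<in>J'. a i0 j * x j) / a i0 j0)"
    have ys: "(\<Sum>j\<in>J. a i j * y j) = a i j0 * y j0 + (\<Sum>j\<in>J'. a i j * x j)" for i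
    proof -
      have "(\<Sum>j\<in>J'. a i j * y j) = (\<Sum>j\<in>J'. a i j * x j)"
        unfolding y_def using fJ(3) by (intro sum.cong) auto
      then show ?thesis using fJ by simp
    qed
    have y0: "y j0 = - (\<Sum>j\<in>J'. a i0 j * x j) / a i0 j0"
      unfolding y_def by simp
    have "(\<Sum>j\<in>J. a i j * y j) = 0" if "i \<in> insert i0 I" for i
    proof (cases "i = i0")
      case True
      then show ?thesis using j0(2) by (simp add: ys y0)
    next
      case False
      then have "0 = (\<Sum>j\<in>J'. a' i j * x j)" using that x(2) by simp
      also have "\<dots> = (\<Sum>j\<in>J'. a i j * x j) - a i j0 / a i0 j0 * (\<Sum>j\<in>J'. a i0 j * x j)"
        unfolding a'_def by (simp add: left_diff_distrib sum_subtractf sum_distrib_left mult.assoc)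
      finally show ?thesis by (simp add: ys y0)
    qed
    moreover have "\<exists>j\<in>J. y j \<noteq> 0" using x(1) fJ unfolding y_def by auto
    ultimately show ?thesis by blast
  qed
qed

text \<open>The right-hand side becomes one more unknown, indexed by \<open>None\<close>. The
  homogeneous system then has a nontrivial solution, injectivity forbids that its
  \<open>None\<close> entry is zero, and division by this entry solves the system.\<close>

lemma square_system_solvable:
  fixes a :: "'i \<Rightarrow> 'i \<Rightarrow> 'f::field"
  assumes J: "finite J"
    and inj: "\<And>x. (\<And>i. i \<in> J \<Longrightarrow> (\<Sum>j\<in>J. a i j * x j) = 0) \<Longrightarrow> (\<forall>j\<in>J. x j = 0)"
  shows "\<exists>x. \<forall>i\<in>J. (\<Sum>j\<in>J. a i j * x j) = b i"
proof -
  define A where "A i j = (case j of None \<Rightarrow> - b i | Some j \<Rightarrow> a i j)" for i and j :: "'i option"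
  have "card J < card (insert None (Some ` J))"
    using J by (simp add: card_image)
  then obtain x where x: "\<exists>j\<in>insert None (Some ` J). x j \<noteq> 0"
    "\<forall>i\<in>J. (\<Sum>j\<in>insert None (Some ` J). A i j * x j) = 0"
    using underdetermined_system[of J "insert None (Some ` J)" A] J by auto
  have eq: "(\<Sum>j\<in>J. a i j * x (Some j)) = b i * x None" if "i \<in> J" for i
    using x(2) that J by (auto simp: A_def sum.reindex)
  have "x None \<noteq> 0"
  proof
    assume 0: "x None = 0"
    then have "\<forall>j\<in>J. x (Some j) = 0" using inj[of "\<lambda>j. x (Some j)"] eq by simp
    then show False using x(1) 0 by auto
  qed
  then have "\<forall>i\<in>J. (\<Sum>j\<in>J. a i j * (x (Some j) / x None)) = b i"
    using eq by (simp flip: sum_divide_distrib)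
  then show ?thesis by (intro exI[of _ "\<lambda>j. x (Some j) / x None"])
qed

section \<open>Linearity and integrability for \<open>L2_inner\<close>\<close>

lemma L2_inner_linear_left:
  assumes "integrable M (\<lambda>x. p x * cnj (r x))" "integrable M (\<lambda>x. q x * cnj (r x))"
  shows "L2_inner M (\<lambda>x. c * p x + q x) r = c * L2_inner M p r + L2_inner M q r"
proof -
  have "(\<lambda>x. (c * p x + q x) * cnj (r x)) = (\<lambda>x. c * (p x * cnj (r x)) + q x * cnj (r x))"
    by (simp add: algebra_simps)
  then show ?thesis
    unfolding L2_inner_def using assms by simp
qed

lemma L2_inner_linear_right:
  assumes "integrable M (\<lambda>x. r x * cnj (p x))" "integrable M (\<lambda>x. r x * cnj (q x))"
  shows "L2_inner M r (\<lambda>x. c * p x + q x) = cnj c * L2_inner M r p + L2_inner M r q"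
proof -
  have "(\<lambda>x. r x * cnj (c * p x + q x)) = (\<lambda>x. cnj c * (r x * cnj (p x)) + r x * cnj (q x))"
    by (simp add: algebra_simps)
  then show ?thesis
    unfolding L2_inner_def using assms by simp
qed

lemma L2_fun_integrable_mult_cnj:
  assumes f: "L2_fun M f" and g: "L2_fun M g"
  shows "integrable M (\<lambda>x. f x * cnj (g x))"
proof (rule Bochner_Integration.integrable_bound)
  show "integrable M (\<lambda>x. (cmod (f x))\<^sup>2 + (cmod (g x))\<^sup>2)"
    using f g unfolding L2_fun_def by simp
  have [measurable]: "f \<in> borel_measurable M" "g \<in> borel_measurable M"
    using f g unfolding L2_fun_def by auto
  have "cnj \<in> borel_measurable borel"
    by (intro borel_measurable_continuous_onI continuous_intros)
  then have [measurable]: "(\<lambda>x. cnj (g x)) \<in> borel_measurable M"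
    by (rule measurable_compose[rotated]) simp
  show "(\<lambda>x. f x * cnj (g x)) \<in> borel_measurable M" by measurable
  have "cmod (f x) * cmod (g x) \<le> (cmod (f x))\<^sup>2 + (cmod (g x))\<^sup>2" for x
  proof -
    have "2 * (cmod (f x) * cmod (g x)) \<le> (cmod (f x))\<^sup>2 + (cmod (g x))\<^sup>2"
      using sum_squares_bound[of "cmod (f x)" "cmod (g x)"] by simp
    moreover have "0 \<le> cmod (f x) * cmod (g x)" by simp
    ultimately show ?thesis by linarith
  qed
  then show "AE x in M. norm (f x * cnj (g x)) \<le> norm ((cmod (f x))\<^sup>2 + (cmod (g x))\<^sup>2)"
    by (intro AE_I2) (simp add: norm_mult)
qed

lemma L2_fun_continuous:
  assumes "finite_measure M" "compact (space M)" "continuous_on UNIV p" "p \<in> borel_measurable M"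
  shows "L2_fun M p"
  unfolding L2_fun_def
  using assms by (intro conjI integrable_continuous_compact continuous_intros) auto

text \<open>The index 0, which is no basis vector, stands for the constant function, so
  \<open>insert 0 Basis\<close> indexes a basis of \<open>P1\<close>.\<close>

definition monom :: "'a::euclidean_space \<Rightarrow> 'a \<Rightarrow> complex" where
  "monom b x = (if b = 0 then 1 else of_real (x \<bullet> b))"

lemma monom_P1: "monom b \<in> P1"
  unfolding P1_iff_linear monom_def
  by (intro linearI) (simp_all add: inner_add_left scaleR_conv_of_real)

section \<open>Sesquilinear forms on the discrete space\<close>

context simplicial_mesh
begin

text \<open>One operation for scaling and addition makes linearity a single equation; the
  restriction keeps the result extensional, as \<open>Vh\<close> demands.\<close>

definition lin :: "complex \<Rightarrow> 'a pw \<Rightarrow> 'a pw \<Rightarrow> 'a pw" where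
  "lin c u v = (\<lambda>K\<in>\<T>. \<lambda>x. c * u K x + v K x)"

lemma lin_apply: "K \<in> \<T> \<Longrightarrow> lin c u v K x = c * u K x + v K x"
  unfolding lin_def by simp

lemma lin_Vh: "u \<in> Vh \<T> \<Longrightarrow> v \<in> Vh \<T> \<Longrightarrow> lin c u v \<in> Vh \<T>"
  unfolding lin_def by (intro Vh_restrictI P1_add P1_cmult Vh_P1)

text \<open>Covers branches, jumps and averages as ordinary functions to be integrated over one
  element or face. Continuity on the whole space makes them square integrable on every compact
  piece.\<close>

definition linear_op :: "('a pw \<Rightarrow> 'a \<Rightarrow> complex) \<Rightarrow> bool" where
  "linear_op A \<longleftrightarrow> (\<forall>u\<in>Vh \<T>. continuous_on UNIV (A u)) \<and>
    (\<forall>u\<in>Vh \<T>. \<forall>v\<in>Vh \<T>. \<forall>c x. A (lin c u v) x = c * A u x + A v x)"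

definition sesquilinear :: "('a pw \<Rightarrow> 'a pw \<Rightarrow> complex) \<Rightarrow> bool" where
  "sesquilinear F \<longleftrightarrow> (\<forall>u\<in>Vh \<T>. \<forall>v\<in>Vh \<T>. \<forall>w\<in>Vh \<T>. \<forall>c.
    F (lin c u v) w = c * F u w + F v w \<and> F w (lin c u v) = cnj c * F w u + F w v)"

lemma sesquilinear_L2:
  assumes M: "\<And>p. continuous_on UNIV p \<Longrightarrow> L2_fun M p" and A: "linear_op A" "linear_op B"
  shows "sesquilinear (\<lambda>u v. L2_inner M (A u) (B v))"
proof -
  have int: "integrable M (\<lambda>x. A u x * cnj (B v x))" if "u \<in> Vh \<T>" "v \<in> Vh \<T>" for u v
    using M A that unfolding linear_op_def by (intro L2_fun_integrable_mult_cnj) auto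
  have eq: "A (lin c u v) = (\<lambda>x. c * A u x + A v x)" "B (lin c u v) = (\<lambda>x. c * B u x + B v x)"
    if "u \<in> Vh \<T>" "v \<in> Vh \<T>" for u v c
    using A that unfolding linear_op_def by auto
  show ?thesis
    unfolding sesquilinear_def using int eq by (simp add: L2_inner_linear_left L2_inner_linear_right)
qed

lemma L2_fun_elem: "K \<in> \<T> \<Longrightarrow> continuous_on UNIV p \<Longrightarrow> L2_fun (lebesgue_on K) p"
  by (intro L2_fun_continuous finite_measure_lebesgue_on_compact measurable_restrict_space1
      measurable_completion) (auto simp: compact_elem intro: borel_measurable_continuous_onI)

lemma L2_fun_face: "adj e \<noteq> {} \<Longrightarrow> continuous_on UNIV p \<Longrightarrow> L2_fun (face_measure e) p"
  using compact_facet[OF up_elem]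
  by (intro L2_fun_continuous finite_measure_face_measure borel_measurable_face_measure)
    (auto intro: borel_measurable_continuous_onI)

lemma sesquilinear_sum:
  "(\<And>i. i \<in> I \<Longrightarrow> sesquilinear (F i)) \<Longrightarrow> sesquilinear (\<lambda>u v. \<Sum>i\<in>I. F i u v)"
  unfolding sesquilinear_def by (simp add: sum.distrib sum_distrib_left)

lemma sesquilinear_add:
  "sesquilinear F \<Longrightarrow> sesquilinear G \<Longrightarrow> sesquilinear (\<lambda>u v. F u v + G u v)"
  unfolding sesquilinear_def by (simp add: algebra_simps)

lemma sesquilinear_cmult: "sesquilinear F \<Longrightarrow> sesquilinear (\<lambda>u v. c * F u v)"
  unfolding sesquilinear_def by (simp add: algebra_simps)

lemma sesquilinear_diff:
  "sesquilinear F \<Longrightarrow> sesquilinear G \<Longrightarrow> sesquilinear (\<lambda>u v. F u v - G u v)"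
  unfolding sesquilinear_def by (simp add: algebra_simps)

lemma linear_op_elem: "K \<in> \<T> \<Longrightarrow> linear_op (\<lambda>u. u K)"
  unfolding linear_op_def by (simp add: lin_apply P1_continuous_on Vh_P1)

lemma linear_op_constI:
  assumes A: "\<And>u x. u \<in> Vh \<T> \<Longrightarrow> A u x = B u"
    and B: "\<And>u v c. u \<in> Vh \<T> \<Longrightarrow> v \<in> Vh \<T> \<Longrightarrow> B (lin c u v) = c * B u + B v"
  shows "linear_op A"
proof -
  have "A u = (\<lambda>_. B u)" if "u \<in> Vh \<T>" for u
    using A[OF that] by (rule ext)
  then show ?thesis
    unfolding linear_op_def using B lin_Vh by simp
qed

lemma linear_op_deriv: "K \<in> \<T> \<Longrightarrow> linear_op (\<lambda>u. pw_deriv \<nu> u K)"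
  by (rule linear_op_constI[where B="\<lambda>u. u K \<nu> - u K 0"])
    (simp_all add: pw_deriv_Vh lin_apply right_diff_distrib)

lemma jump_lin:
  "adj e \<noteq> {} \<Longrightarrow> jump \<T> lab e (lin c u v) x = c * jump \<T> lab e u x + jump \<T> lab e v x"
  by (simp add: jump_def lin_apply up_elem lo_elem right_diff_distrib)

lemma avg_lin:
  "adj e \<noteq> {} \<Longrightarrow> avg \<T> lab e (lin c u v) x = c * avg \<T> lab e u x + avg \<T> lab e v x"
  by (simp add: avg_def lin_apply up_elem lo_elem ring_distribs add_divide_distrib)

lemma linear_op_jump: "adj e \<noteq> {} \<Longrightarrow> linear_op (jump \<T> lab e)"
  unfolding linear_op_def by (simp add: P1_continuous_on jump_P1 jump_lin)

lemma linear_op_jump_deriv: "adj e \<noteq> {} \<Longrightarrow> linear_op (\<lambda>u. jump \<T> lab e (pw_deriv \<nu> u))"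
  by (rule linear_op_constI[where B="\<lambda>u. jump \<T> lab e u \<nu> - jump \<T> lab e u 0"])
    (simp_all add: jump_pw_deriv jump_lin right_diff_distrib)

lemma linear_op_avg_deriv: "adj e \<noteq> {} \<Longrightarrow> linear_op (\<lambda>u. avg \<T> lab e (pw_deriv \<nu> u))"
  by (rule linear_op_constI[where B="\<lambda>u. avg \<T> lab e u \<nu> - avg \<T> lab e u 0"])
    (simp_all add: avg_pw_deriv avg_lin right_diff_distrib)

lemma sesquilinear_mesh_inner: "sesquilinear (mesh_inner \<T>)"
  unfolding mesh_inner_def[abs_def]
  by (intro sesquilinear_sum sesquilinear_L2 L2_fun_elem linear_op_elem)

definition antilinear :: "('a pw \<Rightarrow> complex) \<Rightarrow> bool" where
  "antilinear F \<longleftrightarrow> (\<forall>u\<in>Vh \<T>. \<forall>v\<in>Vh \<T>. \<forall>c. F (lin c u v) = cnj c * F u + F v)"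

lemma antilinear_L2:
  assumes f: "L2_fun M f" and M: "\<And>p. continuous_on UNIV p \<Longrightarrow> L2_fun M p" and A: "linear_op A"
  shows "antilinear (\<lambda>v. L2_inner M f (A v))"
proof -
  have int: "integrable M (\<lambda>x. f x * cnj (A v x))" if "v \<in> Vh \<T>" for v
    using f M A that unfolding linear_op_def by (intro L2_fun_integrable_mult_cnj) auto
  have eq: "A (lin c u v) = (\<lambda>x. c * A u x + A v x)" if "u \<in> Vh \<T>" "v \<in> Vh \<T>" for u v c
    using A that unfolding linear_op_def by auto
  show ?thesis
    unfolding antilinear_def using int eq by (simp add: L2_inner_linear_right)
qed

lemma antilinear_sum:
  "(\<And>i. i \<in> I \<Longrightarrow> antilinear (F i)) \<Longrightarrow> antilinear (\<lambda>v. \<Sum>i\<in>I. F i v)"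
  unfolding antilinear_def by (simp add: sum.distrib sum_distrib_left)

lemma antilinear_add:
  "antilinear F \<Longrightarrow> antilinear G \<Longrightarrow> antilinear (\<lambda>v. F v + G v)"
  unfolding antilinear_def by (simp add: algebra_simps)

section \<open>Coordinates on the discrete space\<close>

definition zero_pw :: "'a pw" where
  "zero_pw = (\<lambda>K\<in>\<T>. \<lambda>x. 0)"

definition basis_fun :: "'a set \<times> 'a \<Rightarrow> 'a pw" where
  "basis_fun j = (\<lambda>K\<in>\<T>. \<lambda>x. if K = fst j then monom (snd j) x else 0)"

definition index_set :: "('a set \<times> 'a) set" where
  "index_set = \<T> \<times> insert 0 Basis"

definition comb :: "('a set \<times> 'a \<Rightarrow> complex) \<Rightarrow> ('a set \<times> 'a) set \<Rightarrow> 'a pw" where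
  "comb c J = (\<lambda>K\<in>\<T>. \<lambda>x. \<Sum>j\<in>J. c j * basis_fun j K x)"

lemma finite_index_set: "finite index_set"
  unfolding index_set_def using finite_T by simp

lemma zero_Vh: "zero_pw \<in> Vh \<T>"
  unfolding zero_pw_def by (intro Vh_restrictI P1_const)

lemma basis_Vh: "basis_fun j \<in> Vh \<T>"
proof -
  have "(\<lambda>x. if K = fst j then monom (snd j) x else 0) \<in> P1" for K
    by (cases "K = fst j") (simp_all add: monom_P1)
  then show ?thesis unfolding basis_fun_def by (intro Vh_restrictI)
qed

lemma comb_empty: "comb c {} = zero_pw"
  unfolding comb_def zero_pw_def by simp

lemma comb_insert: "finite J \<Longrightarrow> j \<notin> J \<Longrightarrow> comb c (insert j J) = lin (c j) (basis_fun j) (comb c J)"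
  unfolding comb_def lin_def by (intro ext) (simp add: restrict_def)

lemma comb_Vh: "finite J \<Longrightarrow> comb c J \<in> Vh \<T>"
  by (induction J rule: finite_induct) (simp_all add: comb_empty comb_insert zero_Vh basis_Vh lin_Vh)

lemma lin_zero: "lin 1 zero_pw zero_pw = zero_pw"
  unfolding lin_def zero_pw_def by (intro ext) (simp add: restrict_def)

lemma sesquilinear_comb:
  assumes F: "sesquilinear F" and J: "finite J" and w: "w \<in> Vh \<T>"
  shows "F (comb c J) w = (\<Sum>j\<in>J. F (basis_fun j) w * c j)"
    and "F w (comb c J) = (\<Sum>j\<in>J. cnj (c j) * F w (basis_fun j))"
  using J
proof (induction J rule: finite_induct)
  case empty
  \<comment> \<open>Since \<open>lin 1 zero_pw zero_pw\<close> is \<open>zero_pw\<close>, the value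
    at zero equals twice itself.\<close>
  have "F (lin 1 zero_pw zero_pw) w = 1 * F zero_pw w + F zero_pw w"
    "F w (lin 1 zero_pw zero_pw) = cnj 1 * F w zero_pw + F w zero_pw"
    using F w zero_Vh unfolding sesquilinear_def by blast+
  then show "F (comb c {}) w = (\<Sum>j\<in>{}. F (basis_fun j) w * c j)"
    "F w (comb c {}) = (\<Sum>j\<in>{}. cnj (c j) * F w (basis_fun j))"
    by (simp_all add: lin_zero comb_empty)
next
  case (insert j J)
  have "F (lin (c j) (basis_fun j) (comb c J)) w = c j * F (basis_fun j) w + F (comb c J) w"
    "F w (lin (c j) (basis_fun j) (comb c J)) = cnj (c j) * F w (basis_fun j) + F w (comb c J)"
    using F w basis_Vh comb_Vh[OF insert.hyps(1)] unfolding sesquilinear_def by blast+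
  then show "F (comb c (insert j J)) w = (\<Sum>j\<in>insert j J. F (basis_fun j) w * c j)"
    "F w (comb c (insert j J)) = (\<Sum>j\<in>insert j J. cnj (c j) * F w (basis_fun j))"
    using insert by (simp_all add: comb_insert mult.commute)
qed

lemma antilinear_comb:
  assumes F: "antilinear F" and J: "finite J"
  shows "F (comb c J) = (\<Sum>j\<in>J. cnj (c j) * F (basis_fun j))"
  using J
proof (induction J rule: finite_induct)
  case empty
  have "F (lin 1 zero_pw zero_pw) = cnj 1 * F zero_pw + F zero_pw"
    using F zero_Vh unfolding antilinear_def by blast
  then show ?case by (simp add: lin_zero comb_empty)
next
  case (insert j J)
  have "F (lin (c j) (basis_fun j) (comb c J)) = cnj (c j) * F (basis_fun j) + F (comb c J)"
    using F basis_Vh comb_Vh[OF insert.hyps(1)] unfolding antilinear_def by blast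
  then show ?case using insert by (simp add: comb_insert)
qed

lemma comb_apply:
  assumes K: "K \<in> \<T>"
  shows "comb c index_set K x = c (K, 0) + (\<Sum>b\<in>Basis. c (K, b) * of_real (x \<bullet> b))"
proof -
  have "comb c index_set K x = (\<Sum>K'\<in>\<T>. \<Sum>b\<in>insert 0 Basis. c (K', b) * basis_fun (K', b) K x)"
    unfolding comb_def index_set_def sum.cartesian_product using K by (simp add: case_prod_unfold)
  also have "\<dots> = (\<Sum>K'\<in>\<T>. if K' = K then \<Sum>b\<in>insert 0 Basis. c (K, b) * monom b x else 0)"
    using K by (intro sum.cong refl) (auto simp: basis_fun_def)
  also have "\<dots> = (\<Sum>b\<in>insert 0 Basis. c (K, b) * monom b x)"
    using K finite_T by simp
  also have "\<dots> = c (K, 0) * monom 0 x + (\<Sum>b\<in>Basis. c (K, b) * monom b x)"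
    by (subst sum.insert) auto
  also have "\<dots> = c (K, 0) + (\<Sum>b\<in>Basis. c (K, b) * of_real (x \<bullet> b))"
    unfolding monom_def by (auto intro!: arg_cong2[where f="(+)"] sum.cong)
  finally show ?thesis .
qed

lemma comb_surj:
  assumes u: "u \<in> Vh \<T>"
  shows "\<exists>c. u = comb c index_set"
proof -
  have "\<forall>K\<in>\<T>. \<exists>a b. u K = (\<lambda>x. a + (\<Sum>i\<in>Basis. b i * of_real (x \<bullet> i)))"
    using Vh_P1[OF u] unfolding P1_def by blast
  then obtain a b where ab: "\<And>K. K \<in> \<T> \<Longrightarrow> u K = (\<lambda>x. a K + (\<Sum>i\<in>Basis. b K i * of_real (x \<bullet> i)))"
    by metis
  define c where "c j = (if snd j = 0 then a (fst j) else b (fst j) (snd j))" for j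
  have "u = comb c index_set"
  proof (rule PiE_ext[where k=\<T> and s="\<lambda>_. P1"])
    show "u \<in> \<T> \<rightarrow>\<^sub>E P1" "comb c index_set \<in> \<T> \<rightarrow>\<^sub>E P1"
      using u comb_Vh[OF finite_index_set] unfolding Vh_def by auto
    fix K assume K: "K \<in> \<T>"
    show "u K = comb c index_set K"
    proof
      fix x
      have "(\<Sum>i\<in>Basis. b K i * of_real (x \<bullet> i)) = (\<Sum>i\<in>Basis. c (K, i) * of_real (x \<bullet> i))"
        unfolding c_def by (intro sum.cong) auto
      then show "u K x = comb c index_set K x"
        unfolding comb_apply[OF K] using ab[OF K] by (simp add: c_def)
    qed
  qed
  then show ?thesis by blast
qed

text \<open>Branches are polynomials on the whole space, so they may be evaluated at the origin and
  at the basis vectors, even outside \<open>K\<close>, which isolates the coefficients.\<close>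

lemma comb_inj:
  assumes z: "\<And>K. K \<in> \<T> \<Longrightarrow> comb c index_set K = (\<lambda>x. 0)" and j: "j \<in> index_set"
  shows "c j = 0"
proof -
  obtain K b where Kb: "j = (K, b)" "K \<in> \<T>" "b \<in> insert 0 Basis"
    using j unfolding index_set_def by blast
  have eq: "c (K, 0) + (\<Sum>i\<in>Basis. c (K, i) * of_real (x \<bullet> i)) = 0" for x
    using comb_apply[OF Kb(2), of c x] z[OF Kb(2)] by simp
  have c0: "c (K, 0) = 0" using eq[of 0] by simp
  have "c (K, b) = 0" if "b \<in> Basis"
  proof -
    have "(\<Sum>i\<in>Basis. c (K, i) * of_real (b \<bullet> i)) = (\<Sum>i\<in>Basis. if i = b then c (K, i) else 0)"
      using that by (intro sum.cong) (auto simp: inner_Basis)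
    then show ?thesis using eq[of b] c0 that by simp
  qed
  then show ?thesis using c0 Kb by auto
qed

text \<open>In coordinates the rows belong to test functions and the columns to trial functions. A
  null vector of the matrix is a function in the kernel of \<open>F\<close>, since conjugated test
  coefficients merely combine rows; \<open>ker\<close> thus gives injectivity, hence solvability,
  and also uniqueness.\<close>

lemma unique_solution:
  assumes F: "sesquilinear F" and G: "antilinear G"
    and ker: "\<And>u K. u \<in> Vh \<T> \<Longrightarrow> (\<And>v. v \<in> Vh \<T> \<Longrightarrow> F u v = 0) \<Longrightarrow> K \<in> \<T> \<Longrightarrow> u K = (\<lambda>x. 0)"
  shows "\<exists>!u. u \<in> Vh \<T> \<and> (\<forall>v\<in>Vh \<T>. F u v = G v)"
proof -
  note fin = finite_index_set
  have "\<exists>x. \<forall>i\<in>index_set. (\<Sum>j\<in>index_set. F (basis_fun j) (basis_fun i) * x j) = G (basis_fun i)"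
  proof (rule square_system_solvable[OF fin], rule ballI)
    fix x j assume x: "\<And>i. i \<in> index_set \<Longrightarrow> (\<Sum>j\<in>index_set. F (basis_fun j) (basis_fun i) * x j) = 0"
      and j: "j \<in> index_set"
    have "F (comb x index_set) v = 0" if v: "v \<in> Vh \<T>" for v
    proof -
      obtain c where c: "v = comb c index_set" using comb_surj[OF v] by blast
      show ?thesis
        unfolding c sesquilinear_comb(2)[OF F fin comb_Vh[OF fin]] sesquilinear_comb(1)[OF F fin basis_Vh]
        using x by (intro sum.neutral) auto
    qed
    then have "comb x index_set K = (\<lambda>x. 0)" if "K \<in> \<T>" for K
      using ker[OF comb_Vh[OF fin]] that by blast
    then show "x j = 0" using j by (rule comb_inj)
  qed
  then obtain x where x: "\<And>i. i \<in> index_set \<Longrightarrow>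
      (\<Sum>j\<in>index_set. F (basis_fun j) (basis_fun i) * x j) = G (basis_fun i)" by blast
  define u where "u = comb x index_set"
  have u: "u \<in> Vh \<T>" unfolding u_def by (rule comb_Vh[OF fin])
  have sol: "F u v = G v" if v: "v \<in> Vh \<T>" for v
  proof -
    obtain c where c: "v = comb c index_set" using comb_surj[OF v] by blast
    show ?thesis
      unfolding c sesquilinear_comb(2)[OF F fin u] antilinear_comb[OF G fin]
      unfolding u_def sesquilinear_comb(1)[OF F fin basis_Vh]
      using x by (intro sum.cong) auto
  qed
  show ?thesis
  proof (rule ex1I[of _ u])
    show "u \<in> Vh \<T> \<and> (\<forall>v\<in>Vh \<T>. F u v = G v)" using u sol by blast
    fix w assume w: "w \<in> Vh \<T> \<and> (\<forall>v\<in>Vh \<T>. F w v = G v)"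
    have "F (lin (-1) u w) v = 0" if v: "v \<in> Vh \<T>" for v
    proof -
      have "F (lin (-1) u w) v = (-1) * F u v + F w v"
        using F u w v unfolding sesquilinear_def by blast
      then show ?thesis using sol[OF v] w v by simp
    qed
    then have z: "lin (-1) u w K = (\<lambda>x. 0)" if "K \<in> \<T>" for K
      using ker[OF lin_Vh[OF u]] w that by blast
    show "w = u"
    proof (rule PiE_ext[where k=\<T> and s="\<lambda>_. P1"])
      show "w \<in> \<T> \<rightarrow>\<^sub>E P1" "u \<in> \<T> \<rightarrow>\<^sub>E P1" using u w unfolding Vh_def by auto
      fix K assume K: "K \<in> \<T>"
      show "w K = u K"
      proof
        fix y show "w K y = u K y"
          using fun_cong[OF z[OF K], of y] by (simp add: lin_apply[OF K])
      qed
    qed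
  qed
qed

end

text \<open>An element may contain points outside the domain, where nothing is known about
  \<open>f\<close>. They form a null set, so \<open>f\<close> is compared with its extension by
  zero.\<close>

lemma (in domain_mesh) L2_fun_restrict_elem:
  assumes f: "L2_fun (lebesgue_on \<Omega>) f" and K: "K \<in> \<T>"
  shows "L2_fun (lebesgue_on K) f"
proof -
  define F where "F x = (if x \<in> \<Omega> then f x else 0)" for x
  have Km: "K \<in> sets lebesgue"
    using lmeasurable_compact[OF compact_elem[OF K]] by (simp add: fmeasurable_def)
  have neg: "negligible {x \<in> K. F x \<noteq> f x}"
    by (rule negligible_subset[OF negligible_closure_diff]) (use K cover in \<open>auto simp: F_def\<close>)
  have Fm: "F \<in> borel_measurable lebesgue"
    using f sets_lebesgue_domain unfolding L2_fun_def F_def by (simp add: borel_measurable_if)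
  have FK: "F \<in> borel_measurable (lebesgue_on K)"
    using Fm by (rule measurable_restrict_space1)
  have ae: "AE x in lebesgue_on K. F x = f x"
  proof -
    have "AE x in lebesgue. x \<notin> {x \<in> K. F x \<noteq> f x}"
      using neg by (intro AE_not_in) (simp add: negligible_iff_null_sets)
    then have "AE x in lebesgue. x \<in> K \<longrightarrow> F x = f x"
      by eventually_elim auto
    then show ?thesis using Km by (subst AE_restrict_space_iff) auto
  qed
  have fm: "f \<in> borel_measurable (lebesgue_on K)"
  proof (rule measurableI)
    fix A :: "complex set" assume A: "A \<in> sets borel"
    have "F -` A \<inter> K \<in> sets (lebesgue_on K)"
      using measurable_sets[OF FK A] by simp
    then have 1: "F -` A \<inter> K \<in> sets lebesgue" using Km by (simp add: sets_restrict_space_iff)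
    \<comment> \<open>Completeness of Lebesgue measure: arbitrary values of \<open>f\<close> on a
      null set do not spoil measurability.\<close>
    have 2: "N \<in> sets lebesgue" if "N \<subseteq> {x \<in> K. F x \<noteq> f x}" for N
      using negligible_subset[OF neg that] by (rule negligible_imp_sets)
    have "f -` A \<inter> K = (F -` A \<inter> K - {x \<in> K. F x \<noteq> f x}) \<union> (f -` A \<inter> {x \<in> K. F x \<noteq> f x})"
      by auto
    also have "\<dots> \<in> sets lebesgue"
      using 1 2 by (intro sets.Un sets.Diff) auto
    finally show "f -` A \<inter> space (lebesgue_on K) \<in> sets (lebesgue_on K)"
      using Km by (simp add: sets_restrict_space_iff)
  qed simp
  have "integrable lebesgue (\<lambda>x. indicator \<Omega> x *\<^sub>R (cmod (f x))\<^sup>2)"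
    using f sets_lebesgue_domain unfolding L2_fun_def by (simp add: integrable_restrict_space)
  moreover have "(\<lambda>x. indicator \<Omega> x *\<^sub>R (cmod (f x))\<^sup>2) = (\<lambda>x. (cmod (F x))\<^sup>2)"
    by (auto simp: F_def indicator_def)
  ultimately have "integrable lebesgue (\<lambda>x. (cmod (F x))\<^sup>2)" by simp
  then have "integrable lebesgue (\<lambda>x. indicator K x *\<^sub>R (cmod (F x))\<^sup>2)"
    using Km by (rule integrable_mult_indicator[rotated])
  then have "integrable (lebesgue_on K) (\<lambda>x. (cmod (F x))\<^sup>2)"
    using Km by (simp add: integrable_restrict_space)
  then have "integrable (lebesgue_on K) (\<lambda>x. (cmod (f x))\<^sup>2)"
    by (rule integrable_cong_AE_imp) (use fm ae in \<open>auto elim: eventually_mono\<close>)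
  then show ?thesis using fm unfolding L2_fun_def by blast
qed

lemma (in domain_mesh) antilinear_load:
  assumes f: "L2_fun (lebesgue_on \<Omega>) f"
    and g: "\<And>e. e \<in> faces_on \<T> \<Gamma>\<^sub>R \<Longrightarrow> L2_fun (face_measure e) g"
  shows "antilinear (\<lambda>v. mesh_inner \<T> (\<lambda>_. f) v + boundary_inner \<T> lab \<Gamma>\<^sub>R (\<lambda>_. g) v)"
  unfolding mesh_inner_def boundary_inner_def
  by (intro antilinear_add antilinear_sum antilinear_L2 L2_fun_restrict_elem[OF f] g
      L2_fun_elem L2_fun_face linear_op_elem up_elem faces_on_adj)

text \<open>Each summand of the form is a constant multiple of an \<open>L2_inner\<close> of two
  linear operators, so the closure rules suffice.\<close>

lemma (in helmholtz) sesquilinear_form: "sesquilinear form"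
proof -
  have face: "sesquilinear (\<lambda>u v. L2_inner (face_measure e) (A u) (B v))"
    if "adj e \<noteq> {}" "linear_op A" "linear_op B" for e A B
    using L2_fun_face[OF that(1)] that(2,3) by (rule sesquilinear_L2)
  have grad: "sesquilinear (\<lambda>u v. mesh_inner \<T> (pw_deriv i u) (pw_deriv i v))" for i
    unfolding mesh_inner_def
    by (rule sesquilinear_sum, rule sesquilinear_L2) (auto intro: L2_fun_elem linear_op_deriv)
  have consistency: "sesquilinear (\<lambda>u v. \<Sum>e\<in>faces_ID.
      L2_inner (face_measure e) (avg \<T> lab e (dn u e)) (jump \<T> lab e v)
      + of_real 1 * L2_inner (face_measure e) (jump \<T> lab e u) (avg \<T> lab e (dn v e)))"
  proof (rule sesquilinear_sum)
    fix e assume "e \<in> faces_ID"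
    note e = adj_ID[OF this]
    note ops = linear_op_avg_deriv[OF e] linear_op_jump[OF e]
    show "sesquilinear (\<lambda>u v. L2_inner (face_measure e) (avg \<T> lab e (dn u e)) (jump \<T> lab e v)
        + of_real 1 * L2_inner (face_measure e) (jump \<T> lab e u) (avg \<T> lab e (dn v e)))"
      by (rule sesquilinear_add[OF face[OF e ops] sesquilinear_cmult[OF face[OF e ops(2,1)]]])
  qed
  have J0: "sesquilinear (\<lambda>u v. J0 \<Gamma>\<^sub>D \<T> lab \<gamma>0 u v)"
    unfolding J0_def
    by (rule sesquilinear_sum, rule sesquilinear_cmult[OF face[OF _ linear_op_jump linear_op_jump]])
      (rule adj_ID, assumption)+
  have J1: "sesquilinear (\<lambda>u v. J1 \<Omega> \<T> lab \<gamma>1 u v)"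
    unfolding J1_def
    by (rule sesquilinear_sum, rule sesquilinear_cmult[OF face[OF _ linear_op_jump_deriv linear_op_jump_deriv]])
      (rule adj_ID, erule UnI1)+
  have L1: "sesquilinear (\<lambda>u v. L1 \<Gamma>\<^sub>D \<T> lab \<tau> \<beta>1 u v)"
    unfolding L1_def
    by (rule sesquilinear_sum, rule sesquilinear_sum,
        rule sesquilinear_cmult[OF face[OF _ linear_op_jump_deriv linear_op_jump_deriv]])
      (rule adj_ID, assumption)+
  have R: "sesquilinear (\<lambda>u v. boundary_inner \<T> lab \<Gamma>\<^sub>R u v)"
    unfolding boundary_inner_def
    by (rule sesquilinear_sum, rule face[OF _ linear_op_elem linear_op_elem])
      (assumption | rule adj_R up_elem)+
  show ?thesis
    unfolding form_def[abs_def] a_h_def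
    by (intro sesquilinear_add[OF sesquilinear_diff sesquilinear_cmult[OF R]]
        sesquilinear_add[OF sesquilinear_diff[OF sesquilinear_sum[OF grad] consistency]
          sesquilinear_cmult[OF sesquilinear_add[OF sesquilinear_add[OF J0 J1] L1]]]
        sesquilinear_cmult[OF sesquilinear_mesh_inner])
qed

theorem theorem4p4:
  fixes \<Omega>\<^sub>1 D \<Omega> \<Gamma>\<^sub>R \<Gamma>\<^sub>D :: "'a::euclidean_space set"
    and x\<^sub>0 :: 'a and c\<^sub>\<Omega> c\<^sub>D :: real
    and \<T> :: "'a set set" and lab :: "'a set \<Rightarrow> nat" and \<tau> :: "'a set \<Rightarrow> nat \<Rightarrow> 'a"
    and \<gamma>0 \<gamma>1 \<beta>1 :: "'a set \<Rightarrow> real" and k :: real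
    and f g :: "'a \<Rightarrow> complex"
  assumes dim: "DIM('a) \<in> {2, 3}"
    and domain: "open \<Omega>\<^sub>1" "connected \<Omega>\<^sub>1" "\<Omega>\<^sub>1 \<noteq> {}" "bounded \<Omega>\<^sub>1" "polyhedral_region \<Omega>\<^sub>1"
    and scatterer: "polyhedral_region D" "closure D \<subseteq> \<Omega>\<^sub>1"
    and \<Omega>: "\<Omega> = \<Omega>\<^sub>1 - D"
    and \<Gamma>\<^sub>R: "\<Gamma>\<^sub>R = frontier \<Omega>\<^sub>1"
    and \<Gamma>\<^sub>D: "\<Gamma>\<^sub>D = frontier D"
    and star_consts: "c\<^sub>\<Omega> > 0" "c\<^sub>D \<ge> 0"
    and star_R: "\<And>x n. x \<in> \<Gamma>\<^sub>R \<Longrightarrow> outward_normal \<Omega> x n \<Longrightarrow> (x - x\<^sub>0) \<bullet> n \<ge> c\<^sub>\<Omega>"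
    and star_D: "\<And>x n. x \<in> \<Gamma>\<^sub>D \<Longrightarrow> outward_normal D x n \<Longrightarrow> (x - x\<^sub>0) \<bullet> n \<ge> c\<^sub>D"
    and mesh: "mesh_of \<T> \<Omega>"
    and labels: "inj_on lab \<T>"
    and frames: "\<And>e. e \<in> interior_faces \<T> \<union> faces_on \<T> \<Gamma>\<^sub>D \<Longrightarrow> orthonormal_tangent_frame e (\<tau> e)"
    and gamma0: "\<And>e. e \<in> interior_faces \<T> \<union> faces_on \<T> \<Gamma>\<^sub>D \<Longrightarrow> \<gamma>0 e > 0"
    and gamma1: "\<And>e. e \<in> interior_faces \<T> \<Longrightarrow> \<gamma>1 e \<ge> 0"
    and beta1: "\<And>e. e \<in> interior_faces \<T> \<union> faces_on \<T> \<Gamma>\<^sub>D \<Longrightarrow> \<beta>1 e \<ge> 0"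
    and k: "k > 0"
    and f: "L2_fun (lebesgue_on \<Omega>) f"
    and g: "\<And>e. e \<in> faces_on \<T> \<Gamma>\<^sub>R \<Longrightarrow> L2_fun (face_measure e) g"
  shows "\<exists>!u. u \<in> Vh \<T> \<and>
    (\<forall>v\<in>Vh \<T>.
       a_h \<Omega> \<Gamma>\<^sub>D \<T> lab \<tau> 1 \<gamma>0 \<gamma>1 \<beta>1 u v
         - of_real (k\<^sup>2) * mesh_inner \<T> u v
         + \<i> * of_real k * boundary_inner \<T> lab \<Gamma>\<^sub>R u v
       = mesh_inner \<T> (\<lambda>_. f) v + boundary_inner \<T> lab \<Gamma>\<^sub>R (\<lambda>_. g) v)"
proof -
  have simp_mesh: "triangulation \<T>" "\<And>K. K \<in> \<T> \<Longrightarrow> int DIM('a) simplex K" "\<Union>\<T> = closure \<Omega>"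
    using mesh unfolding mesh_of_def by blast+
  have "helmholtz \<T> lab \<Omega>\<^sub>1 D \<Omega> \<Gamma>\<^sub>R \<Gamma>\<^sub>D x\<^sub>0 \<tau> \<gamma>0 \<gamma>1 \<beta>1 k"
  proof (unfold_locales)
    show "2 \<le> DIM('a)" using dim by auto
    show "0 \<le> (x - x\<^sub>0) \<bullet> n" if "x \<in> \<Gamma>\<^sub>R" "outward_normal \<Omega> x n" for x n
      using star_R[OF that] star_consts(1) by simp
    show "0 \<le> (x - x\<^sub>0) \<bullet> n" if "x \<in> \<Gamma>\<^sub>D" "outward_normal D x n" for x n
      using star_D[OF that] star_consts(2) by simp
  qed (fact simp_mesh labels domain(1,5) scatterer \<Omega> \<Gamma>\<^sub>R \<Gamma>\<^sub>D frames gamma0 gamma1 beta1 k)+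
  then interpret helmholtz \<T> lab \<Omega>\<^sub>1 D \<Omega> \<Gamma>\<^sub>R \<Gamma>\<^sub>D x\<^sub>0 \<tau> \<gamma>0 \<gamma>1 \<beta>1 k .
  have load: "antilinear (\<lambda>v. mesh_inner \<T> (\<lambda>_. f) v + boundary_inner \<T> lab \<Gamma>\<^sub>R (\<lambda>_. g) v)"
    by (rule antilinear_load[OF f]) (rule g)
  show ?thesis
    using unique_solution[OF sesquilinear_form load] form_kernel unfolding form_def by blast
qed

end
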